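(* Let $H : \mathcal{E}_1 \to \mathcal{E}_2$ be a cartesian (i.e. finite-limit-preserving) functor between extensive locally cartesian closed categories. If $\mathcal{E}_1$ and $\mathcal{E}_2$ have $W$-types, then so does the comma category $(\mathcal{E}_2 \downarrow H)$. Moreover, the projection $\pi_1 : (\mathcal{E}_2 \downarrow H) \to \mathcal{E}_1$ preserves $W$-types.
   Context: A locally cartesian closed category is a category with finite limits in which every pullback functor $f^* : \mathcal{E}/J \to \mathcal{E}/I$ (for $f : I \to J$) has a right adjoint $f_*$ (pushforward); the left adjoint of $f^*$ is denoted $f_!$. An extensive category is a category with finite coproducts such that for all objects $A, B$ the coproduct functor $\mathcal{E}/A \times \mathcal{E}/B \to \mathcal{E}/(A+B)$ is an equivalence. For an endofunctor $P$ on a category, a $P$-algebra is a pair $(X, s : PX \to X)$; a morphism $(X,s) \to (Y,t)$ is $h : X \to Y$ with $h \circ s = t \circ Ph$; $\mathrm{Alg}(P)$ is the resulting category and an initial $P$-algebra is an initial object of it. An endopolynomial on $I$ is a diagram $I \xleftarrow{h} A \xrightarrow{g} B \xrightarrow{f} I$; it determines $P_{f,g,h} = f_! g_* h^* : \mathcal{E}/I \to \mathcal{E}/I$. A locally cartesian closed category has $W$-types if $P_{f,g,h}$ has an initial algebra for every endopolynomial $(f,g,h)$ on every object $I$. A locally cartesian closed functor $K : \mathcal{E} \to \mathcal{F}$ is one preserving finite limits and pushforwards. For such $K$ and an endopolynomial $(f,g,h)$ on $I$, the functor $K/I : \mathcal{E}/I \to \mathcal{F}/KI$, $(u : X \to I)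 \mapsto Ku$, comes with a canonical natural isomorphism $\sigma : P_{Kf,Kg,Kh} \circ (K/I) \cong (K/I) \circ P_{f,g,h}$, hence induces a functor $\mathrm{Alg}(P_{f,g,h}) \to \mathrm{Alg}(P_{Kf,Kg,Kh})$, $(X,s) \mapsto ((K/I)X, (K/I)s \circ \sigma(X))$. If $\mathcal{E}$ and $\mathcal{F}$ have $W$-types, $K$ preserves $W$-types if this induced functor preserves initial objects for every endopolynomial in $\mathcal{E}$. Objects of $(\mathcal{E}_2 \downarrow H)$ are triples $(X_1, X_2, x : X_2 \to HX_1)$ with $X_i \in \mathcal{E}_i$, and $\pi_1$ sends such a triple to $X_1$. This comma category is isomorphic to the category of coalgebras for the cartesian comonad $(X_1,X_2) \mapsto (X_1, HX_1 \times X_2)$ on $\mathcal{E}_1 \times \mathcal{E}_2$; it is locally cartesian closed and $\pi_1$ is a locally cartesian closed functor. *)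

theory Defs
  imports Main
begin

section \<open>Categories, functors, natural transformations\<close>

text \<open>
  A category is given by a carrier set of objects and a carrier set of arrows.  Nothing is
  said about the values of the operations outside the carriers.
\<close>

record ('o, 'a) cat =
  Obj :: "'o set"
  Arr :: "'a set"
  Dom :: "'a \<Rightarrow> 'o"
  Cod :: "'a \<Rightarrow> 'o"
  Ident :: "'o \<Rightarrow> 'a"
  Cmp :: "'a \<Rightarrow> 'a \<Rightarrow> 'a"  (infixl "\<cdot>\<index>" 70)

definition hom :: "('o, 'a, 'r) cat_scheme \<Rightarrow> 'o \<Rightarrow> 'o \<Rightarrow> 'a set" where
  "hom C X Y = {f \<in> Arr C. Dom C f = X \<and> Cod C f = Y}"

locale category =
  fixes C :: "('o, 'a) cat" (structure)
  assumes dom_obj: "f \<in> Arr C \<Longrightarrow> Dom C f \<in> Obj C"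
    and cod_obj: "f \<in> Arr C \<Longrightarrow> Cod C f \<in> Obj C"
    and ident_hom: "X \<in> Obj C \<Longrightarrow> Ident C X \<in> hom C X X"
    and cmp_hom: "f \<in> hom C X Y \<Longrightarrow> g \<in> hom C Y Z \<Longrightarrow> g \<cdot> f \<in> hom C X Z"
    and cmp_ident_right: "f \<in> hom C X Y \<Longrightarrow> f \<cdot> Ident C X = f"
    and cmp_ident_left: "f \<in> hom C X Y \<Longrightarrow> Ident C Y \<cdot> f = f"
    and cmp_assoc: "f \<in> hom C W X \<Longrightarrow> g \<in> hom C X Y \<Longrightarrow> h \<in> hom C Y Z
      \<Longrightarrow> h \<cdot> (g \<cdot> f) = (h \<cdot> g) \<cdot> f"

definition inverse_arrows :: "('o, 'a) cat \<Rightarrow> 'a \<Rightarrow> 'a \<Rightarrow> bool" where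
  "inverse_arrows C f g \<longleftrightarrow> f \<in> Arr C \<and> g \<in> hom C (Cod C f) (Dom C f) \<and>
     g \<cdot>\<^bsub>C\<^esub> f = Ident C (Dom C f) \<and> f \<cdot>\<^bsub>C\<^esub> g = Ident C (Cod C f)"

definition is_iso :: "('o, 'a) cat \<Rightarrow> 'a \<Rightarrow> bool" where
  "is_iso C f \<longleftrightarrow> (\<exists>g. inverse_arrows C f g)"

definition inv_arr :: "('o, 'a) cat \<Rightarrow> 'a \<Rightarrow> 'a" where
  "inv_arr C f = (THE g. inverse_arrows C f g)"

definition initial :: "('o, 'a) cat \<Rightarrow> 'o \<Rightarrow> bool" where
  "initial C X \<longleftrightarrow> X \<in> Obj C \<and> (\<forall>Y \<in> Obj C. \<exists>!f. f \<in> hom C X Y)"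

record ('o1, 'a1, 'o2, 'a2) func =
  OMap :: "'o1 \<Rightarrow> 'o2"
  AMap :: "'a1 \<Rightarrow> 'a2"

definition is_functor ::
  "('o1, 'a1) cat \<Rightarrow> ('o2, 'a2) cat \<Rightarrow> ('o1, 'a1, 'o2, 'a2) func \<Rightarrow> bool" where
  "is_functor C D F \<longleftrightarrow> category C \<and> category D \<and>
     (\<forall>X \<in> Obj C. OMap F X \<in> Obj D) \<and>
     (\<forall>f \<in> Arr C. AMap F f \<in> hom D (OMap F (Dom C f)) (OMap F (Cod C f))) \<and>
     (\<forall>X \<in> Obj C. AMap F (Ident C X) = Ident D (OMap F X)) \<and>
     (\<forall>f \<in> Arr C. \<forall>g \<in> Arr C. Dom C g = Cod C f \<longrightarrow>
        AMap F (g \<cdot>\<^bsub>C\<^esub> f) = AMap F g \<cdot>\<^bsub>D\<^esub> AMap F f)"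

definition id_func :: "('o, 'a, 'o, 'a) func" where
  "id_func = \<lparr>OMap = (\<lambda>X. X), AMap = (\<lambda>f. f)\<rparr>"

definition comp_func ::
  "('o2, 'a2, 'o3, 'a3) func \<Rightarrow> ('o1, 'a1, 'o2, 'a2) func \<Rightarrow> ('o1, 'a1, 'o3, 'a3) func"
  (infixr "\<odot>" 75) where
  "G \<odot> F = \<lparr>OMap = (\<lambda>X. OMap G (OMap F X)), AMap = (\<lambda>f. AMap G (AMap F f))\<rparr>"

definition nat_trans ::
  "('o1, 'a1) cat \<Rightarrow> ('o2, 'a2) cat \<Rightarrow> ('o1, 'a1, 'o2, 'a2) func \<Rightarrow>
   ('o1, 'a1, 'o2, 'a2) func \<Rightarrow> ('o1 \<Rightarrow> 'a2) \<Rightarrow> bool" where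
  "nat_trans C D F G \<tau> \<longleftrightarrow> is_functor C D F \<and> is_functor C D G \<and>
     (\<forall>X \<in> Obj C. \<tau> X \<in> hom D (OMap F X) (OMap G X)) \<and>
     (\<forall>f \<in> Arr C. AMap G f \<cdot>\<^bsub>D\<^esub> \<tau> (Dom C f) = \<tau> (Cod C f) \<cdot>\<^bsub>D\<^esub> AMap F f)"

definition nat_iso ::
  "('o1, 'a1) cat \<Rightarrow> ('o2, 'a2) cat \<Rightarrow> ('o1, 'a1, 'o2, 'a2) func \<Rightarrow>
   ('o1, 'a1, 'o2, 'a2) func \<Rightarrow> ('o1 \<Rightarrow> 'a2) \<Rightarrow> bool" where
  "nat_iso C D F G \<tau> \<longleftrightarrow> nat_trans C D F G \<tau> \<and> (\<forall>X \<in> Obj C. is_iso D (\<tau> X))"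

definition is_equivalence ::
  "('o1, 'a1) cat \<Rightarrow> ('o2, 'a2) cat \<Rightarrow> ('o1, 'a1, 'o2, 'a2) func \<Rightarrow> bool" where
  "is_equivalence C D F \<longleftrightarrow> is_functor C D F \<and>
     (\<exists>G \<eta> \<epsilon>. is_functor D C G \<and> nat_iso C C id_func (G \<odot> F) \<eta> \<and>
        nat_iso D D (F \<odot> G) id_func \<epsilon>)"

text \<open>
  \<open>G\<close> is right adjoint to \<open>F\<close> with counit \<open>\<epsilon>\<close>: every component of the counit is a universal
  arrow from \<open>F\<close>.
\<close>

definition right_adjoint ::
  "('o1, 'a1) cat \<Rightarrow> ('o2, 'a2) cat \<Rightarrow> ('o1, 'a1, 'o2, 'a2) func \<Rightarrow>
   ('o2, 'a2, 'o1, 'a1) func \<Rightarrow> ('o2 \<Rightarrow> 'a2) \<Rightarrow> bool" where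
  "right_adjoint C D F G \<epsilon> \<longleftrightarrow> is_functor C D F \<and> is_functor D C G \<and>
     nat_trans D D (F \<odot> G) id_func \<epsilon> \<and>
     (\<forall>X \<in> Obj C. \<forall>Y \<in> Obj D. \<forall>k \<in> hom D (OMap F X) Y.
        \<exists>!h. h \<in> hom C X (OMap G Y) \<and> \<epsilon> Y \<cdot>\<^bsub>D\<^esub> AMap F h = k)"

section \<open>Finite limits and finite coproducts\<close>

definition cone ::
  "('j, 'b) cat \<Rightarrow> ('o, 'a) cat \<Rightarrow> ('j, 'b, 'o, 'a) func \<Rightarrow> 'o \<Rightarrow> ('j \<Rightarrow> 'a) \<Rightarrow> bool" where
  "cone J C D X \<pi> \<longleftrightarrow> X \<in> Obj C \<and> (\<forall>j \<in> Obj J. \<pi> j \<in> hom C X (OMap D j)) \<and>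
     (\<forall>b \<in> Arr J. AMap D b \<cdot>\<^bsub>C\<^esub> \<pi> (Dom J b) = \<pi> (Cod J b))"

definition limit_cone ::
  "('j, 'b) cat \<Rightarrow> ('o, 'a) cat \<Rightarrow> ('j, 'b, 'o, 'a) func \<Rightarrow> 'o \<Rightarrow> ('j \<Rightarrow> 'a) \<Rightarrow> bool" where
  "limit_cone J C D L \<pi> \<longleftrightarrow> cone J C D L \<pi> \<and>
     (\<forall>X \<rho>. cone J C D X \<rho> \<longrightarrow>
        (\<exists>!m. m \<in> hom C X L \<and> (\<forall>j \<in> Obj J. \<pi> j \<cdot>\<^bsub>C\<^esub> m = \<rho> j)))"

text \<open>
  Every finite category is isomorphic to one whose objects and arrows are natural numbers, so
  the shapes of finite diagrams may be taken of this type.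
\<close>

definition finite_shape :: "(nat, nat) cat \<Rightarrow> bool" where
  "finite_shape J \<longleftrightarrow> category J \<and> finite (Obj J) \<and> finite (Arr J)"

definition has_finite_limits :: "('o, 'a) cat \<Rightarrow> bool" where
  "has_finite_limits C \<longleftrightarrow>
     (\<forall>J D. finite_shape J \<and> is_functor J C D \<longrightarrow> (\<exists>L \<pi>. limit_cone J C D L \<pi>))"

definition preserves_finite_limits ::
  "('o1, 'a1) cat \<Rightarrow> ('o2, 'a2) cat \<Rightarrow> ('o1, 'a1, 'o2, 'a2) func \<Rightarrow> bool" where
  "preserves_finite_limits C C' F \<longleftrightarrow>
     (\<forall>J D L \<pi>. finite_shape J \<and> is_functor J C D \<and> limit_cone J C D L \<pi> \<longrightarrow>
        limit_cone J C' (F \<odot> D) (OMap F L) (\<lambda>j. AMap F (\<pi> j)))"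

definition cartesian_functor ::
  "('o1, 'a1) cat \<Rightarrow> ('o2, 'a2) cat \<Rightarrow> ('o1, 'a1, 'o2, 'a2) func \<Rightarrow> bool" where
  "cartesian_functor C D F \<longleftrightarrow> is_functor C D F \<and> preserves_finite_limits C D F"

definition is_coproduct ::
  "('o, 'a) cat \<Rightarrow> 'i set \<Rightarrow> ('i \<Rightarrow> 'o) \<Rightarrow> 'o \<Rightarrow> ('i \<Rightarrow> 'a) \<Rightarrow> bool" where
  "is_coproduct C I A S \<iota> \<longleftrightarrow> S \<in> Obj C \<and> (\<forall>i \<in> I. \<iota> i \<in> hom C (A i) S) \<and>
     (\<forall>Y c. Y \<in> Obj C \<and> (\<forall>i \<in> I. c i \<in> hom C (A i) Y) \<longrightarrow>
        (\<exists>!m. m \<in> hom C S Y \<and> (\<forall>i \<in> I. m \<cdot>\<^bsub>C\<^esub> \<iota> i = c i)))"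

definition has_finite_coproducts :: "('o, 'a) cat \<Rightarrow> bool" where
  "has_finite_coproducts C \<longleftrightarrow>
     (\<forall>(I :: nat set) A. finite I \<and> (\<forall>i \<in> I. A i \<in> Obj C) \<longrightarrow> (\<exists>S \<iota>. is_coproduct C I A S \<iota>))"

section \<open>Slice categories and products of categories\<close>

text \<open>
  An arrow \<open>k\<close> from \<open>u\<close> to \<open>v\<close> in a slice is recorded together with its source and target, as
  the triple \<open>(u, k, v)\<close>.  The same convention is used for algebras and comma categories.
\<close>

definition slice :: "('o, 'a) cat \<Rightarrow> 'o \<Rightarrow> ('a, 'a \<times> 'a \<times> 'a) cat" where
  "slice C I = \<lparr>
     Obj = {u \<in> Arr C. Cod C u = I},
     Arr = {(u, k, v). u \<in> Arr C \<and> Cod C u = I \<and> v \<in> Arr C \<and> Cod C v = I \<and>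
       k \<in> hom C (Dom C u) (Dom C v) \<and> v \<cdot>\<^bsub>C\<^esub> k = u},
     Dom = (\<lambda>(u, k, v). u),
     Cod = (\<lambda>(u, k, v). v),
     Ident = (\<lambda>u. (u, Ident C (Dom C u), u)),
     Cmp = (\<lambda>(v, l, w) (u, k, v'). (u, l \<cdot>\<^bsub>C\<^esub> k, w))\<rparr>"

definition slice_func ::
  "('o1, 'a1, 'o2, 'a2) func \<Rightarrow> ('a1, 'a1 \<times> 'a1 \<times> 'a1, 'a2, 'a2 \<times> 'a2 \<times> 'a2) func" where
  "slice_func K = \<lparr>OMap = AMap K, AMap = (\<lambda>(u, k, v). (AMap K u, AMap K k, AMap K v))\<rparr>"

definition prod_cat :: "('o1, 'a1) cat \<Rightarrow> ('o2, 'a2) cat \<Rightarrow> ('o1 \<times> 'o2, 'a1 \<times> 'a2) cat" where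
  "prod_cat C D = \<lparr>
     Obj = Obj C \<times> Obj D,
     Arr = Arr C \<times> Arr D,
     Dom = (\<lambda>(f, g). (Dom C f, Dom D g)),
     Cod = (\<lambda>(f, g). (Cod C f, Cod D g)),
     Ident = (\<lambda>(X, Y). (Ident C X, Ident D Y)),
     Cmp = (\<lambda>(f', g') (f, g). (f' \<cdot>\<^bsub>C\<^esub> f, g' \<cdot>\<^bsub>D\<^esub> g))\<rparr>"

section \<open>Extensive categories\<close>

text \<open>
  Binary coproducts are coproducts indexed by the booleans, \<open>True\<close> being the left summand;
  \<open>coprod\<close> is a choice of one, with object \<open>coprod_obj\<close> and injections \<open>coprod_in\<close>.
\<close>

definition coprod :: "('o, 'a) cat \<Rightarrow> 'o \<Rightarrow> 'o \<Rightarrow> 'o \<times> (bool \<Rightarrow> 'a)" where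
  "coprod C A B = (SOME (S, \<iota>). is_coproduct C UNIV (\<lambda>b. if b then A else B) S \<iota>)"

definition coprod_obj :: "('o, 'a) cat \<Rightarrow> 'o \<Rightarrow> 'o \<Rightarrow> 'o" where
  "coprod_obj C A B = fst (coprod C A B)"

definition coprod_in :: "('o, 'a) cat \<Rightarrow> 'o \<Rightarrow> 'o \<Rightarrow> bool \<Rightarrow> 'a" where
  "coprod_in C A B = snd (coprod C A B)"

definition copair :: "('o, 'a) cat \<Rightarrow> 'a \<Rightarrow> 'a \<Rightarrow> 'a" where
  "copair C f g = (THE m. m \<in> hom C (coprod_obj C (Dom C f) (Dom C g)) (Cod C f) \<and>
     m \<cdot>\<^bsub>C\<^esub> coprod_in C (Dom C f) (Dom C g) True = f \<and>
     m \<cdot>\<^bsub>C\<^esub> coprod_in C (Dom C f) (Dom C g) False = g)"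

definition coprod_arr :: "('o, 'a) cat \<Rightarrow> 'a \<Rightarrow> 'a \<Rightarrow> 'a" where
  "coprod_arr C f g = copair C
     (coprod_in C (Cod C f) (Cod C g) True \<cdot>\<^bsub>C\<^esub> f) (coprod_in C (Cod C f) (Cod C g) False \<cdot>\<^bsub>C\<^esub> g)"

definition coprod_func ::
  "('o, 'a) cat \<Rightarrow>
   ('a \<times> 'a, ('a \<times> 'a \<times> 'a) \<times> ('a \<times> 'a \<times> 'a), 'a, 'a \<times> 'a \<times> 'a) func" where
  "coprod_func C = \<lparr>
     OMap = (\<lambda>(u, v). coprod_arr C u v),
     AMap = (\<lambda>((u, k, u'), (v, l, v')).
       (coprod_arr C u v, coprod_arr C k l, coprod_arr C u' v'))\<rparr>"

definition extensive :: "('o, 'a) cat \<Rightarrow> bool" where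
  "extensive C \<longleftrightarrow> category C \<and> has_finite_coproducts C \<and>
     (\<forall>A \<in> Obj C. \<forall>B \<in> Obj C.
        is_equivalence (prod_cat (slice C A) (slice C B)) (slice C (coprod_obj C A B))
          (coprod_func C))"

section \<open>Pullback functors, pushforwards and local cartesian closure\<close>

definition is_pullback :: "('o, 'a) cat \<Rightarrow> 'a \<Rightarrow> 'a \<Rightarrow> 'a \<Rightarrow> 'a \<Rightarrow> bool" where
  "is_pullback C f u p q \<longleftrightarrow>
     f \<in> Arr C \<and> u \<in> Arr C \<and> Cod C f = Cod C u \<and>
     p \<in> Arr C \<and> q \<in> hom C (Dom C p) (Dom C u) \<and> Cod C p = Dom C f \<and>
     f \<cdot>\<^bsub>C\<^esub> p = u \<cdot>\<^bsub>C\<^esub> q \<and>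
     (\<forall>X. \<forall>a \<in> hom C X (Dom C f). \<forall>b \<in> hom C X (Dom C u). f \<cdot>\<^bsub>C\<^esub> a = u \<cdot>\<^bsub>C\<^esub> b \<longrightarrow>
        (\<exists>!m. m \<in> hom C X (Dom C p) \<and> p \<cdot>\<^bsub>C\<^esub> m = a \<and> q \<cdot>\<^bsub>C\<^esub> m = b))"

definition pb :: "('o, 'a) cat \<Rightarrow> 'a \<Rightarrow> 'a \<Rightarrow> 'a \<times> 'a" where
  "pb C f u = (SOME (p, q). is_pullback C f u p q)"

definition pb1 :: "('o, 'a) cat \<Rightarrow> 'a \<Rightarrow> 'a \<Rightarrow> 'a" where
  "pb1 C f u = fst (pb C f u)"

definition pb2 :: "('o, 'a) cat \<Rightarrow> 'a \<Rightarrow> 'a \<Rightarrow> 'a" where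
  "pb2 C f u = snd (pb C f u)"

definition pb_pair :: "('o, 'a) cat \<Rightarrow> 'a \<Rightarrow> 'a \<Rightarrow> 'a \<Rightarrow> 'a \<Rightarrow> 'a" where
  "pb_pair C f u a b = (THE m. m \<in> hom C (Dom C a) (Dom C (pb1 C f u)) \<and>
     pb1 C f u \<cdot>\<^bsub>C\<^esub> m = a \<and> pb2 C f u \<cdot>\<^bsub>C\<^esub> m = b)"

text \<open>The functors \<open>f\<^sup>*\<close> and \<open>f\<^sub>!\<close> between slices.\<close>

definition pullback_func ::
  "('o, 'a) cat \<Rightarrow> 'a \<Rightarrow> ('a, 'a \<times> 'a \<times> 'a, 'a, 'a \<times> 'a \<times> 'a) func" where
  "pullback_func C f = \<lparr>
     OMap = (\<lambda>u. pb1 C f u),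
     AMap = (\<lambda>(u, k, v).
       (pb1 C f u, pb_pair C f v (pb1 C f u) (k \<cdot>\<^bsub>C\<^esub> pb2 C f u), pb1 C f v))\<rparr>"

definition postcomp_func ::
  "('o, 'a) cat \<Rightarrow> 'a \<Rightarrow> ('a, 'a \<times> 'a \<times> 'a, 'a, 'a \<times> 'a \<times> 'a) func" where
  "postcomp_func C f = \<lparr>
     OMap = (\<lambda>u. f \<cdot>\<^bsub>C\<^esub> u),
     AMap = (\<lambda>(u, k, v). (f \<cdot>\<^bsub>C\<^esub> u, k, f \<cdot>\<^bsub>C\<^esub> v))\<rparr>"

definition lccc :: "('o, 'a) cat \<Rightarrow> bool" where
  "lccc C \<longleftrightarrow> category C \<and> has_finite_limits C \<and>
     (\<forall>f \<in> Arr C. \<exists>G \<epsilon>.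
        right_adjoint (slice C (Cod C f)) (slice C (Dom C f)) (pullback_func C f) G \<epsilon>)"

text \<open>A choice of pushforward functor \<open>f\<^sub>*\<close> together with its counit.\<close>

definition pushforward ::
  "('o, 'a) cat \<Rightarrow> 'a \<Rightarrow>
   ('a, 'a \<times> 'a \<times> 'a, 'a, 'a \<times> 'a \<times> 'a) func \<times> ('a \<Rightarrow> 'a \<times> 'a \<times> 'a)" where
  "pushforward C f = (SOME (G, \<epsilon>).
     right_adjoint (slice C (Cod C f)) (slice C (Dom C f)) (pullback_func C f) G \<epsilon>)"

definition pushforward_func ::
  "('o, 'a) cat \<Rightarrow> 'a \<Rightarrow> ('a, 'a \<times> 'a \<times> 'a, 'a, 'a \<times> 'a \<times> 'a) func" where
  "pushforward_func C f = fst (pushforward C f)"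

definition pushforward_counit :: "('o, 'a) cat \<Rightarrow> 'a \<Rightarrow> 'a \<Rightarrow> 'a \<times> 'a \<times> 'a" where
  "pushforward_counit C f = snd (pushforward C f)"

text \<open>The transpose \<open>w \<rightarrow> f\<^sub>* v\<close> of an arrow \<open>k : f\<^sup>* w \<rightarrow> v\<close>.\<close>

definition pushforward_transpose ::
  "('o, 'a) cat \<Rightarrow> 'a \<Rightarrow> 'a \<Rightarrow> 'a \<Rightarrow> 'a \<times> 'a \<times> 'a \<Rightarrow> 'a \<times> 'a \<times> 'a" where
  "pushforward_transpose C f w v k =
     (THE h. h \<in> hom (slice C (Cod C f)) w (OMap (pushforward_func C f) v) \<and>
        pushforward_counit C f v \<cdot>\<^bsub>slice C (Dom C f)\<^esub> AMap (pullback_func C f) h = k)"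

section \<open>Locally cartesian closed functors\<close>

text \<open>
  For a functor \<open>K\<close> from \<open>C\<close> to \<open>D\<close> that preserves pullbacks, the canonical comparison
  \<open>K (f\<^sup>* u) \<rightarrow> (K f)\<^sup>* (K u)\<close> is invertible, and the canonical comparison
  \<open>K (f\<^sub>* v) \<rightarrow> (K f)\<^sub>* (K v)\<close> is the transpose of the composite
  \<open>(K f)\<^sup>* (K (f\<^sub>* v)) \<cong> K (f\<^sup>* (f\<^sub>* v)) \<rightarrow> K v\<close>, whose second factor is \<open>K\<close> applied to the counit.
\<close>

definition pullback_comparison ::
  "('o1, 'a1) cat \<Rightarrow> ('o2, 'a2) cat \<Rightarrow> ('o1, 'a1, 'o2, 'a2) func \<Rightarrow> 'a1 \<Rightarrow> 'a1 \<Rightarrow>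
   'a2 \<times> 'a2 \<times> 'a2" where
  "pullback_comparison C D K f u =
     (AMap K (pb1 C f u),
      pb_pair D (AMap K f) (AMap K u) (AMap K (pb1 C f u)) (AMap K (pb2 C f u)),
      pb1 D (AMap K f) (AMap K u))"

definition pushforward_comparison ::
  "('o1, 'a1) cat \<Rightarrow> ('o2, 'a2) cat \<Rightarrow> ('o1, 'a1, 'o2, 'a2) func \<Rightarrow> 'a1 \<Rightarrow> 'a1 \<Rightarrow>
   'a2 \<times> 'a2 \<times> 'a2" where
  "pushforward_comparison C D K f v =
     (let S = slice D (OMap K (Dom C f)); w = OMap (pushforward_func C f) v in
      pushforward_transpose D (AMap K f) (AMap K w) (AMap K v)
        (AMap (slice_func K) (pushforward_counit C f v) \<cdot>\<^bsub>S\<^esub>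
         inv_arr S (pullback_comparison C D K f w)))"

definition preserves_pushforwards ::
  "('o1, 'a1) cat \<Rightarrow> ('o2, 'a2) cat \<Rightarrow> ('o1, 'a1, 'o2, 'a2) func \<Rightarrow> bool" where
  "preserves_pushforwards C D K \<longleftrightarrow>
     (\<forall>f \<in> Arr C. \<forall>v \<in> Obj (slice C (Dom C f)).
        is_iso (slice D (OMap K (Cod C f))) (pushforward_comparison C D K f v))"

definition lcc_functor ::
  "('o1, 'a1) cat \<Rightarrow> ('o2, 'a2) cat \<Rightarrow> ('o1, 'a1, 'o2, 'a2) func \<Rightarrow> bool" where
  "lcc_functor C D K \<longleftrightarrow> lccc C \<and> lccc D \<and> is_functor C D K \<and>
     preserves_finite_limits C D K \<and> preserves_pushforwards C D K"

section \<open>Polynomial functors, algebras and W-types\<close>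

definition endopolynomial :: "('o, 'a) cat \<Rightarrow> 'o \<Rightarrow> 'a \<Rightarrow> 'a \<Rightarrow> 'a \<Rightarrow> bool" where
  "endopolynomial C I f g h \<longleftrightarrow>
     (\<exists>A \<in> Obj C. \<exists>B \<in> Obj C. h \<in> hom C A I \<and> g \<in> hom C A B \<and> f \<in> hom C B I)"

definition poly_func ::
  "('o, 'a) cat \<Rightarrow> 'a \<Rightarrow> 'a \<Rightarrow> 'a \<Rightarrow> ('a, 'a \<times> 'a \<times> 'a, 'a, 'a \<times> 'a \<times> 'a) func" where
  "poly_func C f g h = postcomp_func C f \<odot> pushforward_func C g \<odot> pullback_func C h"

definition Alg ::
  "('o, 'a) cat \<Rightarrow> ('o, 'a, 'o, 'a) func \<Rightarrow> ('o \<times> 'a, ('o \<times> 'a) \<times> 'a \<times> ('o \<times> 'a)) cat" where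
  "Alg C P = \<lparr>
     Obj = {(X, s). X \<in> Obj C \<and> s \<in> hom C (OMap P X) X},
     Arr = {((X, s), h, (Y, t)). X \<in> Obj C \<and> s \<in> hom C (OMap P X) X \<and>
       Y \<in> Obj C \<and> t \<in> hom C (OMap P Y) Y \<and> h \<in> hom C X Y \<and> h \<cdot>\<^bsub>C\<^esub> s = t \<cdot>\<^bsub>C\<^esub> AMap P h},
     Dom = (\<lambda>(a, h, b). a),
     Cod = (\<lambda>(a, h, b). b),
     Ident = (\<lambda>(X, s). ((X, s), Ident C X, (X, s))),
     Cmp = (\<lambda>(b, k, c) (a, h, b'). (a, k \<cdot>\<^bsub>C\<^esub> h, c))\<rparr>"

definition has_W_types :: "('o, 'a) cat \<Rightarrow> bool" where
  "has_W_types C \<longleftrightarrow> lccc C \<and>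
     (\<forall>I \<in> Obj C. \<forall>f g h. endopolynomial C I f g h \<longrightarrow>
        (\<exists>W. initial (Alg (slice C I) (poly_func C f g h)) W))"

text \<open>
  The isomorphism \<open>\<sigma>\<close> at \<open>u\<close>, from \<open>P\<^sub>K (K u)\<close> to \<open>K (P u)\<close> for \<open>P\<close> and \<open>P\<^sub>K\<close> the polynomial functors of
  \<open>(f, g, h)\<close> and \<open>(K f, K g, K h)\<close>.  It is the inverse of the image under \<open>(K f)\<^sub>!\<close> of the composite
  \<open>K (g\<^sub>* (h\<^sup>* u)) \<rightarrow> (K g)\<^sub>* (K (h\<^sup>* u)) \<rightarrow> (K g)\<^sub>* ((K h)\<^sup>* (K u))\<close> of canonical comparisons;
  note that \<open>(K f)\<^sub>!\<close> and \<open>f\<^sub>!\<close> commute strictly with \<open>K\<close>.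
\<close>

definition poly_iso ::
  "('o1, 'a1) cat \<Rightarrow> ('o2, 'a2) cat \<Rightarrow> ('o1, 'a1, 'o2, 'a2) func \<Rightarrow>
   'a1 \<Rightarrow> 'a1 \<Rightarrow> 'a1 \<Rightarrow> 'a1 \<Rightarrow> 'a2 \<times> 'a2 \<times> 'a2" where
  "poly_iso C D K f g h u =
     inv_arr (slice D (OMap K (Cod C f)))
       (AMap (postcomp_func D (AMap K f))
         (AMap (pushforward_func D (AMap K g)) (pullback_comparison C D K h u)
          \<cdot>\<^bsub>slice D (OMap K (Cod C g))\<^esub>
          pushforward_comparison C D K g (OMap (pullback_func C h) u)))"

definition alg_func ::
  "('o1, 'a1) cat \<Rightarrow> ('o2, 'a2) cat \<Rightarrow> ('o1, 'a1, 'o2, 'a2) func \<Rightarrow> 'a1 \<Rightarrow> 'a1 \<Rightarrow> 'a1 \<Rightarrow>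
   ('a1 \<times> ('a1 \<times> 'a1 \<times> 'a1),
    ('a1 \<times> ('a1 \<times> 'a1 \<times> 'a1)) \<times> ('a1 \<times> 'a1 \<times> 'a1) \<times> ('a1 \<times> ('a1 \<times> 'a1 \<times> 'a1)),
    'a2 \<times> ('a2 \<times> 'a2 \<times> 'a2),
    ('a2 \<times> ('a2 \<times> 'a2 \<times> 'a2)) \<times> ('a2 \<times> 'a2 \<times> 'a2) \<times> ('a2 \<times> ('a2 \<times> 'a2 \<times> 'a2))) func" where
  "alg_func C D K f g h =
     (let S = slice D (OMap K (Cod C f));
          A = (\<lambda>(u, s). (OMap (slice_func K) u,
                 AMap (slice_func K) s \<cdot>\<^bsub>S\<^esub> poly_iso C D K f g h u)) in
      \<lparr>OMap = A, AMap = (\<lambda>(a, k, b). (A a, AMap (slice_func K) k, A b))\<rparr>)"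

definition preserves_initial ::
  "('o1, 'a1) cat \<Rightarrow> ('o2, 'a2) cat \<Rightarrow> ('o1, 'a1, 'o2, 'a2) func \<Rightarrow> bool" where
  "preserves_initial C D F \<longleftrightarrow> (\<forall>X. initial C X \<longrightarrow> initial D (OMap F X))"

definition preserves_W_types ::
  "('o1, 'a1) cat \<Rightarrow> ('o2, 'a2) cat \<Rightarrow> ('o1, 'a1, 'o2, 'a2) func \<Rightarrow> bool" where
  "preserves_W_types C D K \<longleftrightarrow> lcc_functor C D K \<and>
     (\<forall>I \<in> Obj C. \<forall>f g h. endopolynomial C I f g h \<longrightarrow>
        preserves_initial
          (Alg (slice C I) (poly_func C f g h))
          (Alg (slice D (OMap K I)) (poly_func D (AMap K f) (AMap K g) (AMap K h)))
          (alg_func C D K f g h))"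

section \<open>The comma category\<close>

text \<open>
  Here \<open>comma E1 E2 H\<close> is \<open>(E2 \<down> H)\<close> for a functor \<open>H\<close> from \<open>E1\<close> to \<open>E2\<close>.
\<close>

definition comma_obj ::
  "('o1, 'a1) cat \<Rightarrow> ('o2, 'a2) cat \<Rightarrow> ('o1, 'a1, 'o2, 'a2) func \<Rightarrow> ('o1 \<times> 'o2 \<times> 'a2) set" where
  "comma_obj E1 E2 H =
     {(X1, X2, x). X1 \<in> Obj E1 \<and> X2 \<in> Obj E2 \<and> x \<in> hom E2 X2 (OMap H X1)}"

definition comma ::
  "('o1, 'a1) cat \<Rightarrow> ('o2, 'a2) cat \<Rightarrow> ('o1, 'a1, 'o2, 'a2) func \<Rightarrow>
   ('o1 \<times> 'o2 \<times> 'a2, ('o1 \<times> 'o2 \<times> 'a2) \<times> ('a1 \<times> 'a2) \<times> ('o1 \<times> 'o2 \<times> 'a2)) cat" where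
  "comma E1 E2 H = \<lparr>
     Obj = comma_obj E1 E2 H,
     Arr = {((X1, X2, x), (k1, k2), (Y1, Y2, y)).
       (X1, X2, x) \<in> comma_obj E1 E2 H \<and> (Y1, Y2, y) \<in> comma_obj E1 E2 H \<and>
       k1 \<in> hom E1 X1 Y1 \<and> k2 \<in> hom E2 X2 Y2 \<and> y \<cdot>\<^bsub>E2\<^esub> k2 = AMap H k1 \<cdot>\<^bsub>E2\<^esub> x},
     Dom = (\<lambda>(a, k, b). a),
     Cod = (\<lambda>(a, k, b). b),
     Ident = (\<lambda>(X1, X2, x). ((X1, X2, x), (Ident E1 X1, Ident E2 X2), (X1, X2, x))),
     Cmp = (\<lambda>(b, (l1, l2), c) (a, (k1, k2), b'). (a, (l1 \<cdot>\<^bsub>E1\<^esub> k1, l2 \<cdot>\<^bsub>E2\<^esub> k2), c))\<rparr>"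

definition comma_proj1 ::
  "('o1 \<times> 'o2 \<times> 'a2, ('o1 \<times> 'o2 \<times> 'a2) \<times> ('a1 \<times> 'a2) \<times> ('o1 \<times> 'o2 \<times> 'a2), 'o1, 'a1) func" where
  "comma_proj1 = \<lparr>OMap = (\<lambda>(X1, X2, x). X1), AMap = (\<lambda>(a, (k1, k2), b). k1)\<rparr>"

end

theory Submission
  imports Defs
begin

text \<open>
  Write \<open>P\<close> for an endopolynomial in the comma category and \<open>P\<^sub>1\<close> for its image in \<open>E1\<close>.  The functor
  from \<open>P\<close>-algebras to \<open>P\<^sub>1\<close>-algebras has cartesian lifts, given by pullback in \<open>E2\<close>, so an initial object of the
  fibre over an initial \<open>P\<^sub>1\<close>-algebra \<open>W\<^sub>1\<close> is an initial \<open>P\<close>-algebra.  That fibre is again a category of algebras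
  for an endopolynomial, now in \<open>E2\<close> on the object \<open>H W\<^sub>1 \<times> I\<^sub>2\<close> (product over \<open>H I\<^sub>1\<close>), hence it has an initial
  object \<open>W\<^sub>2\<close>.  Since \<open>(W\<^sub>1, W\<^sub>2)\<close> projects to \<open>W\<^sub>1\<close>, so does up to isomorphism every initial algebra.
\<close>

section \<open>Categories and pullbacks\<close>

text \<open>Pullbacks and pushforwards are chosen by \<open>SOME\<close>, and the choices made in
  the comma category bear no relation to those made in \<open>E1\<close> and \<open>E2\<close>.
  Chosen objects are therefore never matched directly: an algebra structure becomes a natural
  operation on generalized elements, a chosen pushforward becomes one universal element among many,
  and each canonical comparison between pushforwards, \<sigma> included, turns out to be the
  \<open>name\<close> of one universal element in another. The fibre is polynomial for the following
  reason. Once the first component of a generalized element is the universal one over \<Pi>, what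
  remains is an arrow of \<open>E2\<close> defined on a pullback of \<open>g\<^sub>2\<close>. The
  dependence on the first component is absorbed by enlarging the base \<open>B\<^sub>2\<close> to
  \<open>B' = H \<Pi> \<times> B\<^sub>2\<close> and pulling \<open>g\<^sub>2\<close> back to it.
  Evaluating the first component inside \<open>E2\<close> requires the pullback squares of
  \<open>E1\<close> that carry generalized elements to stay pullbacks under
  \<open>H\<close>.\<close>

lemma in_hom [simp]: "f \<in> hom C X Y \<longleftrightarrow> f \<in> Arr C \<and> Dom C f = X \<and> Cod C f = Y"
  by (simp add: hom_def)

text \<open>Mediating arrow for a pullback given by its legs. \<open>pb_pair\<close> is tied to the
  chosen pullback, whereas the proof mostly meets others: pasted ones, images under
  \<open>H\<close>, projections from the comma category.\<close>

definition pair :: "('o, 'a) cat \<Rightarrow> 'a \<Rightarrow> 'a \<Rightarrow> 'a \<Rightarrow> 'a \<Rightarrow> 'a" where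
  "pair C p q a b = (THE m. m \<in> hom C (Dom C a) (Dom C p) \<and> p \<cdot>\<^bsub>C\<^esub> m = a \<and> q
    \<cdot>\<^bsub>C\<^esub> m = b)"

context category
begin

lemma arr_cmp [simp]: "\<lbrakk>f \<in> Arr C; g \<in> Arr C; Dom C g = Cod C f\<rbrakk> \<Longrightarrow> g \<cdot> f \<in> Arr C"
  and dom_cmp [simp]: "\<lbrakk>f \<in> Arr C; g \<in> Arr C; Dom C g = Cod C f\<rbrakk> \<Longrightarrow> Dom C (g \<cdot> f) =
    Dom C f"
  and cod_cmp [simp]: "\<lbrakk>f \<in> Arr C; g \<in> Arr C; Dom C g = Cod C f\<rbrakk> \<Longrightarrow> Cod C (g \<cdot> f) =
    Cod C g"
  using cmp_hom[of f "Dom C f" "Cod C f" g "Cod C g"] by simp_all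

lemma arr_ident [simp]: "X \<in> Obj C \<Longrightarrow> Ident C X \<in> Arr C"
  and dom_ident [simp]: "X \<in> Obj C \<Longrightarrow> Dom C (Ident C X) = X"
  and cod_ident [simp]: "X \<in> Obj C \<Longrightarrow> Cod C (Ident C X) = X"
  using ident_hom[of X] by simp_all

lemma ident_right [simp]: "\<lbrakk>f \<in> Arr C; Dom C f = X\<rbrakk> \<Longrightarrow> f \<cdot> Ident C X = f"
  and ident_left [simp]: "\<lbrakk>f \<in> Arr C; Cod C f = X\<rbrakk> \<Longrightarrow> Ident C X \<cdot> f = f"
  using cmp_ident_right[of f X "Cod C f"] cmp_ident_left[of f "Dom C f" X] by simp_all

lemma assoc [simp]:
  "\<lbrakk>f \<in> Arr C; g \<in> Arr C; h \<in> Arr C; Dom C g = Cod C f; Dom C h = Cod C g\<rbrakk>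
    \<Longrightarrow> (h \<cdot> g) \<cdot> f = h \<cdot> (g \<cdot> f)"
  using cmp_assoc[of f "Dom C f" "Cod C f" g "Cod C g" h "Cod C h"] by simp

declare dom_obj [simp] cod_obj [simp]

text \<open>Simplification brackets composites to the right, which hides a known square or triangle
  as soon as a further arrow stands on its right. This lemma and the next apply such an equation
  inside a right-bracketed composite.\<close>

lemma reassoc:
  "\<lbrakk>a \<cdot> b = c \<cdot> d; a \<in> Arr C; b \<in> Arr C; c \<in> Arr C; d \<in> Arr C; x \<in> Arr C;
    Dom C a = Cod C b; Dom C c = Cod C d; Dom C b = Cod C x; Dom C d = Cod C x\<rbrakk>
    \<Longrightarrow> a \<cdot> (b \<cdot> x) = c \<cdot> (d \<cdot> x)"
  by (metis assoc)

lemma reassoc1: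
  "\<lbrakk>a \<cdot> b = c; a \<in> Arr C; b \<in> Arr C; x \<in> Arr C; Dom C a = Cod C b; Dom C b = Cod C x\<rbrakk>
    \<Longrightarrow> a \<cdot> (b \<cdot> x) = c \<cdot> x"
  by (metis assoc)

lemma inverse_unique: "inverse_arrows C f g \<Longrightarrow> inverse_arrows C f g' \<Longrightarrow> g = g'"
  unfolding inverse_arrows_def in_hom by (metis assoc ident_left ident_right)

lemma inv_arr_eq: "inverse_arrows C f g \<Longrightarrow> inv_arr C f = g"
  unfolding inv_arr_def by (blast intro: inverse_unique)

lemma is_pullbackI:
  assumes "f \<in> Arr C" "u \<in> Arr C" "Cod C f = Cod C u" "p \<in> Arr C" "q \<in> Arr C"
    "Dom C q = Dom C p" "Cod C p = Dom C f" "Cod C q = Dom C u" "f \<cdot> p = u \<cdot> q"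
    and "\<And>a b. \<lbrakk>a \<in> Arr C; b \<in> Arr C; Dom C b = Dom C a; Cod C a = Dom C f; Cod C b = Dom C u; f \<cdot> a = u
      \<cdot> b\<rbrakk>
      \<Longrightarrow> \<exists>m. m \<in> Arr C \<and> Dom C m = Dom C a \<and> Cod C m = Dom C p \<and> p \<cdot> m = a \<and> q
        \<cdot> m = b"
    and "\<And>m m'. \<lbrakk>m \<in> Arr C; m' \<in> Arr C; Dom C m' = Dom C m; Cod C m = Dom C p; Cod C m' = Dom C p;
      p \<cdot> m = p \<cdot> m'; q \<cdot> m = q \<cdot> m'\<rbrakk> \<Longrightarrow> m = m'"
  shows "is_pullback C f u p q"
  unfolding is_pullback_def
proof (intro conjI allI ballI impI)
  fix X a b assume ab: "a \<in> hom C X (Dom C f)" "b \<in> hom C X (Dom C u)" "f \<cdot> a = u \<cdot> b"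
  then obtain m where "m \<in> Arr C \<and> Dom C m = Dom C a \<and> Cod C m = Dom C p \<and> p \<cdot> m = a \<and> q \<cdot> m =
    b"
    using assms(10)[of a b] by auto
  then show "\<exists>!m. m \<in> hom C X (Dom C p) \<and> p \<cdot> m = a \<and> q \<cdot> m = b"
    using ab by (intro ex1I[of _ m]) (auto intro!: assms(11))
qed (use assms in auto)

lemma pullbackD:
  assumes "is_pullback C f u p q"
  shows "f \<in> Arr C" "u \<in> Arr C" "Cod C f = Cod C u" "p \<in> Arr C" "q \<in> Arr C"
    "Dom C q = Dom C p" "Cod C p = Dom C f" "Cod C q = Dom C u" "f \<cdot> p = u \<cdot> q"
  using assms unfolding is_pullback_def by auto

lemma pair:
  assumes "is_pullback C f u p q"
    and "a \<in> Arr C" "b \<in> Arr C" "Dom C b = Dom C a" "Cod C a = Dom C f" "Cod C b = Dom C u" "f \<cdot> a = u \<cdot> b"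
  shows "pair C p q a b \<in> Arr C" "Dom C (pair C p q a b) = Dom C a" "Cod C (pair C p q a b) = Dom C p"
    "p \<cdot> pair C p q a b = a" "q \<cdot> pair C p q a b = b"
proof -
  have "\<exists>!m. m \<in> hom C (Dom C a) (Dom C p) \<and> p \<cdot> m = a \<and> q \<cdot> m = b"
    using assms unfolding is_pullback_def by simp
  from theI'[OF this, folded pair_def]
  show "pair C p q a b \<in> Arr C" "Dom C (pair C p q a b) = Dom C a" "Cod C (pair C p q a b) = Dom C p"
    "p \<cdot> pair C p q a b = a" "q \<cdot> pair C p q a b = b" by auto
qed

lemma pullback_eqI:
  assumes "is_pullback C f u p q"
    and m: "m \<in> Arr C" "m' \<in> Arr C" "Dom C m' = Dom C m" "Cod C m = Dom C p" "Cod C m' = Dom C p"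
      "p \<cdot> m = p \<cdot> m'" "q \<cdot> m = q \<cdot> m'"
  shows "m = m'"
proof -
  note [simp] = pullbackD[OF assms(1)]
  have "f \<cdot> (p \<cdot> m) = u \<cdot> (q \<cdot> m)"
    using m by (simp add: pullbackD(9)[OF assms(1), THEN reassoc])
  then have "\<exists>!k. k \<in> hom C (Dom C m) (Dom C p) \<and> p \<cdot> k = p \<cdot> m \<and> q \<cdot> k = q \<cdot> m"
    using assms(1) m(1-5) unfolding is_pullback_def by simp
  then show ?thesis using m by auto
qed

lemma pair_eq:
  assumes "is_pullback C f u p q" "m \<in> Arr C" "Cod C m = Dom C p"
  shows "pair C p q (p \<cdot> m) (q \<cdot> m) = m"
proof -
  note [simp] = pullbackD[OF assms(1)]
  have "f \<cdot> (p \<cdot> m) = u \<cdot> (q \<cdot> m)"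
    using assms(2,3) by (simp add: pullbackD(9)[OF assms(1), THEN reassoc])
  note k = pair[OF assms(1), of "p \<cdot> m" "q \<cdot> m", OF _ _ _ _ _ this]
  show ?thesis
    by (rule pullback_eqI[OF assms(1)]) (use k assms(2,3) in simp_all)
qed

lemma pullback_paste:
  assumes P: "is_pullback C g b p g'" and Q: "is_pullback C g' b' p' q"
  shows "is_pullback C g (b \<cdot> b') (p \<cdot> p') q"
proof -
  note [simp] = pullbackD[OF P] pullbackD(2,4-6,8,9)[OF Q]
    pullbackD(9)[OF P, THEN reassoc] pullbackD(9)[OF Q, THEN reassoc]
  have [simp]: "Cod C b' = Dom C b" "Cod C p' = Dom C p"
    using pullbackD[OF P] pullbackD[OF Q] by simp_all
  show ?thesis
  proof (rule is_pullbackI)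
    fix c d assume cd: "c \<in> Arr C" "d \<in> Arr C" "Dom C d = Dom C c" "Cod C c = Dom C g"
      "Cod C d = Dom C (b \<cdot> b')" "g \<cdot> c = (b \<cdot> b') \<cdot> d"
    note k = pair[OF P, of c "b' \<cdot> d"]
    let ?k = "pair C p g' c (b' \<cdot> d)"
    note l = pair[OF Q, of ?k d]
    show "\<exists>m. m \<in> Arr C \<and> Dom C m = Dom C c \<and> Cod C m = Dom C (p \<cdot> p') \<and> (p \<cdot> p') \<cdot> m
      = c \<and> q \<cdot> m = d"
      using k l cd by (intro exI[of _ "pair C p' q ?k d"]) simp
  next
    fix m m' assume m: "m \<in> Arr C" "m' \<in> Arr C" "Dom C m' = Dom C m" "Cod C m = Dom C (p \<cdot> p')"
      "Cod C m' = Dom C (p \<cdot> p')" "(p \<cdot> p') \<cdot> m = (p \<cdot> p') \<cdot> m'" "q \<cdot> m = q \<cdot> m'"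
    have "p' \<cdot> m = p' \<cdot> m'"
      by (rule pullback_eqI[OF P]) (use m in simp_all)
    with m show "m = m'" by (simp add: pullback_eqI[OF Q])
  qed simp_all
qed

text \<open>The converse half of the pasting law. It later extracts a pullback of \<open>g'\<close>
  from a pullback of \<open>a2 g\<close>.\<close>

lemma pullback_cancel:
  assumes P: "is_pullback C g b p g'" and Q: "is_pullback C g (b \<cdot> b') q' q"
    and b': "b' \<in> Arr C" "Cod C b' = Dom C b"
    and p': "p' \<in> Arr C" "Dom C p' = Dom C q'" "Cod C p' = Dom C p" "p \<cdot> p' = q'" "g' \<cdot> p' = b' \<cdot> q"
  shows "is_pullback C g' b' p' q"
proof -
  note [simp] = pullbackD(1-8)[OF P] pullbackD(4-8)[OF Q] b' p'
    pullbackD(9)[OF P, THEN reassoc] pullbackD(9)[OF Q, THEN reassoc]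
  have [simp]: "Cod C g' = Dom C b" "Cod C q' = Dom C g" "Cod C q = Dom C b'" "Dom C q = Dom C q'"
    using pullbackD[OF P] pullbackD[OF Q] by simp_all
  have P9: "g \<cdot> p = b \<cdot> g'" by (rule pullbackD(9)[OF P])
  show ?thesis
  proof (rule is_pullbackI)
    fix c d assume cd: "c \<in> Arr C" "d \<in> Arr C" "Dom C d = Dom C c" "Cod C c = Dom C g'"
      "Cod C d = Dom C b'" "g' \<cdot> c = b' \<cdot> d"
    have "g \<cdot> (p \<cdot> c) = (b \<cdot> b') \<cdot> d" using cd by (simp)
    note k = pair[OF Q, of "p \<cdot> c" d, OF _ _ _ _ _ this]
    let ?k = "pair C q' q (p \<cdot> c) d"
    have k: "?k \<in> Arr C" "Dom C ?k = Dom C c" "Cod C ?k = Dom C q'" "q' \<cdot> ?k = p \<cdot> c" "q \<cdot> ?k = d"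
      using k cd by simp_all
    have "p' \<cdot> ?k = c"
      by (rule pullback_eqI[OF P]) (use k cd p'(4)[THEN reassoc1] p'(5)[THEN reassoc] in simp_all)
    with k show "\<exists>m. m \<in> Arr C \<and> Dom C m = Dom C c \<and> Cod C m = Dom C p' \<and> p' \<cdot> m = c \<and> q
      \<cdot> m = d"
      by (intro exI[of _ "?k"]) simp
  next
    fix m m' assume m: "m \<in> Arr C" "m' \<in> Arr C" "Dom C m' = Dom C m" "Cod C m = Dom C p'"
      "Cod C m' = Dom C p'" "p' \<cdot> m = p' \<cdot> m'" "q \<cdot> m = q \<cdot> m'"
    have "q' \<cdot> m = q' \<cdot> m'"
      using m p'(4)[THEN reassoc1, symmetric] by simp
    with m show "m = m'" by (simp add: pullback_eqI[OF Q])
  qed simp_all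
qed

end

section \<open>Functors and finite limits\<close>

locale cat_functor = C: category C + D: category D
  for C :: "('o1, 'a1) cat" and D :: "('o2, 'a2) cat" +
  fixes F :: "('o1, 'a1, 'o2, 'a2) func"
  assumes is_functor: "is_functor C D F"
begin

lemma obj_map [simp]: "X \<in> Obj C \<Longrightarrow> OMap F X \<in> Obj D"
  and arr_map [simp]: "f \<in> Arr C \<Longrightarrow> AMap F f \<in> Arr D"
  and dom_map [simp]: "f \<in> Arr C \<Longrightarrow> Dom D (AMap F f) = OMap F (Dom C f)"
  and cod_map [simp]: "f \<in> Arr C \<Longrightarrow> Cod D (AMap F f) = OMap F (Cod C f)"
  and map_ident [simp]: "X \<in> Obj C \<Longrightarrow> AMap F (Ident C X) = Ident D (OMap F X)"
  and map_cmp [simp]: "\<lbrakk>f \<in> Arr C; g \<in> Arr C; Dom C g = Cod C f\<rbrakk>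
    \<Longrightarrow> AMap F (g \<cdot>\<^bsub>C\<^esub> f) = AMap F g \<cdot>\<^bsub>D\<^esub> AMap F f"
  using is_functor unfolding is_functor_def by simp_all

lemma map_square:
  "\<lbrakk>a \<cdot>\<^bsub>C\<^esub> b = c \<cdot>\<^bsub>C\<^esub> d; a \<in> Arr C; b \<in> Arr C; c \<in> Arr C; d \<in> Arr
    C; Dom C a = Cod C b; Dom C c = Cod C d\<rbrakk>
    \<Longrightarrow> AMap F a \<cdot>\<^bsub>D\<^esub> AMap F b = AMap F c \<cdot>\<^bsub>D\<^esub> AMap F d"
  by (metis map_cmp)

lemma map_triangle:
  "\<lbrakk>a \<cdot>\<^bsub>C\<^esub> b = c; a \<in> Arr C; b \<in> Arr C; Dom C a = Cod C b\<rbrakk>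
    \<Longrightarrow> AMap F a \<cdot>\<^bsub>D\<^esub> AMap F b = AMap F c"
  by (metis map_cmp)

lemma map_inverse_arrows: "inverse_arrows C f g \<Longrightarrow> inverse_arrows D (AMap F f) (AMap F g)"
  unfolding inverse_arrows_def by (auto dest: map_triangle)

end

lemma cat_functorI: "is_functor C D F \<Longrightarrow> cat_functor C D F"
  unfolding cat_functor_def cat_functor_axioms_def by (simp add: is_functor_def)

lemma is_functorI:
  assumes "category C" "category D"
    and "\<And>X. X \<in> Obj C \<Longrightarrow> OMap F X \<in> Obj D"
    and "\<And>f. f \<in> Arr C \<Longrightarrow> AMap F f \<in> Arr D \<and> Dom D (AMap F f) = OMap F (Dom C f) \<and> Cod D
      (AMap F f) = OMap F (Cod C f)"
    and "\<And>X. X \<in> Obj C \<Longrightarrow> AMap F (Ident C X) = Ident D (OMap F X)"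
    and "\<And>f g. \<lbrakk>f \<in> Arr C; g \<in> Arr C; Dom C g = Cod C f\<rbrakk>
      \<Longrightarrow> AMap F (g \<cdot>\<^bsub>C\<^esub> f) = AMap F g \<cdot>\<^bsub>D\<^esub> AMap F f"
  shows "is_functor C D F"
  using assms unfolding is_functor_def by simp

lemma comp_func_simps [simp]:
  "OMap (G \<odot> F) X = OMap G (OMap F X)" "AMap (G \<odot> F) f = AMap G (AMap F f)"
  by (simp_all add: comp_func_def)

lemma id_func_simps [simp]: "OMap id_func X = X" "AMap id_func f = f"
  by (simp_all add: id_func_def)

lemma is_functor_comp:
  assumes "is_functor C D F" "is_functor D E G"
  shows "is_functor C E (G \<odot> F)"
proof -
  interpret F: cat_functor C D F using assms(1) by (rule cat_functorI)
  interpret G: cat_functor D E G using assms(2) by (rule cat_functorI)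
  show ?thesis by (rule is_functorI) (simp_all add: F.C.category_axioms G.D.category_axioms)
qed

context category
begin

lemma limit_eqI:
  assumes "limit_cone J C D L \<pi>" and J: "is_functor J C D"
    and m: "m \<in> hom C X L" "m' \<in> hom C X L" "\<And>j. j \<in> Obj J \<Longrightarrow> \<pi> j \<cdot> m = \<pi> j \<cdot>
      m'"
  shows "m = m'"
proof -
  interpret D: cat_functor J C D using J by (rule cat_functorI)
  have \<pi>: "cone J C D L \<pi>" using assms(1) by (simp add: limit_cone_def)
  have "cone J C D X (\<lambda>j. \<pi> j \<cdot> m)"
    using \<pi> m(1) unfolding cone_def by (auto intro: reassoc1)
  then have "\<exists>!k. k \<in> hom C X L \<and> (\<forall>j \<in> Obj J. \<pi> j \<cdot> k = \<pi> j \<cdot> m)"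
    using assms(1) unfolding limit_cone_def by blast
  then show ?thesis using m by metis
qed

lemma limit_coneI:
  assumes "cone J C D L \<pi>"
    and "\<And>X \<rho>. cone J C D X \<rho> \<Longrightarrow> \<exists>m. m \<in> hom C X L \<and> (\<forall>j \<in> Obj J. \<pi>
      j \<cdot> m = \<rho> j)"
    and "\<And>X m m'. \<lbrakk>m \<in> hom C X L; m' \<in> hom C X L; \<And>j. j \<in> Obj J \<Longrightarrow> \<pi> j \<cdot> m =
      \<pi> j \<cdot> m'\<rbrakk> \<Longrightarrow> m = m'"
  shows "limit_cone J C D L \<pi>"
  unfolding limit_cone_def
proof (intro conjI allI impI)
  fix X \<rho> assume "cone J C D X \<rho>"
  then obtain m where "m \<in> hom C X L \<and> (\<forall>j \<in> Obj J. \<pi> j \<cdot> m = \<rho> j)" using assms(2) by blast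
  then show "\<exists>!m. m \<in> hom C X L \<and> (\<forall>j \<in> Obj J. \<pi> j \<cdot> m = \<rho> j)"
    by (intro ex1I[of _ m]) (auto intro: assms(3))
qed (rule assms(1))

lemma limit_factor:
  assumes "limit_cone J C D L \<pi>" "cone J C D X \<rho>"
  obtains m where "m \<in> hom C X L" "\<And>j. j \<in> Obj J \<Longrightarrow> \<pi> j \<cdot> m = \<rho> j"
  using assms unfolding limit_cone_def by metis

end

text \<open>Limit cones over one diagram are isomorphic, and functors preserve isomorphisms, so
  preserving one limit cone means preserving all. For the comma category only the limits built
  componentwise are visibly preserved by the projections.\<close>

lemma (in cat_functor) limit_cone_transfer:
  assumes J: "is_functor J C D'" and L: "limit_cone J C D' L \<pi>" and L': "limit_cone J C D' L' \<pi>'"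
    and FL': "limit_cone J D (F \<odot> D') (OMap F L') (\<lambda>j. AMap F (\<pi>' j))"
  shows "limit_cone J D (F \<odot> D') (OMap F L) (\<lambda>j. AMap F (\<pi> j))"
proof -
  interpret D': cat_functor J C D' using J by (rule cat_functorI)
  have FJ: "is_functor J D (F \<odot> D')" using J is_functor by (rule is_functor_comp)
  have \<pi>: "cone J C D' L \<pi>" "cone J C D' L' \<pi>'" using L L' by (simp_all add: limit_cone_def)
  have LO: "L \<in> Obj C" "L' \<in> Obj C" using \<pi> by (simp_all add: cone_def)
  have pj: "\<pi> j \<in> Arr C" "Dom C (\<pi> j) = L" "Cod C (\<pi> j) = OMap D' j"
     "\<pi>' j \<in> Arr C" "Dom C (\<pi>' j) = L'" "Cod C (\<pi>' j) = OMap D' j" if "j \<in> Obj J" for j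
    using that \<pi> by (auto simp: cone_def)
  obtain i where i: "i \<in> hom C L L'" "\<And>j. j \<in> Obj J \<Longrightarrow> \<pi>' j \<cdot>\<^bsub>C\<^esub> i = \<pi> j"
    using C.limit_factor[OF L' \<pi>(1)] by blast
  obtain i' where i': "i' \<in> hom C L' L" "\<And>j. j \<in> Obj J \<Longrightarrow> \<pi> j \<cdot>\<^bsub>C\<^esub> i' = \<pi>'
    j"
    using C.limit_factor[OF L \<pi>(2)] by blast
  have pii: "\<And>j. j \<in> Obj J \<Longrightarrow> \<pi> j \<cdot>\<^bsub>C\<^esub> (i' \<cdot>\<^bsub>C\<^esub> i) = \<pi> j"
    using i i' pj by (simp add: i'(2)[THEN C.reassoc1])
  have "i' \<cdot>\<^bsub>C\<^esub> i = Ident C L"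
    by (rule C.limit_eqI[OF L J, of _ L]) (use i i' LO pj pii in \<open>simp_all\<close>)
  then have ii: "AMap F i' \<cdot>\<^bsub>D\<^esub> AMap F i = Ident D (OMap F L)"
    using i(1) i'(1) LO map_triangle[of i' i] by simp
  have pF: "AMap F (\<pi> j) \<cdot>\<^bsub>D\<^esub> AMap F i' = AMap F (\<pi>' j)" "AMap F (\<pi>' j) \<cdot>\<^bsub>D\<^esub>
    AMap F i = AMap F (\<pi> j)" if "j \<in> Obj J" for j
    using i(1) i'(1) pj[OF that] map_triangle[OF i'(2)[OF that]] map_triangle[OF i(2)[OF that]] by simp_all
  show ?thesis
  proof (rule D.limit_coneI)
    show "cone J D (F \<odot> D') (OMap F L) (\<lambda>j. AMap F (\<pi> j))"
      unfolding cone_def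
    proof (intro conjI ballI)
      fix b assume b: "b \<in> Arr J"
      then have "AMap D' b \<cdot>\<^bsub>C\<^esub> \<pi> (Dom J b) = \<pi> (Cod J b)" using \<pi>(1) by (simp add: cone_def)
      from map_triangle[OF this] b
      show "AMap (F \<odot> D') b \<cdot>\<^bsub>D\<^esub> AMap F (\<pi> (Dom J b)) = AMap F (\<pi> (Cod J b))" by (simp add: pj)
    qed (use pj LO in simp_all)
  next
    fix X \<rho> assume "cone J D (F \<odot> D') X \<rho>"
    then obtain m where m: "m \<in> hom D X (OMap F L')" "\<And>j. j \<in> Obj J \<Longrightarrow> AMap F (\<pi>' j)
      \<cdot>\<^bsub>D\<^esub> m = \<rho> j"
      using D.limit_factor[OF FL'] by blast
    then show "\<exists>m. m \<in> hom D X (OMap F L) \<and> (\<forall>j\<in>Obj J. AMap F (\<pi> j) \<cdot>\<^bsub>D\<^esub> m =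
      \<rho> j)"
      using i' pj by (intro exI[of _ "AMap F i' \<cdot>\<^bsub>D\<^esub> m"]) (simp add: pF(1)[THEN D.reassoc1])
  next
    fix X m m' assume m: "m \<in> hom D X (OMap F L)" "m' \<in> hom D X (OMap F L)"
      "\<And>j. j \<in> Obj J \<Longrightarrow> AMap F (\<pi> j) \<cdot>\<^bsub>D\<^esub> m = AMap F (\<pi> j)
        \<cdot>\<^bsub>D\<^esub> m'"
    \<comment> \<open>\<open>AMap F i\<close> is a split monomorphism by \<open>ii\<close>, so
      \<open>m\<close> and \<open>m'\<close> may be compared after composing with it, inside the
      limit \<open>OMap F L'\<close>.\<close>
    have "AMap F i \<cdot>\<^bsub>D\<^esub> m = AMap F i \<cdot>\<^bsub>D\<^esub> m'"
      by (rule D.limit_eqI[OF FL' FJ, of _ X]) (use m i pj in \<open>simp_all add: pF(2)[THEN D.reassoc1]\<close>)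
    then have "AMap F i' \<cdot>\<^bsub>D\<^esub> (AMap F i \<cdot>\<^bsub>D\<^esub> m) = AMap F i' \<cdot>\<^bsub>D\<^esub> (AMap
      F i \<cdot>\<^bsub>D\<^esub> m')" by simp
    then show "m = m'" using m i i' LO by (simp add: ii[THEN D.reassoc1])
  qed
qed

text \<open>The codes 0, 1, 2 serve both as objects and as their identities; 3 and 4 are the arrows
  from 0 and from 1 to 2. In a composable pair at least one arrow is an identity, which explains the
  formula for \<open>Cmp\<close>.\<close>

definition cospan :: "(nat, nat) cat" where
  "cospan = \<lparr>Obj = {0, 1, 2}, Arr = {0, 1, 2, 3, 4},
     Dom = (\<lambda>a. if a = 3 then 0 else if a = 4 then 1 else a),
     Cod = (\<lambda>a. if a = 3 \<or> a = 4 then 2 else a),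
     Ident = (\<lambda>X. X), Cmp = (\<lambda>b a. if b \<le> 2 then a else b)\<rparr>"

definition cospan_diagram :: "('o, 'a) cat \<Rightarrow> 'a \<Rightarrow> 'a \<Rightarrow> (nat, nat, 'o, 'a) func" where
  "cospan_diagram C f u = \<lparr>
     OMap = (\<lambda>n. if n = 0 then Dom C f else if n = 1 then Dom C u else Cod C f),
     AMap = (\<lambda>n. if n = 3 then f else if n = 4 then u
       else Ident C (if n = 0 then Dom C f else if n = 1 then Dom C u else Cod C f))\<rparr>"

lemma cospan_simps [simp]:
  "Obj cospan = {0, 1, 2}"
  "Arr cospan = {0, 1, 2, 3, 4}"
  "Dom cospan a = (if a = 3 then 0 else if a = 4 then 1 else a)"
  "Cod cospan a = (if a = 3 \<or> a = 4 then 2 else a)"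
  "Ident cospan X = X"
  "b \<cdot>\<^bsub>cospan\<^esub> a = (if b \<le> 2 then a else b)"
  by (simp_all add: cospan_def)

lemma finite_shape_cospan: "finite_shape cospan"
proof -
  have "category cospan"
  proof
    fix f g X Y Z
    assume "f \<in> hom cospan X Y" "g \<in> hom cospan Y Z"
    then show "g \<cdot>\<^bsub>cospan\<^esub> f \<in> hom cospan X Z"
      by (simp split: if_splits) linarith+
  qed auto
  then show ?thesis by (simp add: finite_shape_def cospan_def)
qed

section \<open>Pullbacks as limits over the cospan\<close>

context category
begin

lemma cospan_diagram_functor:
  assumes "f \<in> Arr C" "u \<in> Arr C" "Cod C f = Cod C u"
  shows "is_functor cospan C (cospan_diagram C f u)" (is "is_functor _ _ ?D")
proof (rule is_functorI)
  show "category cospan" using finite_shape_cospan by (simp add: finite_shape_def)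
  show O: "OMap ?D X \<in> Obj C" for X
    using assms by (simp add: cospan_diagram_def)
  show A: "AMap ?D x \<in> Arr C \<and> Dom C (AMap ?D x) = OMap ?D (Dom cospan x) \<and>
    Cod C (AMap ?D x) = OMap ?D (Cod cospan x)" if "x \<in> Arr cospan" for x
    using assms that by (auto simp: cospan_diagram_def)
  show I: "AMap ?D (Ident cospan X) = Ident C (OMap ?D X)" if "X \<in> Obj cospan" for X
    using that by (auto simp: cospan_diagram_def)
  show "AMap ?D (y \<cdot>\<^bsub>cospan\<^esub> x) = AMap ?D y \<cdot> AMap ?D x"
    if xy: "x \<in> Arr cospan" "y \<in> Arr cospan" "Dom cospan y = Cod cospan x" for x y
  proof -
    have "y \<in> Obj cospan \<and> y \<cdot>\<^bsub>cospan\<^esub> x = x \<and> y = Cod cospan x \<or>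
        x \<in> Obj cospan \<and> y \<cdot>\<^bsub>cospan\<^esub> x = y \<and> x = Dom cospan y"
      using xy by (auto split: if_splits)
    then show ?thesis
    proof (elim disjE conjE)
      assume "y \<in> Obj cospan" "y \<cdot>\<^bsub>cospan\<^esub> x = x" "y = Cod cospan x"
      moreover from this have "AMap ?D y = Ident C (OMap ?D y)" using I[of y] by simp
      ultimately show ?thesis using A[OF xy(1)] by simp
    next
      assume "x \<in> Obj cospan" "y \<cdot>\<^bsub>cospan\<^esub> x = y" "x = Dom cospan y"
      moreover from this have "AMap ?D x = Ident C (OMap ?D x)" using I[of x] by simp
      ultimately show ?thesis using A[OF xy(2)] by simp
    qed
  qed
qed (rule category_axioms)

text \<open>Stated for an arbitrary diagram, so that it applies to \<open>cospan_diagram\<close> and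
  also to its composite with a functor.\<close>

lemma cospan_limit_pullback:
  assumes D: "is_functor cospan C D" and L: "limit_cone cospan C D L \<pi>"
  shows "is_pullback C (AMap D 3) (AMap D 4) (\<pi> 0) (\<pi> 1)"
proof -
  interpret D: cat_functor cospan C D using D by (rule cat_functorI)
  have D34: "AMap D 3 \<in> Arr C" "AMap D 4 \<in> Arr C" "Dom C (AMap D 3) = OMap D 0"
    "Dom C (AMap D 4) = OMap D 1" "Cod C (AMap D 3) = OMap D 2" "Cod C (AMap D 4) = OMap D 2"
    using D.arr_map[of 3] D.arr_map[of 4] D.dom_map[of 3] D.dom_map[of 4] D.cod_map[of 3] D.cod_map[of 4]
    by simp_all
  have Dn: "AMap D 0 = Ident C (OMap D 0)" "AMap D (Suc 0) = Ident C (OMap D 1)" "AMap D 2 = Ident C (OMap D 2)"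
    "OMap D 0 \<in> Obj C" "OMap D (Suc 0) \<in> Obj C" "OMap D 2 \<in> Obj C"
    using D.map_ident[of 0] D.map_ident[of 1] D.map_ident[of 2] D.obj_map[of 0] D.obj_map[of 1] D.obj_map[of 2]
    by simp_all
  \<comment> \<open>The component at 2 is determined by the one at 0, so a cone is a commutative
    square.\<close>
  have cone: "cone cospan C D X \<rho> \<longleftrightarrow> X \<in> Obj C \<and> \<rho> 0 \<in> hom C X (OMap D 0) \<and> \<rho> 1
    \<in> hom C X (OMap D 1) \<and>
     \<rho> 2 = AMap D 3 \<cdot> \<rho> 0 \<and> AMap D 4 \<cdot> \<rho> 1 = AMap D 3 \<cdot> \<rho> 0" for X \<rho>
  proof
    show "cone cospan C D X \<rho> \<Longrightarrow> X \<in> Obj C \<and> \<rho> 0 \<in> hom C X (OMap D 0) \<and> \<rho> 1 \<in>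
      hom C X (OMap D 1) \<and>
     \<rho> 2 = AMap D 3 \<cdot> \<rho> 0 \<and> AMap D 4 \<cdot> \<rho> 1 = AMap D 3 \<cdot> \<rho> 0"
      unfolding cone_def by simp
  qed (use D34 Dn in \<open>simp add: cone_def\<close>)
  have \<pi>: "cone cospan C D L \<pi>" using L by (simp add: limit_cone_def)
  show ?thesis
  proof (rule is_pullbackI)
    fix a b assume ab: "a \<in> Arr C" "b \<in> Arr C" "Dom C b = Dom C a" "Cod C a = Dom C (AMap D 3)"
      "Cod C b = Dom C (AMap D 4)" "AMap D 3 \<cdot> a = AMap D 4 \<cdot> b"
    then have "cone cospan C D (Dom C a) (\<lambda>n. if n = 0 then a else if n = 1 then b else AMap D 3 \<cdot> a)"
      using D34 by (simp add: cone)
    from limit_factor[OF L this]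
    obtain m where m: "m \<in> hom C (Dom C a) L" "\<And>j. j \<in> Obj cospan \<Longrightarrow>
      \<pi> j \<cdot> m = (if j = 0 then a else if j = 1 then b else AMap D 3 \<cdot> a)"
      by blast
    have "\<pi> 0 \<cdot> m = a" "\<pi> 1 \<cdot> m = b"
      using m(2)[of 0] m(2)[of 1] by simp_all
    with m(1) show "\<exists>m. m \<in> Arr C \<and> Dom C m = Dom C a \<and> Cod C m = Dom C (\<pi> 0) \<and> \<pi> 0 \<cdot> m =
      a \<and> \<pi> 1 \<cdot> m = b"
      using \<pi> by (auto simp: cone)
  next
    fix m m' assume m: "m \<in> Arr C" "m' \<in> Arr C" "Dom C m' = Dom C m" "Cod C m = Dom C (\<pi> 0)"
      "Cod C m' = Dom C (\<pi> 0)" "\<pi> 0 \<cdot> m = \<pi> 0 \<cdot> m'" "\<pi> 1 \<cdot> m = \<pi> 1 \<cdot> m'"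
    have m2: "\<pi> 2 \<cdot> m = AMap D 3 \<cdot> (\<pi> 0 \<cdot> m)" "\<pi> 2 \<cdot> m' = AMap D 3 \<cdot> (\<pi> 0 \<cdot> m')"
      using \<pi> m(1-5) D34 unfolding cone by (metis assoc in_hom)+
    show "m = m'"
    proof (rule limit_eqI[OF L D])
      show "m \<in> hom C (Dom C m) L" "m' \<in> hom C (Dom C m) L" using m \<pi>[unfolded cone] by simp_all
      show "\<pi> j \<cdot> m = \<pi> j \<cdot> m'" if "j \<in> Obj cospan" for j
      proof -
        have "j = 0 \<or> j = 1 \<or> j = 2" using that by auto
        then show ?thesis using m(6,7) m2 by (elim disjE) simp_all
      qed
    qed
  qed (use \<pi> D34 in \<open>auto simp: cone\<close>)
qed

lemma pullback_cospan_limit: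
  assumes P: "is_pullback C f u p q"
  shows "limit_cone cospan C (cospan_diagram C f u) (Dom C p) (\<lambda>n. if n = 0 then p else if n = 1 then q else f \<cdot> p)"
    (is "limit_cone _ _ ?D ?L ?p")
proof -
  note [simp] = pullbackD[OF P] pullbackD(9)[OF P, THEN reassoc]
  have cone: "cone cospan C ?D X \<rho> \<longleftrightarrow> X \<in> Obj C \<and> \<rho> 0 \<in> hom C X (Dom C f) \<and> \<rho> 1
    \<in> hom C X (Dom C u) \<and>
     \<rho> 2 = f \<cdot> \<rho> 0 \<and> u \<cdot> \<rho> 1 = f \<cdot> \<rho> 0" for X \<rho>
  proof
    show "cone cospan C ?D X \<rho> \<Longrightarrow> X \<in> Obj C \<and> \<rho> 0 \<in> hom C X (Dom C f) \<and> \<rho> 1 \<in>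
      hom C X (Dom C u) \<and>
     \<rho> 2 = f \<cdot> \<rho> 0 \<and> u \<cdot> \<rho> 1 = f \<cdot> \<rho> 0"
      unfolding cone_def by (simp add: cospan_diagram_def)
  qed (simp add: cone_def cospan_diagram_def)
  show ?thesis
  proof (rule limit_coneI)
    fix X \<rho> assume "cone cospan C ?D X \<rho>"
    then have c: "\<rho> 0 \<in> Arr C" "\<rho> 1 \<in> Arr C" "Dom C (\<rho> 0) = X" "Dom C (\<rho> 1) = X" "Cod C (\<rho> 0) =
      Dom C f"
      "Cod C (\<rho> 1) = Dom C u" "\<rho> 2 = f \<cdot> \<rho> 0" "u \<cdot> \<rho> 1 = f \<cdot> \<rho> 0" by (auto simp: cone)
    note k = pair[OF P, of "\<rho> 0" "\<rho> 1", OF _ _ _ _ _ c(8)[symmetric]]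
    from k c show "\<exists>m. m \<in> hom C X ?L \<and> (\<forall>j\<in>Obj cospan. ?p j \<cdot> m = \<rho> j)"
      by (intro exI[of _ "pair C p q (\<rho> 0) (\<rho> 1)"]) simp
  next
    fix X m m' assume m: "m \<in> hom C X ?L" "m' \<in> hom C X ?L" "\<And>j. j \<in> Obj cospan \<Longrightarrow> ?p j \<cdot> m =
      ?p j \<cdot> m'"
    show "m = m'"
      by (rule pullback_eqI[OF P, of m m']) (use m(1,2) m(3)[of 0] m(3)[of 1] in \<open>simp_all\<close>)
  qed (simp add: cone)
qed

lemma has_pullbacks:
  assumes "has_finite_limits C" "f \<in> Arr C" "u \<in> Arr C" "Cod C f = Cod C u"
  shows "is_pullback C f u (pb1 C f u) (pb2 C f u)"
proof -
  note D = cospan_diagram_functor[OF assms(2-4)]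
  obtain L \<pi> where "limit_cone cospan C (cospan_diagram C f u) L \<pi>"
    using assms(1) D finite_shape_cospan unfolding has_finite_limits_def by blast
  from cospan_limit_pullback[OF D this]
  have "case (\<pi> 0, \<pi> 1) of (p, q) \<Rightarrow> is_pullback C f u p q"
    by (simp add: cospan_diagram_def)
  then have "case pb C f u of (p, q) \<Rightarrow> is_pullback C f u p q"
    unfolding pb_def by (rule someI)
  then show ?thesis by (simp add: pb1_def pb2_def case_prod_beta)
qed

end

lemma preserves_pullbacks:
  assumes "is_functor C D F" "preserves_finite_limits C D F" "is_pullback C f u p q"
  shows "is_pullback D (AMap F f) (AMap F u) (AMap F p) (AMap F q)"
proof -
  interpret cat_functor C D F using assms(1) by (rule cat_functorI)
  note P = assms(3)
  have J: "is_functor cospan C (cospan_diagram C f u)"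
    using C.pullbackD[OF P] by (intro C.cospan_diagram_functor)
  have "limit_cone cospan D (F \<odot> cospan_diagram C f u) (OMap F (Dom C p))
    (\<lambda>j. AMap F (if j = 0 then p else if j = 1 then q else f \<cdot>\<^bsub>C\<^esub> p))"
    using assms(2) J C.pullback_cospan_limit[OF P] finite_shape_cospan
    unfolding preserves_finite_limits_def by blast
  from D.cospan_limit_pullback[OF is_functor_comp[OF J assms(1)] this]
  show ?thesis by (simp add: cospan_diagram_def)
qed

section \<open>Slices and universal arrows\<close>

lemma slice_simps [simp]:
  "u \<in> Obj (slice C I) \<longleftrightarrow> u \<in> Arr C \<and> Cod C u = I"
  "(u, k, v) \<in> Arr (slice C I) \<longleftrightarrow> u \<in> Arr C \<and> Cod C u = I \<and> v \<in> Arr C \<and> Cod C v = I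
    \<and>
     k \<in> Arr C \<and> Dom C k = Dom C u \<and> Cod C k = Dom C v \<and> v \<cdot>\<^bsub>C\<^esub> k = u"
  "Dom (slice C I) (u, k, v) = u"
  "Cod (slice C I) (u, k, v) = v"
  "Ident (slice C I) u = (u, Ident C (Dom C u), u)"
  "(v', l, w) \<cdot>\<^bsub>slice C I\<^esub> (u, k, v) = (u, l \<cdot>\<^bsub>C\<^esub> k, w)"
  by (auto simp: slice_def)

lemma slice_arrE:
  assumes "x \<in> Arr (slice C I)"
  obtains u k v where "x = (u, k, v)" "u \<in> Arr C" "Cod C u = I" "v \<in> Arr C" "Cod C v = I"
     "k \<in> Arr C" "Dom C k = Dom C u" "Cod C k = Dom C v" "v \<cdot>\<^bsub>C\<^esub> k = u"
  using assms by (cases x) auto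

context category
begin

lemma category_slice: "category (slice C I)"
proof
  fix f show "f \<in> Arr (slice C I) \<Longrightarrow> Dom (slice C I) f \<in> Obj (slice C I)"
    "f \<in> Arr (slice C I) \<Longrightarrow> Cod (slice C I) f \<in> Obj (slice C I)" by (auto elim!: slice_arrE)
next
  fix u v w x y assume xy: "x \<in> hom (slice C I) u v" "y \<in> hom (slice C I) v w"
  then obtain k l where "x = (u, k, v)" "y = (v, l, w)" by (cases x; cases y) auto
  with xy reassoc1[of w l v k] show "y \<cdot>\<^bsub>slice C I\<^esub> x \<in> hom (slice C I) u w"
    by simp
qed (auto elim!: slice_arrE)

lemma slice_inverse:
  assumes "(u, k, v) \<in> Arr (slice C I)" "inverse_arrows C k k'"
  shows "inverse_arrows (slice C I) (u, k, v) (v, k', u)"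
proof -
  have "u \<cdot> k' = v"
    using assms reassoc1[of v k u k'] by (auto simp: inverse_arrows_def)
  then show ?thesis using assms by (simp add: inverse_arrows_def)
qed

end

text \<open>A universal arrow at each object is enough: the right adjoint sends \<open>f\<close> to
  the unique arrow through which \<open>f\<close> composed with the universal arrow factors.
  Functoriality follows from uniqueness, and naturality of the counit is the defining
  equation.\<close>

lemma right_adjointI:
  assumes F: "is_functor C D F"
    and ex: "\<And>Y. Y \<in> Obj D \<Longrightarrow> \<exists>X e. X \<in> Obj C \<and> e \<in> hom D (OMap F X) Y \<and>
      (\<forall>Z \<in> Obj C. \<forall>k \<in> hom D (OMap F Z) Y. \<exists>!h. h \<in> hom C Z X \<and> e
        \<cdot>\<^bsub>D\<^esub> AMap F h = k)"
  shows "\<exists>G \<epsilon>. right_adjoint C D F G \<epsilon>"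
proof -
  interpret cat_functor C D F using F by (rule cat_functorI)
  obtain X e where Xe: "\<And>Y. Y \<in> Obj D \<Longrightarrow> X Y \<in> Obj C \<and> e Y \<in> hom D (OMap F (X Y)) Y \<and>
      (\<forall>Z \<in> Obj C. \<forall>k \<in> hom D (OMap F Z) Y. \<exists>!h. h \<in> hom C Z (X Y) \<and> e Y
        \<cdot>\<^bsub>D\<^esub> AMap F h = k)"
    using ex by metis
  have uniq: "\<exists>!h. h \<in> hom C Z (X Y) \<and> e Y \<cdot>\<^bsub>D\<^esub> AMap F h = k"
    if "Y \<in> Obj D" "Z \<in> Obj C" "k \<in> hom D (OMap F Z) Y" for Y Z k
    using Xe[OF that(1)] that by blast
  have eq: "h = h'" if "Y \<in> Obj D" "h \<in> hom C Z (X Y)" "h' \<in> hom C Z (X Y)"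
    "e Y \<cdot>\<^bsub>D\<^esub> AMap F h = e Y \<cdot>\<^bsub>D\<^esub> AMap F h'" for Y Z h h'
  proof -
    have Z: "Z \<in> Obj C" and k: "e Y \<cdot>\<^bsub>D\<^esub> AMap F h \<in> hom D (OMap F Z) Y" using Xe[OF that(1)] that(2) by
      auto
    from uniq[OF that(1) Z k] show ?thesis using that(2-4) by metis
  qed
  have X: "X Y \<in> Obj C" "e Y \<in> Arr D" "Dom D (e Y) = OMap F (X Y)" "Cod D (e Y) = Y" if "Y \<in> Obj D" for Y
    using Xe[OF that] by auto
  define g where "g f = (THE h. h \<in> hom C (X (Dom D f)) (X (Cod D f)) \<and>
    e (Cod D f) \<cdot>\<^bsub>D\<^esub> AMap F h = f \<cdot>\<^bsub>D\<^esub> e (Dom D f))" for f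
  have g: "g f \<in> hom C (X (Dom D f)) (X (Cod D f)) \<and> e (Cod D f) \<cdot>\<^bsub>D\<^esub> AMap F (g f) = f
    \<cdot>\<^bsub>D\<^esub> e (Dom D f)"
    if "f \<in> Arr D" for f
    unfolding g_def by (rule theI') (use uniq[of "Cod D f" "X (Dom D f)" "f \<cdot>\<^bsub>D\<^esub> e (Dom D f)"] X that in auto)
  let ?G = "\<lparr>OMap = X, AMap = g\<rparr>"
  have "is_functor D C ?G"
  proof (rule is_functorI)
    show "AMap ?G (Ident D Y) = Ident C (OMap ?G Y)" if "Y \<in> Obj D" for Y
      using g[of "Ident D Y"] X[OF that] that by (auto intro!: eq[of Y _ "X Y"])
    show "AMap ?G (f' \<cdot>\<^bsub>D\<^esub> f) = AMap ?G f' \<cdot>\<^bsub>C\<^esub> AMap ?G f"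
      if f: "f \<in> Arr D" "f' \<in> Arr D" "Dom D f' = Cod D f" for f f'
    proof -
      have "e (Cod D f') \<cdot>\<^bsub>D\<^esub> AMap F (g f' \<cdot>\<^bsub>C\<^esub> g f) = f' \<cdot>\<^bsub>D\<^esub> f
        \<cdot>\<^bsub>D\<^esub> e (Dom D f)"
        using g[OF f(1)] g[OF f(2)] g[OF f(2), THEN conjunct2, THEN D.reassoc] X f by simp
      moreover have "e (Cod D f') \<cdot>\<^bsub>D\<^esub> AMap F (g (f' \<cdot>\<^bsub>D\<^esub> f)) = f' \<cdot>\<^bsub>D\<^esub>
        f \<cdot>\<^bsub>D\<^esub> e (Dom D f)"
        using g[of "f' \<cdot>\<^bsub>D\<^esub> f"] f by simp
      ultimately show ?thesis
        using g[of "f' \<cdot>\<^bsub>D\<^esub> f"] g[OF f(1)] g[OF f(2)] f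
        by (simp, intro eq[of "Cod D f'" _ "X (Dom D f)"]) simp_all
    qed
  qed (use X g in \<open>auto simp: C.category_axioms D.category_axioms\<close>)
  then have G: "is_functor D C ?G" .
  have "is_functor D D id_func" by (rule is_functorI) (simp_all add: D.category_axioms)
  then have "nat_trans D D (F \<odot> ?G) id_func e"
    unfolding nat_trans_def using is_functor_comp[OF G F] X g by simp
  then have "right_adjoint C D F ?G e"
    unfolding right_adjoint_def
    by (intro conjI ballI F G) (simp_all only: func.simps uniq)
  then show ?thesis by blast
qed

locale finite_limit_category = category C for C :: "('o, 'a) cat" (structure) +
  assumes finite_limits: "has_finite_limits C"
begin

lemma pb: "f \<in> Arr C \<Longrightarrow> u \<in> Arr C \<Longrightarrow> Cod C f = Cod C u \<Longrightarrow> is_pullback C f u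
  (pb1 C f u) (pb2 C f u)"
  using has_pullbacks finite_limits by blast

lemma pb_pair_eq: "pb_pair C f u = pair C (pb1 C f u) (pb2 C f u)"
  by (simp add: pb_pair_def pair_def fun_eq_iff)

lemma pullback_func_arr:
  assumes "f \<in> Arr C" "(u, k, v) \<in> Arr (slice C (Cod C f))"
  defines "n \<equiv> pb_pair C f v (pb1 C f u) (k \<cdot> pb2 C f u)"
  shows "n \<in> Arr C" "Dom C n = Dom C (pb1 C f u)" "Cod C n = Dom C (pb1 C f v)"
    "pb1 C f v \<cdot> n = pb1 C f u" "pb2 C f v \<cdot> n = k \<cdot> pb2 C f u"
proof -
  have u: "is_pullback C f u (pb1 C f u) (pb2 C f u)" and v: "is_pullback C f v (pb1 C f v) (pb2 C f v)"
    using assms by (auto intro: pb)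
  note [simp] = pullbackD[OF u]
  have "f \<cdot> pb1 C f u = v \<cdot> (k \<cdot> pb2 C f u)"
    using assms(2) reassoc1[of v k u "pb2 C f u"] by simp
  from pair[OF v _ _ _ _ _ this] assms(2)
  show "n \<in> Arr C" "Dom C n = Dom C (pb1 C f u)" "Cod C n = Dom C (pb1 C f v)"
    "pb1 C f v \<cdot> n = pb1 C f u" "pb2 C f v \<cdot> n = k \<cdot> pb2 C f u"
    by (simp_all add: n_def pb_pair_eq)
qed

lemma pullback_functor:
  assumes f: "f \<in> Arr C"
  shows "is_functor (slice C (Cod C f)) (slice C (Dom C f)) (pullback_func C f)"
    (is "is_functor ?S ?T ?P")
proof (rule is_functorI)
  have pb': "is_pullback C f u (pb1 C f u) (pb2 C f u)" if "u \<in> Arr C" "Cod C u = Cod C f" for u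
    using pb f that by simp
  show "OMap ?P u \<in> Obj ?T" if "u \<in> Obj ?S" for u
    using that pullbackD[OF pb', of u] by (simp add: pullback_func_def)
  show "AMap ?P x \<in> Arr ?T \<and> Dom ?T (AMap ?P x) = OMap ?P (Dom ?S x) \<and> Cod ?T (AMap ?P x) = OMap ?P (Cod ?S x)"
    if "x \<in> Arr ?S" for x
    using that
  proof (cases rule: slice_arrE)
    case (1 u k v)
    then show ?thesis
      using pullback_func_arr[OF f, of u k v] pullbackD[OF pb', of u] pullbackD[OF pb', of v]
      by (simp add: pullback_func_def)
  qed
  show "AMap ?P (Ident ?S u) = Ident ?T (OMap ?P u)" if "u \<in> Obj ?S" for u
    using that pullbackD[OF pb', of u] pair_eq[OF pb', of u "Ident C (Dom C (pb1 C f u))"]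
    by (simp add: pullback_func_def pb_pair_eq)
  show "AMap ?P (y \<cdot>\<^bsub>?S\<^esub> x) = AMap ?P y \<cdot>\<^bsub>?T\<^esub> AMap ?P x"
    if xy: "x \<in> Arr ?S" "y \<in> Arr ?S" "Dom ?S y = Cod ?S x" for x y
  proof -
    obtain u k v where x: "x = (u, k, v)" by (cases x)
    with xy obtain l w where y: "y = (v, l, w)" by (cases y) simp
    have xy': "(u, k, v) \<in> Arr ?S" "(v, l, w) \<in> Arr ?S" using xy x y by simp_all
    have yx: "(u, l \<cdot> k, w) \<in> Arr ?S" using xy' reassoc1[of w l v k] by simp
    note n1 = pullback_func_arr[OF f xy'(1)]
    note n2 = pullback_func_arr[OF f xy'(2)]
    note n3 = pullback_func_arr[OF f yx]
    have "pb_pair C f w (pb1 C f u) ((l \<cdot> k) \<cdot> pb2 C f u) =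
        pb_pair C f w (pb1 C f v) (l \<cdot> pb2 C f v) \<cdot> pb_pair C f v (pb1 C f u) (k \<cdot> pb2 C f u)"
      apply (rule pullback_eqI[OF pb'[of w]])
      using n1 n2 n3 xy' n2(4,5)[THEN reassoc1] pullbackD[OF pb', of u] pullbackD[OF pb', of v] pullbackD[OF pb', of w]
      apply simp_all
      done
    then show ?thesis by (simp add: x y pullback_func_def)
  qed
qed (rule category_slice)+

end

section \<open>Generalized elements and operations\<close>

text \<open>
  For \<open>g : A \<rightarrow> B\<close>, \<open>h : A \<rightarrow> I\<close> and \<open>u : X \<rightarrow> I\<close>, an arrow from \<open>b : T \<rightarrow> B\<close> to \<open>g\<^sub>* (h\<^sup>* u)\<close> over \<open>B\<close> is
  the same thing as an arrow \<open>e : Q \<rightarrow> X\<close> with \<open>u e = h p\<close>, where \<open>(p, q)\<close> is a pullback of \<open>g\<close> along \<open>b\<close>.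
  Such a generalized element is written \<open>Gel b p q e\<close>.  Any pullback is admitted, so that no choices
  have to be compared; \<open>gmor\<close> makes generalized elements into a category, a terminal object of
  which (\<open>univ\<close>) is a representation of \<open>g\<^sub>* (h\<^sup>* u)\<close>.
\<close>

datatype 'a gel = Gel (gb: 'a) (gp: 'a) (gq: 'a) (ge: 'a)

definition gelem :: "('o, 'a) cat \<Rightarrow> 'a \<Rightarrow> 'a \<Rightarrow> 'a \<Rightarrow> 'a gel \<Rightarrow> bool" where
  "gelem C g h u x \<longleftrightarrow> is_pullback C g (gb x) (gp x) (gq x) \<and> u \<in> Arr C \<and> h \<in> Arr C \<and> Dom
    C h = Dom C g \<and>
     Cod C u = Cod C h \<and> ge x \<in> hom C (Dom C (gp x)) (Dom C u) \<and> u \<cdot>\<^bsub>C\<^esub> ge x = h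
       \<cdot>\<^bsub>C\<^esub> gp x"

definition gmor :: "('o, 'a) cat \<Rightarrow> 'a gel \<Rightarrow> 'a gel \<Rightarrow> 'a \<Rightarrow> 'a \<Rightarrow> bool"
  where
  "gmor C x y m n \<longleftrightarrow> m \<in> hom C (Dom C (gb x)) (Dom C (gb y)) \<and> n \<in> hom C (Dom C (gp x)) (Dom C (gp
    y)) \<and>
     gb y \<cdot>\<^bsub>C\<^esub> m = gb x \<and> gp y \<cdot>\<^bsub>C\<^esub> n = gp x \<and> gq y \<cdot>\<^bsub>C\<^esub> n =
       m \<cdot>\<^bsub>C\<^esub> gq x \<and> ge y \<cdot>\<^bsub>C\<^esub> n = ge x"

definition push :: "('o, 'a) cat \<Rightarrow> 'a \<Rightarrow> 'a gel \<Rightarrow> 'a gel" where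
  "push C k x = Gel (gb x) (gp x) (gq x) (k \<cdot>\<^bsub>C\<^esub> ge x)"

lemma push_simps [simp]:
  "gb (push C k x) = gb x" "gp (push C k x) = gp x" "gq (push C k x) = gq x" "ge (push C k x) = k \<cdot>\<^bsub>C\<^esub> ge x"
  by (simp_all add: push_def)

lemma map_gel_simps [simp]:
  "gb (map_gel F x) = F (gb x)" "gp (map_gel F x) = F (gp x)" "gq (map_gel F x) = F (gq x)" "ge (map_gel F x) = F (ge x)"
  by (cases x; simp)+

text \<open>Uniqueness is asked of \<open>m\<close> alone. It extends to \<open>n\<close>, which
  \<open>m\<close> determines because \<open>gp y\<close> and \<open>gq y\<close> are the legs of a
  pullback.\<close>

definition univ :: "('o, 'a) cat \<Rightarrow> 'a \<Rightarrow> 'a \<Rightarrow> 'a \<Rightarrow> 'a gel \<Rightarrow> bool" where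
  "univ C g h u y \<longleftrightarrow> gelem C g h u y \<and> (\<forall>x. gelem C g h u x \<longrightarrow> (\<exists>!m.
    \<exists>n. gmor C x y m n))"

definition name :: "('o, 'a) cat \<Rightarrow> 'a gel \<Rightarrow> 'a gel \<Rightarrow> 'a" where
  "name C y x = (THE m. \<exists>n. gmor C x y m n)"

text \<open>
  By the Yoneda lemma, an algebra structure \<open>f\<^sub>! (g\<^sub>* (h\<^sup>* u)) \<rightarrow> u\<close> is a natural operation on the generalized
  elements of \<open>g\<^sub>* (h\<^sup>* u)\<close>.  The values of \<open>\<sigma>\<close> on other arguments are junk.
\<close>

definition op_alg :: "('o, 'a) cat \<Rightarrow> 'a \<Rightarrow> 'a \<Rightarrow> 'a \<Rightarrow> 'a \<Rightarrow> ('a gel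
  \<Rightarrow> 'a) \<Rightarrow> bool" where
  "op_alg C f g h u \<sigma> \<longleftrightarrow> u \<in> Arr C \<and> Cod C u = Cod C f \<and>
     (\<forall>x. gelem C g h u x \<longrightarrow> \<sigma> x \<in> hom C (Dom C (gb x)) (Dom C u) \<and> u
       \<cdot>\<^bsub>C\<^esub> \<sigma> x = f \<cdot>\<^bsub>C\<^esub> gb x) \<and>
     (\<forall>x y m n. gelem C g h u x \<and> gelem C g h u y \<and> gmor C x y m n \<longrightarrow> \<sigma> x = \<sigma> y
       \<cdot>\<^bsub>C\<^esub> m)"

definition op_hom :: "('o, 'a) cat \<Rightarrow> 'a \<Rightarrow> 'a \<Rightarrow> 'a \<Rightarrow> ('a gel \<Rightarrow> 'a)
  \<Rightarrow> 'a \<Rightarrow> ('a gel \<Rightarrow> 'a) \<Rightarrow> 'a \<Rightarrow> bool" where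
  "op_hom C g h u \<sigma> v \<tau> k \<longleftrightarrow> k \<in> hom C (Dom C u) (Dom C v) \<and> v \<cdot>\<^bsub>C\<^esub> k =
    u \<and>
     (\<forall>x. gelem C g h u x \<longrightarrow> k \<cdot>\<^bsub>C\<^esub> \<sigma> x = \<tau> (push C k x))"

definition op_initial :: "('o, 'a) cat \<Rightarrow> 'a \<Rightarrow> 'a \<Rightarrow> 'a \<Rightarrow> 'a \<Rightarrow> ('a gel
  \<Rightarrow> 'a) \<Rightarrow> bool" where
  "op_initial C f g h u \<sigma> \<longleftrightarrow> op_alg C f g h u \<sigma> \<and>
     (\<forall>v \<tau>. op_alg C f g h v \<tau> \<longrightarrow> (\<exists>!k. op_hom C g h u \<sigma> v \<tau> k))"

lemma op_initialE:
  assumes "op_initial C f g h u \<sigma>" "op_alg C f g h v \<tau>"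
  obtains k where "op_hom C g h u \<sigma> v \<tau> k" "\<And>l. op_hom C g h u \<sigma> v \<tau> l \<Longrightarrow> l = k"
proof -
  have "\<exists>!k. op_hom C g h u \<sigma> v \<tau> k" using assms by (simp add: op_initial_def)
  then show ?thesis using that by blast
qed

lemma univ_gelem: "univ C g h u y \<Longrightarrow> gelem C g h u y"
  by (simp add: univ_def)

section \<open>Calculus of generalized elements and their names\<close>

context category
begin

lemma gelemD:
  assumes "gelem C g h u x"
  shows "is_pullback C g (gb x) (gp x) (gq x)"
    "gb x \<in> Arr C" "gp x \<in> Arr C" "gq x \<in> Arr C" "ge x \<in> Arr C" "u \<in> Arr C" "h \<in> Arr C" "g \<in> Arr C"
    "Dom C h = Dom C g" "Cod C u = Cod C h" "Cod C (gb x) = Cod C g"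
    "Dom C (gq x) = Dom C (gp x)" "Dom C (ge x) = Dom C (gp x)"
    "Cod C (gp x) = Dom C g" "Cod C (gq x) = Dom C (gb x)" "Cod C (ge x) = Dom C u"
    "g \<cdot> gp x = gb x \<cdot> gq x" "u \<cdot> ge x = h \<cdot> gp x"
  using assms pullbackD[of g "gb x" "gp x" "gq x"] unfolding gelem_def by simp_all

lemma gelemI:
  assumes "is_pullback C g (gb x) (gp x) (gq x)" "u \<in> Arr C" "h \<in> Arr C" "Dom C h = Dom C g"
    "Cod C u = Cod C h" "ge x \<in> Arr C" "Dom C (ge x) = Dom C (gp x)" "Cod C (ge x) = Dom C u"
    "u \<cdot> ge x = h \<cdot> gp x"
  shows "gelem C g h u x"
  using assms by (simp add: gelem_def)

lemma gelem_push:
  assumes x: "gelem C g h u x" and k: "k \<in> Arr C" "v \<in> Arr C" "Dom C k = Dom C u" "Cod C k = Dom C v" "v \<cdot> k = u"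
  shows "gelem C g h v (push C k x)"
proof -
  note [simp] = gelemD(2-)[OF x]
  have "Cod C v = Cod C h" using k(5) cod_cmp[of k v] k by simp
  then show ?thesis
    by (intro gelemI) (use k gelemD(1)[OF x] reassoc1[OF k(5), of "ge x"] in simp_all)
qed

lemma push_push:
  assumes "gelem C g h u x" "k \<in> Arr C" "Dom C k = Dom C u" "l \<in> Arr C" "Dom C l = Cod C k"
  shows "push C l (push C k x) = push C (l \<cdot> k) x"
  using gelemD[OF assms(1)] assms by (simp add: push_def)

lemma push_ident: "gelem C g h u x \<Longrightarrow> push C (Ident C (Dom C u)) x = x"
  using gelemD[of g h u x] by (cases x) (simp add: push_def)

lemma gmor_comp:
  assumes x: "gelem C g h u x" and y: "gelem C g h u y" and z: "gelem C g h u z"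
    and m: "gmor C x y m n" "gmor C y z m' n'"
  shows "gmor C x z (m' \<cdot> m) (n' \<cdot> n)"
proof -
  note [simp] = gelemD(2-16)[OF x] gelemD(2-16)[OF y] gelemD(2-16)[OF z]
  have [simp]: "m \<in> Arr C" "n \<in> Arr C" "m' \<in> Arr C" "n' \<in> Arr C" "Dom C m = Dom C (gb x)" "Cod C m = Dom C (gb y)"
     "Dom C n = Dom C (gp x)" "Cod C n = Dom C (gp y)" "Dom C m' = Dom C (gb y)" "Cod C m' = Dom C (gb z)"
     "Dom C n' = Dom C (gp y)" "Cod C n' = Dom C (gp z)"
   and s: "gb y \<cdot> m = gb x" "gp y \<cdot> n = gp x" "gq y \<cdot> n = m \<cdot> gq x" "ge y \<cdot> n = ge x"
     "gb z \<cdot> m' = gb y" "gp z \<cdot> n' = gp y" "gq z \<cdot> n' = m' \<cdot> gq y" "ge z \<cdot> n' = ge y"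
    using m by (simp_all add: gmor_def)
  show ?thesis
    using s reassoc1[OF s(5), of m] reassoc1[OF s(6), of n] reassoc[OF s(7), of n] reassoc1[OF s(8), of n]
    by (simp add: gmor_def)
qed

lemma gmor_ident:
  assumes "gelem C g h u x" shows "gmor C x x (Ident C (Dom C (gb x))) (Ident C (Dom C (gp x)))"
  using gelemD[OF assms] by (simp add: gmor_def)

lemma gmor_push:
  assumes "gelem C g h u x" "gelem C g h u y" "k \<in> Arr C" "Dom C k = Dom C u" "gmor C x y m n"
  shows "gmor C (push C k x) (push C k y) m n"
  using assms gelemD[OF assms(1)] gelemD[OF assms(2)] by (simp add: gmor_def)

lemma univ_name:
  assumes "univ C g h u y" "gelem C g h u x"
  obtains n where "gmor C x y (name C y x) n"
proof -
  have "\<exists>!m. \<exists>n. gmor C x y m n" using assms by (simp add: univ_def)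
  from theI'[OF this, folded name_def] that show ?thesis by blast
qed

lemma name_eq:
  assumes "univ C g h u y" "gelem C g h u x" "gmor C x y m n"
  shows "name C y x = m"
proof -
  have "\<exists>!m. \<exists>n. gmor C x y m n" using assms by (simp add: univ_def)
  then show ?thesis unfolding name_def using assms(3) by blast
qed

lemma name_hom:
  assumes "univ C g h u y" "gelem C g h u x"
  shows "name C y x \<in> Arr C" "Dom C (name C y x) = Dom C (gb x)" "Cod C (name C y x) = Dom C (gb y)"
    "gb y \<cdot> name C y x = gb x"
  using univ_name[OF assms] by (auto simp: gmor_def)

lemma name_self:
  assumes "univ C g h u y" shows "name C y y = Ident C (Dom C (gb y))"
  using name_eq[OF assms _ gmor_ident] univ_gelem[OF assms] by blast

lemma name_gmor:
  assumes y: "univ C g h u y" and x: "gelem C g h u x" and z: "gelem C g h u z" and m: "gmor C x z m n"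
  shows "name C y x = name C y z \<cdot> m"
proof -
  obtain n' where "gmor C z y (name C y z) n'" using univ_name[OF y z] .
  from gmor_comp[OF x z univ_gelem[OF y] m this] show ?thesis by (rule name_eq[OF y x])
qed

text \<open>Two terminal objects are isomorphic in a unique way. The comparison maps between
  pushforwards will be identified with such names and are invertible for this reason.\<close>

lemma univ_inverse:
  assumes y: "univ C g h u y" and y': "univ C g h u y'"
  shows "inverse_arrows C (name C y y') (name C y' y)"
proof -
  note e = univ_gelem[OF y] univ_gelem[OF y']
  obtain n where n: "gmor C y y' (name C y' y) n" using univ_name[OF y' e(1)] .
  obtain n' where n': "gmor C y' y (name C y y') n'" using univ_name[OF y e(2)] .
  show ?thesis
    using name_gmor[OF y e n] name_gmor[OF y' e(2,1) n'] name_self[OF y] name_self[OF y']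
      name_hom[OF y e(2)] name_hom[OF y' e(1)]
    by (simp add: inverse_arrows_def)
qed

text \<open>A retract of a terminal object is terminal: an arrow \<open>k\<close> into
  \<open>z\<close> equals \<open>m \<cdot> (m' \<cdot> k)\<close>, and \<open>m' \<cdot> k\<close>
  is forced to be the name in \<open>y\<close>.\<close>

lemma univ_transport:
  assumes y: "univ C g h u y" and z: "gelem C g h u z"
    and m: "gmor C y z m n" "gmor C z y m' n'" and mm: "m \<cdot> m' = Ident C (Dom C (gb z))"
  shows "univ C g h u z"
  unfolding univ_def
proof (intro conjI z allI impI)
  fix x assume x: "gelem C g h u x"
  note ye = univ_gelem[OF y]
  obtain l where l: "gmor C x y (name C y x) l" using univ_name[OF y x] .
  show "\<exists>!k. \<exists>n. gmor C x z k n"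
  proof (rule ex1I)
    show "\<exists>n. gmor C x z (m \<cdot> name C y x) n" using gmor_comp[OF x ye z l m(1)] by blast
  next
    fix k assume "\<exists>n. gmor C x z k n"
    then obtain j where j: "gmor C x z k j" by blast
    have "name C y x = m' \<cdot> k" using name_eq[OF y x gmor_comp[OF x z ye j m(2)]] .
    then have "m \<cdot> name C y x = (m \<cdot> m') \<cdot> k"
      using j m z by (simp add: gmor_def)
    then show "k = m \<cdot> name C y x" using j by (simp add: mm gmor_def)
  qed
qed

section \<open>Natural operations and their homomorphisms\<close>

lemma op_algD:
  assumes "op_alg C f g h u \<sigma>"
  shows "u \<in> Arr C" "Cod C u = Cod C f"
    and "gelem C g h u x \<Longrightarrow> \<sigma> x \<in> Arr C" "gelem C g h u x \<Longrightarrow> Dom C (\<sigma> x) = Dom C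
      (gb x)"
      "gelem C g h u x \<Longrightarrow> Cod C (\<sigma> x) = Dom C u" "gelem C g h u x \<Longrightarrow> u \<cdot> \<sigma> x = f
        \<cdot> gb x"
    and "\<lbrakk>gelem C g h u x; gelem C g h u y; gmor C x y m n\<rbrakk> \<Longrightarrow> \<sigma> x = \<sigma> y \<cdot> m"
  using assms unfolding op_alg_def by (simp_all, blast)

lemma op_algI:
  assumes "u \<in> Arr C" "Cod C u = Cod C f"
    and "\<And>x. gelem C g h u x \<Longrightarrow> \<sigma> x \<in> Arr C \<and> Dom C (\<sigma> x) = Dom C (gb x) \<and> Cod C
      (\<sigma> x) = Dom C u \<and>
      u \<cdot> \<sigma> x = f \<cdot> gb x"
    and "\<And>x y m n. \<lbrakk>gelem C g h u x; gelem C g h u y; gmor C x y m n\<rbrakk> \<Longrightarrow> \<sigma> x = \<sigma>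
      y \<cdot> m"
  shows "op_alg C f g h u \<sigma>"
  unfolding op_alg_def in_hom using assms by blast

text \<open>One half of the Yoneda correspondence: a structure map \<open>s\<close> on the
  representing object acts on an element through its name. The other half is
  \<open>op_alg_univ\<close>, which recovers an operation from its value at a universal
  element.\<close>

lemma op_alg_of:
  assumes y: "univ C g h u y" and f: "f \<in> Arr C" "Dom C f = Cod C g" "Cod C f = Cod C h"
    and s: "s \<in> Arr C" "Dom C s = Dom C (gb y)" "Cod C s = Dom C u" "u \<cdot> s = f \<cdot> gb y"
  shows "op_alg C f g h u (\<lambda>x. s \<cdot> name C y x)"
proof (rule op_algI)
  note ye = gelemD[OF univ_gelem[OF y]]
  show "u \<in> Arr C" "Cod C u = Cod C f" using ye f by simp_all
  show "s \<cdot> name C y x \<in> Arr C \<and> Dom C (s \<cdot> name C y x) = Dom C (gb x) \<and> Cod C (s \<cdot> name C y x) =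
    Dom C u \<and>
      u \<cdot> (s \<cdot> name C y x) = f \<cdot> gb x" if x: "gelem C g h u x" for x
  proof -
    note n = name_hom[OF y x]
    have "u \<cdot> (s \<cdot> name C y x) = f \<cdot> (gb y \<cdot> name C y x)"
      using s f ye n(1-3) by (intro reassoc) simp_all
    then show ?thesis using n s by simp
  qed
  show "s \<cdot> name C y x = (s \<cdot> name C y z) \<cdot> m" if x: "gelem C g h u x" and z: "gelem C g h u z" and m: "gmor C x
    z m n" for x z m n
    using name_gmor[OF y x z m] name_hom[OF y z] s m by (simp add: gmor_def)
qed

lemma op_alg_univ:
  assumes "op_alg C f g h u \<sigma>" "univ C g h u y" "gelem C g h u x"
  shows "\<sigma> x = \<sigma> y \<cdot> name C y x"
proof -
  obtain n where "gmor C x y (name C y x) n" using univ_name assms(2,3) .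
  then show ?thesis by (rule op_algD(7)[OF assms(1,3) univ_gelem[OF assms(2)]])
qed

lemma op_homD:
  assumes "op_hom C g h u \<sigma> v \<tau> k"
  shows "k \<in> Arr C" "Dom C k = Dom C u" "Cod C k = Dom C v" "v \<cdot> k = u"
    "gelem C g h u x \<Longrightarrow> k \<cdot> \<sigma> x = \<tau> (push C k x)"
  using assms by (simp_all add: op_hom_def)

text \<open>Both sides of the homomorphism condition are natural in the element, so they agree
  everywhere once they agree at a universal element.\<close>

lemma op_hom_univ:
  assumes \<sigma>: "op_alg C f g h u \<sigma>" and \<tau>: "op_alg C f g h v \<tau>" and y: "univ C g h u y"
    and k: "k \<in> Arr C" "Dom C k = Dom C u" "Cod C k = Dom C v" "v \<cdot> k = u" "k \<cdot> \<sigma> y = \<tau> (push C k y)"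
  shows "op_hom C g h u \<sigma> v \<tau> k"
proof -
  have "k \<cdot> \<sigma> x = \<tau> (push C k x)" if x: "gelem C g h u x" for x
  proof -
    note ye = univ_gelem[OF y]
    obtain n where n: "gmor C x y (name C y x) n" using univ_name[OF y x] .
    have v: "v \<in> Arr C" using op_algD(1)[OF \<tau>] .
    have "\<tau> (push C k x) = \<tau> (push C k y) \<cdot> name C y x"
      using x ye n k v by (intro op_algD(7)[OF \<tau>] gelem_push gmor_push) auto
    also have "\<dots> = k \<cdot> (\<sigma> y \<cdot> name C y x)"
      using k name_hom[OF y x] op_algD(3-5)[OF \<sigma> ye] by (simp flip: k(5))
    finally show ?thesis using op_alg_univ[OF \<sigma> y x] by simp
  qed
  then show ?thesis using k by (simp add: op_hom_def)
qed

lemma op_hom_ident: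
  assumes "op_alg C f g h u \<sigma>"
  shows "op_hom C g h u \<sigma> u \<sigma> (Ident C (Dom C u))"
  using op_algD[OF assms] by (auto simp: op_hom_def push_ident)

lemma op_hom_comp:
  assumes \<sigma>: "op_alg C f g h u \<sigma>" and \<tau>: "op_alg C f g h v \<tau>" and \<rho>: "op_alg C f g h w \<rho>"
    and k: "op_hom C g h u \<sigma> v \<tau> k" and l: "op_hom C g h v \<tau> w \<rho> l"
  shows "op_hom C g h u \<sigma> w \<rho> (l \<cdot> k)"
proof -
  note [simp] = op_homD(1-3)[OF k] op_homD(1-3)[OF l] op_algD(1)[OF \<sigma>] op_algD(1)[OF \<tau>] op_algD(1)[OF \<rho>]
  have "(l \<cdot> k) \<cdot> \<sigma> x = \<rho> (push C (l \<cdot> k) x)" if x: "gelem C g h u x" for x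
  proof -
    have kx: "gelem C g h v (push C k x)" using x op_homD(4)[OF k] by (intro gelem_push) simp_all
    show ?thesis
      using op_homD(5)[OF k x] op_homD(5)[OF l kx] op_algD(3-5)[OF \<sigma> x] x by (simp add: push_push)
  qed
  then show ?thesis using op_homD(4)[OF k] reassoc1[OF op_homD(4)[OF l], of k] by (simp add: op_hom_def)
qed

text \<open>A retract of an initial algebra is initial: a homomorphism \<open>l\<close> out of it
  equals \<open>(l \<cdot> i) \<cdot> j\<close>, and \<open>l \<cdot> i\<close> is forced.\<close>

lemma op_initial_transport:
  assumes u: "op_initial C f g h u \<sigma>" and u': "op_alg C f g h u' \<sigma>'"
    and i: "op_hom C g h u \<sigma> u' \<sigma>' i" and j: "op_hom C g h u' \<sigma>' u \<sigma> j" and ij: "i \<cdot> j = Ident C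
      (Dom C u')"
  shows "op_initial C f g h u' \<sigma>'"
  unfolding op_initial_def
proof (intro conjI u' allI impI)
  fix v \<tau> assume v: "op_alg C f g h v \<tau>"
  have ua: "op_alg C f g h u \<sigma>" using u by (simp add: op_initial_def)
  obtain k where k: "op_hom C g h u \<sigma> v \<tau> k" "\<And>l. op_hom C g h u \<sigma> v \<tau> l \<Longrightarrow> l = k"
    using op_initialE[OF u v] by blast
  show "\<exists>!k. op_hom C g h u' \<sigma>' v \<tau> k"
  proof (rule ex1I)
    show "op_hom C g h u' \<sigma>' v \<tau> (k \<cdot> j)" using op_hom_comp[OF u' ua v j k(1)] .
  next
    fix l assume l: "op_hom C g h u' \<sigma>' v \<tau> l"
    have "l \<cdot> i = k" using op_hom_comp[OF ua u' v i l] by (rule k(2))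
    then have "k \<cdot> j = l \<cdot> (i \<cdot> j)" using op_homD(1-3)[OF i] op_homD(1-3)[OF j] op_homD(1-3)[OF l] by auto
    then show "l = k \<cdot> j" using op_homD(1-3)[OF l] by (simp add: ij)
  qed
qed

end

section \<open>Local cartesian closure through universal elements\<close>

context category
begin

text \<open>Moves an element to another pullback of \<open>g\<close> along the same base arrow. The
  move covers the identity of the base in both directions, so names are unaffected.\<close>

lemma repullback:
  assumes x: "gelem C g h u x" and P: "is_pullback C g (gb x) p q"
  obtains z i j where "gelem C g h u z" "gb z = gb x" "gp z = p" "gq z = q"
    "gmor C z x (Ident C (Dom C (gb x))) i" "gmor C x z (Ident C (Dom C (gb x))) j"
proof -
  note [simp] = gelemD(2-16)[OF x] pullbackD(4-8)[OF P]
  note px = gelemD(1)[OF x]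
  let ?i = "pair C (gp x) (gq x) p q" and ?j = "pair C p q (gp x) (gq x)"
  note i = pair[OF px _ _ _ _ _ pullbackD(9)[OF P], simplified]
  note j = pair[OF P _ _ _ _ _ gelemD(17)[OF x], simplified]
  have ij: "?i \<cdot> ?j = Ident C (Dom C (gp x))"
    by (rule pullback_eqI[OF px]) (use i j i(4)[THEN reassoc1, of ?j] i(5)[THEN reassoc1, of ?j] in simp_all)
  have ue: "u \<cdot> (ge x \<cdot> ?i) = h \<cdot> (gp x \<cdot> ?i)"
    by (rule reassoc[OF gelemD(18)[OF x]]) (use i in simp_all)
  have "gelem C g h u (Gel (gb x) p q (ge x \<cdot> ?i))"
    by (rule gelemI) (use P i ue in simp_all)
  moreover have "gmor C (Gel (gb x) p q (ge x \<cdot> ?i)) x (Ident C (Dom C (gb x))) ?i"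
    using i by (simp add: gmor_def)
  moreover have "gmor C x (Gel (gb x) p q (ge x \<cdot> ?i)) (Ident C (Dom C (gb x))) ?j"
    using i j ij by (simp add: gmor_def)
  ultimately show ?thesis using that[of "Gel (gb x) p q (ge x \<cdot> ?i)" ?i ?j] by simp
qed

text \<open>Reduces \<open>g\<^sub>* (h\<^sup>* u)\<close> to the pushforward alone. By the pullback
  property of \<open>(a, c)\<close>, an arrow \<open>e\<close> with
  \<open>u \<cdot> e = h \<cdot> p\<close> is the same as an arrow \<open>e'\<close> with
  \<open>a \<cdot> e' = p\<close>, so both kinds of generalized elements have the same
  morphisms.\<close>

lemma univ_push_pullback:
  assumes P: "is_pullback C h u a c" and y: "univ C g (Ident C (Dom C g)) a y"
  shows "univ C g h u (push C c y)"
proof -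
  note ye = univ_gelem[OF y]
  note [simp] = gelemD(2-8)[OF ye] gelemD(11-16)[OF ye] pullbackD(1,2,4-8)[OF P]
  have [simp]: "Dom C h = Dom C g" "Cod C u = Cod C h"
    using gelemD(10)[OF ye] pullbackD(3,7)[OF P] by simp_all
  have ay: "a \<cdot> ge y = gp y" using gelemD(18)[OF ye] by simp
  have yc: "gelem C g h u (push C c y)"
  proof (rule gelemI)
    have "u \<cdot> (c \<cdot> ge y) = h \<cdot> (a \<cdot> ge y)"
      by (rule reassoc[OF pullbackD(9)[OF P, symmetric]]) simp_all
    then show "u \<cdot> ge (push C c y) = h \<cdot> gp (push C c y)" by (simp add: ay)
  qed (use gelemD(1)[OF ye] in simp_all)
  show ?thesis
    unfolding univ_def
  proof (intro conjI yc allI impI)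
    fix x assume x: "gelem C g h u x"
    note xD = gelemD[OF x]
    let ?e = "pair C a c (gp x) (ge x)"
    have e: "?e \<in> Arr C" "Dom C ?e = Dom C (gp x)" "Cod C ?e = Dom C a" "a \<cdot> ?e = gp x" "c \<cdot> ?e = ge x"
      using pair[OF P, of "gp x" "ge x"] xD by simp_all
    let ?x = "Gel (gb x) (gp x) (gq x) ?e"
    have xe: "gelem C g (Ident C (Dom C g)) a ?x"
      by (rule gelemI) (use xD(1-5,11-16) e in simp_all)
    have "gmor C ?x y m n \<longleftrightarrow> gmor C x (push C c y) m n" for m n
    proof
      assume m: "gmor C ?x y m n"
      then have "c \<cdot> (ge y \<cdot> n) = ge x" by (simp add: gmor_def e)
      then show "gmor C x (push C c y) m n" using m by (simp add: gmor_def)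
    next
      assume m: "gmor C x (push C c y) m n"
      have n: "n \<in> Arr C" "Dom C n = Dom C (gp x)" "Cod C n = Dom C (gp y)" "gp y \<cdot> n = gp x" "c \<cdot> (ge y \<cdot> n)
        = ge x"
        using m by (auto simp: gmor_def)
      have an: "a \<cdot> (ge y \<cdot> n) = gp x"
        using reassoc1[OF ay, of n] n by simp
      have "ge y \<cdot> n = ?e"
        by (rule pullback_eqI[OF P]) (use n an e in simp_all)
      then show "gmor C ?x y m n" using m by (simp add: gmor_def)
    qed
    moreover have "\<exists>!m. \<exists>n. gmor C ?x y m n" using y xe by (simp add: univ_def)
    ultimately show "\<exists>!m. \<exists>n. gmor C x (push C c y) m n" by simp
  qed
qed

text \<open>Operations carry junk values away from generalized elements, so two presentations of one
  operation need not be equal functions. Agreement on elements replaces equality.\<close>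

lemma op_hom_cong:
  assumes "v \<in> Arr C" "\<And>x. gelem C g h u x \<Longrightarrow> \<sigma> x = \<sigma>' x" "\<And>x. gelem C g h v x
    \<Longrightarrow> \<tau> x = \<tau>' x"
  shows "op_hom C g h u \<sigma> v \<tau> k \<longleftrightarrow> op_hom C g h u \<sigma>' v \<tau>' k"
proof -
  have "gelem C g h v (push C k x)" if "gelem C g h u x" "k \<in> hom C (Dom C u) (Dom C v)" "v \<cdot> k = u" for x
    using that assms(1) by (intro gelem_push) auto
  then show ?thesis using assms(2,3) by (auto simp: op_hom_def)
qed

end

context finite_limit_category
begin

text \<open>For elements on chosen pullbacks the second arrow of a \<open>gmor\<close> can only be
  the one that \<open>pullback_func\<close> produces from \<open>m\<close>. Its existence thereby
  becomes the equation that occurs in the universal property of the counit.\<close>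

lemma canonical_gmor:
  assumes y: "gelem C g h u y" "gp y = pb1 C g (gb y)" "gq y = pb2 C g (gb y)"
    and z: "gelem C g h v z" "gp z = pb1 C g (gb z)" "gq z = pb2 C g (gb z)"
  shows "(\<exists>n. gmor C z y m n) \<longleftrightarrow> m \<in> hom C (Dom C (gb z)) (Dom C (gb y)) \<and> gb y \<cdot> m = gb
    z \<and>
    ge y \<cdot> pb_pair C g (gb y) (pb1 C g (gb z)) (m \<cdot> pb2 C g (gb z)) = ge z"
    (is "?l \<longleftrightarrow> ?r")
proof -
  let ?n = "pb_pair C g (gb y) (pb1 C g (gb z)) (m \<cdot> pb2 C g (gb z))"
  note yD = gelemD[OF y(1), unfolded y(2,3)] and zD = gelemD[OF z(1), unfolded z(2,3)]
  show ?thesis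
  proof
    assume ?l
    then obtain n where n: "gmor C z y m n" by blast
    have nD: "n \<in> Arr C" "Dom C n = Dom C (pb1 C g (gb z))" "Cod C n = Dom C (pb1 C g (gb y))"
      "pb1 C g (gb y) \<cdot> n = pb1 C g (gb z)" "pb2 C g (gb y) \<cdot> n = m \<cdot> pb2 C g (gb z)" "ge y \<cdot> n = ge z"
      using n y(2,3) z(2,3) by (simp_all add: gmor_def)
    have "?n = n"
      using pair_eq[OF yD(1) nD(1,3)] nD(4,5) by (simp add: pb_pair_eq)
    then show ?r using n nD(6) by (simp add: gmor_def)
  next
    assume r: ?r
    have "(gb z, m, gb y) \<in> Arr (slice C (Cod C g))"
      using r yD zD by simp
    from pullback_func_arr[OF yD(8) this] have "gmor C z y m ?n"
      using r y(2,3) z(2,3) by (simp add: gmor_def)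
    then show ?l by blast
  qed
qed

text \<open>On chosen pullbacks the arrow \<open>ge y\<close> is an arrow of the slice from
  \<open>g\<^sup>* (gb y)\<close> to \<open>v\<close>, and terminality for \<open>gmor\<close> is
  its universality as an arrow from \<open>g\<^sup>*\<close>. This is the bridge between universal
  elements and \<open>right_adjoint\<close>.\<close>

lemma univ_iff_universal_arrow:
  assumes g: "g \<in> Arr C" and v: "v \<in> Arr C" "Cod C v = Dom C g"
    and y: "gelem C g (Ident C (Dom C g)) v y" "gp y = pb1 C g (gb y)" "gq y = pb2 C g (gb y)"
  shows "univ C g (Ident C (Dom C g)) v y \<longleftrightarrow>
    (\<forall>b \<in> Obj (slice C (Cod C g)). \<forall>k \<in> hom (slice C (Dom C g)) (OMap (pullback_func C g) b) v.
      \<exists>!h. h \<in> hom (slice C (Cod C g)) b (gb y) \<and>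
        (pb1 C g (gb y), ge y, v) \<cdot>\<^bsub>slice C (Dom C g)\<^esub> AMap (pullback_func C g) h = k)"
    (is "?l \<longleftrightarrow> (\<forall>b \<in> Obj ?S. \<forall>k \<in> hom ?T _ v. ?r b k)")
proof -
  have pbD: "pb1 C g b \<in> Arr C" "pb2 C g b \<in> Arr C" "Cod C (pb1 C g b) = Dom C g" "Dom C (pb2 C g b) = Dom C (pb1 C g b)"
    "is_pullback C g b (pb1 C g b) (pb2 C g b)" if "b \<in> Arr C" "Cod C b = Cod C g" for b
    using pb[of g b] pullbackD[OF pb[of g b]] that g by simp_all
  have yD: "gb y \<in> Arr C" "Cod C (gb y) = Cod C g" using gelemD[OF y(1)] by simp_all
  \<comment> \<open>The outer entries of a slice arrow are forced by its source and target, so a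
    transpose amounts to its middle entry \<open>m\<close>.\<close>
  have red: "(h \<in> hom ?S b (gb y) \<and> (pb1 C g (gb y), ge y, v) \<cdot>\<^bsub>?T\<^esub> AMap (pullback_func C g) h = k)
    \<longleftrightarrow>
      (\<exists>m. h = (b, m, gb y) \<and> (\<exists>n. gmor C z y m n))"
    if z: "gelem C g (Ident C (Dom C g)) v z" "gp z = pb1 C g (gb z)" "gq z = pb2 C g (gb z)"
     and b: "b = gb z" and k: "k = (pb1 C g b, ge z, v)" for h b k z
  proof -
    have b': "b \<in> Arr C" "Cod C b = Cod C g" using gelemD[OF z(1)] b by simp_all
    obtain b0 m w0 where h: "h = (b0, m, w0)" by (cases h)
    show ?thesis
      unfolding canonical_gmor[OF y z] using b' yD
      by (auto simp: h k b pullback_func_def)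
  qed
  have ex: "(\<exists>!h. \<exists>m. h = (b, m, w) \<and> Q m) \<longleftrightarrow> (\<exists>!m. Q m)" for b w :: 'a and Q
    by auto
  show ?thesis
  proof
    assume u: ?l
    show "\<forall>b \<in> Obj ?S. \<forall>k \<in> hom ?T (OMap (pullback_func C g) b) v. ?r b k"
    proof (intro ballI)
      fix b k assume b: "b \<in> Obj ?S" and k: "k \<in> hom ?T (OMap (pullback_func C g) b) v"
      then obtain k' where k': "k = (pb1 C g b, k', v)" by (cases k) (simp add: pullback_func_def)
      let ?z = "Gel b (pb1 C g b) (pb2 C g b) k'"
      have z: "gelem C g (Ident C (Dom C g)) v ?z"
        by (rule gelemI) (use b k k' pbD[of b] v g in simp_all)
      have "\<exists>!m. \<exists>n. gmor C ?z y m n" using u z by (simp add: univ_def)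
      moreover have "(h \<in> hom ?S b (gb y) \<and> (pb1 C g (gb y), ge y, v) \<cdot>\<^bsub>?T\<^esub> AMap (pullback_func C g) h
        = k) \<longleftrightarrow>
          (\<exists>m. h = (b, m, gb y) \<and> (\<exists>n. gmor C ?z y m n))" for h
        by (rule red[OF z]) (simp_all add: k')
      ultimately show "?r b k" by (simp only: ex)
    qed
  next
    assume r: "\<forall>b \<in> Obj ?S. \<forall>k \<in> hom ?T (OMap (pullback_func C g) b) v. ?r b k"
    show ?l
      unfolding univ_def
    proof (intro conjI y(1) allI impI)
      fix x assume x: "gelem C g (Ident C (Dom C g)) v x"
      have xb: "gb x \<in> Arr C" "Cod C (gb x) = Cod C g" using gelemD[OF x] by simp_all
      \<comment> \<open>The universal arrow only speaks about elements on chosen pullbacks; an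
        arbitrary \<open>x\<close> is first moved to one.\<close>
      obtain z i j where z: "gelem C g (Ident C (Dom C g)) v z" "gb z = gb x" "gp z = pb1 C g (gb x)" "gq z = pb2 C g (gb x)"
        and i: "gmor C z x (Ident C (Dom C (gb x))) i" and j: "gmor C x z (Ident C (Dom C (gb x))) j"
        using repullback[OF x pbD(5)[OF xb]] by blast
      let ?k = "(pb1 C g (gb x), ge z, v)"
      have kh: "?k \<in> hom ?T (OMap (pullback_func C g) (gb x)) v"
        using gelemD[OF z(1)] z(2-4) v pbD[OF xb] by (simp add: pullback_func_def)
      have "gb x \<in> Obj ?S" using xb by simp
      from bspec[OF bspec[OF r this] kh] have "?r (gb x) ?k" .
      moreover have "(h \<in> hom ?S (gb x) (gb y) \<and> (pb1 C g (gb y), ge y, v) \<cdot>\<^bsub>?T\<^esub> AMap (pullback_func C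
        g) h = ?k) \<longleftrightarrow>
          (\<exists>m. h = (gb x, m, gb y) \<and> (\<exists>n. gmor C z y m n))" for h
        by (rule red[OF z(1)]) (simp_all add: z(2-4))
      ultimately have "\<exists>!m. \<exists>n. gmor C z y m n" by (simp only: ex)
      moreover have "(\<exists>n. gmor C x y m n) \<longleftrightarrow> (\<exists>n. gmor C z y m n)" for m
      proof
        assume "\<exists>n. gmor C x y m n"
        then obtain n where n: "gmor C x y m n" by blast
        then show "\<exists>n. gmor C z y m n"
          using gmor_comp[OF z(1) x y(1) i n] z(2) by (auto simp: gmor_def)
      next
        assume "\<exists>n. gmor C z y m n"
        then obtain n where n: "gmor C z y m n" by blast
        then show "\<exists>n. gmor C x y m n"
          using gmor_comp[OF x z(1) y(1) j n] z(2) by (auto simp: gmor_def)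
      qed
      ultimately show "\<exists>!m. \<exists>n. gmor C x y m n" by simp
    qed
  qed
qed

text \<open>The universal element may sit on any pullback, which suits the comma category, where
  pullbacks are built by hand. It is moved to the chosen one before it is read as a universal
  arrow.\<close>

lemma lcccI:
  assumes ex: "\<And>g v. \<lbrakk>g \<in> Arr C; v \<in> Arr C; Cod C v = Dom C g\<rbrakk> \<Longrightarrow> \<exists>y. univ C g
    (Ident C (Dom C g)) v y"
  shows "lccc C"
  unfolding lccc_def
proof (intro conjI category_axioms finite_limits ballI)
  fix g assume g: "g \<in> Arr C"
  show "\<exists>G \<epsilon>. right_adjoint (slice C (Cod C g)) (slice C (Dom C g)) (pullback_func C g) G \<epsilon>"
  proof (rule right_adjointI[OF pullback_functor[OF g]])
    fix v assume "v \<in> Obj (slice C (Dom C g))"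
    then have v: "v \<in> Arr C" "Cod C v = Dom C g" by simp_all
    obtain y where y: "univ C g (Ident C (Dom C g)) v y" using ex[OF g v] by blast
    note ye = univ_gelem[OF y]
    have yb: "gb y \<in> Arr C" "Cod C (gb y) = Cod C g" using gelemD[OF ye] by simp_all
    obtain z i j where z: "gelem C g (Ident C (Dom C g)) v z" "gb z = gb y" "gp z = pb1 C g (gb z)" "gq z = pb2 C g (gb z)"
      and i: "gmor C z y (Ident C (Dom C (gb y))) i" and j: "gmor C y z (Ident C (Dom C (gb y))) j"
      using repullback[OF ye pb[OF g yb(1) yb(2)[symmetric]]] by metis
    have "univ C g (Ident C (Dom C g)) v z"
      by (rule univ_transport[OF y z(1) j i]) (use yb z(2) in simp)
    then
    have u: "\<forall>b \<in> Obj (slice C (Cod C g)). \<forall>k \<in> hom (slice C (Dom C g)) (OMap (pullback_func C g) b) v.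
      \<exists>!h. h \<in> hom (slice C (Cod C g)) b (gb z) \<and>
        (pb1 C g (gb z), ge z, v) \<cdot>\<^bsub>slice C (Dom C g)\<^esub> AMap (pullback_func C g) h = k"
      by (simp only: univ_iff_universal_arrow[OF g v z(1,3,4)])
    have e: "(pb1 C g (gb z), ge z, v) \<in> hom (slice C (Dom C g)) (OMap (pullback_func C g) (gb z)) v"
      using gelemD[OF z(1)] z(3,4) v by (simp add: pullback_func_def)
    show "\<exists>X e. X \<in> Obj (slice C (Cod C g)) \<and> e \<in> hom (slice C (Dom C g)) (OMap (pullback_func C g) X) v \<and>
      (\<forall>Z \<in> Obj (slice C (Cod C g)). \<forall>k \<in> hom (slice C (Dom C g)) (OMap (pullback_func C g) Z) v.
        \<exists>!h. h \<in> hom (slice C (Cod C g)) Z X \<and> e \<cdot>\<^bsub>slice C (Dom C g)\<^esub> AMap (pullback_func C g)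
          h = k)"
    proof (intro exI conjI)
      show "gb z \<in> Obj (slice C (Cod C g))" using yb z(2) by simp
    qed (rule e u)+
  qed
qed

end

section \<open>Algebras of a polynomial functor\<close>

text \<open>The counit of the chosen pushforward, repackaged as a generalized element;
  \<open>fst (snd _)\<close> extracts the underlying arrow from the slice triple.\<close>

definition canonical_pf :: "('o, 'a) cat \<Rightarrow> 'a \<Rightarrow> 'a \<Rightarrow> 'a gel" where
  "canonical_pf C g v = (let w = OMap (pushforward_func C g) v in
     Gel w (pb1 C g w) (pb2 C g w) (fst (snd (pushforward_counit C g v))))"

definition canonical :: "('o, 'a) cat \<Rightarrow> 'a \<Rightarrow> 'a \<Rightarrow> 'a \<Rightarrow> 'a gel" where
  "canonical C g h u = push C (pb2 C h u) (canonical_pf C g (pb1 C h u))"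

lemma Alg_simps [simp]:
  "(X, s) \<in> Obj (Alg C P) \<longleftrightarrow> X \<in> Obj C \<and> s \<in> hom C (OMap P X) X"
  "((X, s), h, (Y, t)) \<in> Arr (Alg C P) \<longleftrightarrow> X \<in> Obj C \<and> s \<in> hom C (OMap P X) X \<and>
       Y \<in> Obj C \<and> t \<in> hom C (OMap P Y) Y \<and> h \<in> hom C X Y \<and> h \<cdot>\<^bsub>C\<^esub> s = t
         \<cdot>\<^bsub>C\<^esub> AMap P h"
  "Dom (Alg C P) (a, h, b) = a"
  "Cod (Alg C P) (a, h, b) = b"
  by (simp_all add: Alg_def)

lemma right_adjointD:
  assumes "right_adjoint C D F G \<epsilon>"
  shows "is_functor C D F" "is_functor D C G"
    "Y \<in> Obj D \<Longrightarrow> \<epsilon> Y \<in> hom D (OMap F (OMap G Y)) Y"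
    "y \<in> Arr D \<Longrightarrow> y \<cdot>\<^bsub>D\<^esub> \<epsilon> (Dom D y) = \<epsilon> (Cod D y)
      \<cdot>\<^bsub>D\<^esub> AMap F (AMap G y)"
    "\<lbrakk>X \<in> Obj C; Y \<in> Obj D; k \<in> hom D (OMap F X) Y\<rbrakk> \<Longrightarrow>
      \<exists>!h. h \<in> hom C X (OMap G Y) \<and> \<epsilon> Y \<cdot>\<^bsub>D\<^esub> AMap F h = k"
proof -
  show "is_functor C D F" "is_functor D C G" using assms by (simp_all add: right_adjoint_def)
  have n: "nat_trans D D (F \<odot> G) id_func \<epsilon>" using assms by (simp add: right_adjoint_def)
  show "Y \<in> Obj D \<Longrightarrow> \<epsilon> Y \<in> hom D (OMap F (OMap G Y)) Y" using n by (simp add: nat_trans_def)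
  show "y \<in> Arr D \<Longrightarrow> y \<cdot>\<^bsub>D\<^esub> \<epsilon> (Dom D y) = \<epsilon> (Cod D y)
    \<cdot>\<^bsub>D\<^esub> AMap F (AMap G y)"
    using n by (simp add: nat_trans_def)
  have "\<forall>X \<in> Obj C. \<forall>Y \<in> Obj D. \<forall>k \<in> hom D (OMap F X) Y.
        \<exists>!h. h \<in> hom C X (OMap G Y) \<and> \<epsilon> Y \<cdot>\<^bsub>D\<^esub> AMap F h = k"
    using assms unfolding right_adjoint_def by (elim conjE)
  then show "\<lbrakk>X \<in> Obj C; Y \<in> Obj D; k \<in> hom D (OMap F X) Y\<rbrakk> \<Longrightarrow>
      \<exists>!h. h \<in> hom C X (OMap G Y) \<and> \<epsilon> Y \<cdot>\<^bsub>D\<^esub> AMap F h = k" by (elim ballE) blast+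
qed

locale lccc_category = category C for C :: "('o, 'a) cat" (structure) +
  assumes lccc: "lccc C"

sublocale lccc_category \<subseteq> finite_limit_category
  by standard (use lccc in \<open>simp add: lccc_def\<close>)

context lccc_category
begin

lemma pushforward_adjoint:
  assumes "g \<in> Arr C"
  shows "right_adjoint (slice C (Cod C g)) (slice C (Dom C g)) (pullback_func C g)
    (pushforward_func C g) (pushforward_counit C g)"
proof -
  obtain G \<epsilon> where "right_adjoint (slice C (Cod C g)) (slice C (Dom C g)) (pullback_func C g) G \<epsilon>"
    using lccc assms by (auto simp: lccc_def)
  then have "case (G, \<epsilon>) of (G, \<epsilon>) \<Rightarrow> right_adjoint (slice C (Cod C g)) (slice C (Dom C g))
    (pullback_func C g) G \<epsilon>"
    by simp
  then have "case pushforward C g of (G, \<epsilon>) \<Rightarrow> right_adjoint (slice C (Cod C g)) (slice C (Dom C g))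
    (pullback_func C g) G \<epsilon>"
    unfolding pushforward_def by (rule someI)
  then show ?thesis by (simp add: pushforward_func_def pushforward_counit_def case_prod_beta)
qed

lemma pushforward_functor:
  "g \<in> Arr C \<Longrightarrow> cat_functor (slice C (Dom C g)) (slice C (Cod C g)) (pushforward_func C g)"
  using right_adjointD(2)[OF pushforward_adjoint] by (rule cat_functorI)

lemma counit_hom:
  assumes "g \<in> Arr C" "v \<in> Arr C" "Cod C v = Dom C g"
  shows "pushforward_counit C g v \<in> hom (slice C (Dom C g)) (pb1 C g (OMap (pushforward_func C g) v)) v"
proof -
  have "v \<in> Obj (slice C (Dom C g))" using assms by simp
  from right_adjointD(3)[OF pushforward_adjoint[OF assms(1)] this]
  show ?thesis by (simp only: pullback_func_def func.simps)
qed

lemmas counit_natural = right_adjointD(4)[OF pushforward_adjoint]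

lemma counit_universal:
  assumes "g \<in> Arr C" "v \<in> Arr C" "Cod C v = Dom C g" "b \<in> Obj (slice C (Cod C g))"
    "k \<in> hom (slice C (Dom C g)) (OMap (pullback_func C g) b) v"
  shows "\<exists>!h. h \<in> hom (slice C (Cod C g)) b (OMap (pushforward_func C g) v) \<and>
       pushforward_counit C g v \<cdot>\<^bsub>slice C (Dom C g)\<^esub> AMap (pullback_func C g) h = k"
  using assms(2,3) by (intro right_adjointD(5)[OF pushforward_adjoint[OF assms(1)] assms(4) _ assms(5)]) simp

lemma canonical_pf_sel:
  "gb (canonical_pf C g v) = OMap (pushforward_func C g) v"
  "gp (canonical_pf C g v) = pb1 C g (gb (canonical_pf C g v))"
  "gq (canonical_pf C g v) = pb2 C g (gb (canonical_pf C g v))"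
  by (simp_all add: canonical_pf_def Let_def)

lemma pushforward_counit_eq:
  assumes g: "g \<in> Arr C" and v: "v \<in> Arr C" "Cod C v = Dom C g"
  shows "gb (canonical_pf C g v) \<in> Arr C" "Cod C (gb (canonical_pf C g v)) = Cod C g"
    "pushforward_counit C g v = (pb1 C g (gb (canonical_pf C g v)), ge (canonical_pf C g v), v)"
    "pushforward_counit C g v \<in> Arr (slice C (Dom C g))"
proof -
  let ?S = "slice C (Cod C g)" and ?T = "slice C (Dom C g)"
  have "OMap (pushforward_func C g) v \<in> Obj ?S"
    using v by (intro cat_functor.obj_map[OF pushforward_functor[OF g]]) simp
  then show "gb (canonical_pf C g v) \<in> Arr C" "Cod C (gb (canonical_pf C g v)) = Cod C g"
    by (simp_all add: canonical_pf_sel)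
  have e: "pushforward_counit C g v \<in> hom ?T (pb1 C g (OMap (pushforward_func C g) v)) v"
    by (rule counit_hom[OF assms])
  then show "pushforward_counit C g v = (pb1 C g (gb (canonical_pf C g v)), ge (canonical_pf C g v), v)"
    by (cases "pushforward_counit C g v") (simp add: canonical_pf_def Let_def)
  show "pushforward_counit C g v \<in> Arr ?T" using e by simp
qed

lemma canonical_pf_gelem:
  assumes g: "g \<in> Arr C" and v: "v \<in> Arr C" "Cod C v = Dom C g"
  shows "gelem C g (Ident C (Dom C g)) v (canonical_pf C g v)"
proof (rule gelemI)
  note c = pushforward_counit_eq[OF assms]
  show P: "is_pullback C g (gb (canonical_pf C g v)) (gp (canonical_pf C g v)) (gq (canonical_pf C g v))"
    unfolding canonical_pf_sel(2,3) using pb[OF g c(1)] c(2) by simp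
  show "v \<cdot> ge (canonical_pf C g v) = Ident C (Dom C g) \<cdot> gp (canonical_pf C g v)"
    using c(3,4) pullbackD[OF P] by (simp add: canonical_pf_sel)
qed (use pushforward_counit_eq[OF assms] g v in \<open>simp_all add: canonical_pf_sel\<close>)

lemma canonical_pf_univ:
  assumes g: "g \<in> Arr C" and v: "v \<in> Arr C" "Cod C v = Dom C g"
  shows "univ C g (Ident C (Dom C g)) v (canonical_pf C g v)"
proof -
  have "\<forall>b \<in> Obj (slice C (Cod C g)). \<forall>k \<in> hom (slice C (Dom C g)) (OMap (pullback_func C g) b) v.
      \<exists>!h. h \<in> hom (slice C (Cod C g)) b (OMap (pushforward_func C g) v) \<and>
       pushforward_counit C g v \<cdot>\<^bsub>slice C (Dom C g)\<^esub> AMap (pullback_func C g) h = k"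
    using counit_universal[OF assms] by blast
  then show ?thesis
    unfolding univ_iff_universal_arrow[OF g v canonical_pf_gelem[OF assms] canonical_pf_sel(2,3)]
      pushforward_counit_eq(3)[OF assms] canonical_pf_sel(1) .
qed

text \<open>Transposing across the adjunction is naming: both are the unique arrow through which the
  given one factors over the counit.\<close>

lemma pushforward_transpose_eq:
  assumes g: "g \<in> Arr C" and v: "v \<in> Arr C" "Cod C v = Dom C g" and b: "b \<in> Arr C" "Cod C b = Cod C g"
    and k: "(pb1 C g b, k, v) \<in> Arr (slice C (Dom C g))"
  shows "pushforward_transpose C g b v (pb1 C g b, k, v) =
    (b, name C (canonical_pf C g v) (Gel b (pb1 C g b) (pb2 C g b) k), gb (canonical_pf C g v))"
    and "gelem C g (Ident C (Dom C g)) v (Gel b (pb1 C g b) (pb2 C g b) k)"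
proof -
  let ?z = "Gel b (pb1 C g b) (pb2 C g b) k" and ?y = "canonical_pf C g v"
  let ?S = "slice C (Cod C g)" and ?T = "slice C (Dom C g)"
  show z: "gelem C g (Ident C (Dom C g)) v ?z"
  proof (rule gelemI)
    show "is_pullback C g (gb ?z) (gp ?z) (gq ?z)" using pb[OF g b(1)] b(2) by simp
  qed (use k g v in simp_all)
  note y = canonical_pf_univ[OF g v]
  note ye = univ_gelem[OF y]
  obtain n where "gmor C ?z ?y (name C ?y ?z) n" using univ_name[OF y z] .
  then have "\<exists>n. gmor C ?z ?y (name C ?y ?z) n" by blast
  then have m: "name C ?y ?z \<in> hom C (Dom C b) (Dom C (gb ?y)) \<and> gb ?y \<cdot> name C ?y ?z = b \<and>
    ge ?y \<cdot> pb_pair C g (gb ?y) (pb1 C g b) (name C ?y ?z \<cdot> pb2 C g b) = k"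
    using canonical_gmor[OF ye canonical_pf_sel(2,3) z] by simp
  have bS: "b \<in> Obj ?S" using b by simp
  have kT: "(pb1 C g b, k, v) \<in> hom ?T (OMap (pullback_func C g) b) v"
    using k by (simp add: pullback_func_def)
  let ?h = "(b, name C ?y ?z, gb ?y)"
  have "\<exists>!h. h \<in> hom ?S b (OMap (pushforward_func C g) v) \<and>
       pushforward_counit C g v \<cdot>\<^bsub>?T\<^esub> AMap (pullback_func C g) h = (pb1 C g b, k, v)"
    by (rule counit_universal[OF g v bS kT])
  moreover have "?h \<in> hom ?S b (OMap (pushforward_func C g) v) \<and>
       pushforward_counit C g v \<cdot>\<^bsub>?T\<^esub> AMap (pullback_func C g) ?h = (pb1 C g b, k, v)"
    using m b gelemD[OF ye] unfolding pushforward_counit_eq(3)[OF g v]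
    by (simp add: canonical_pf_sel pullback_func_def)
  ultimately show "pushforward_transpose C g b v (pb1 C g b, k, v) = ?h"
    unfolding pushforward_transpose_def by (rule the1_equality)
qed

text \<open>Naturality of the counit says precisely that the image arrow satisfies the property
  defining the name of the pushed element.\<close>

lemma pushforward_func_arr:
  assumes g: "g \<in> Arr C" and k: "(v, k, v') \<in> Arr (slice C (Dom C g))"
  shows "AMap (pushforward_func C g) (v, k, v') =
    (gb (canonical_pf C g v), name C (canonical_pf C g v') (push C k (canonical_pf C g v)), gb (canonical_pf C g v'))"
proof -
  let ?S = "slice C (Cod C g)" and ?T = "slice C (Dom C g)"
  let ?y = "canonical_pf C g v" and ?y' = "canonical_pf C g v'"
  interpret P: cat_functor ?T ?S "pushforward_func C g" by (rule pushforward_functor[OF g])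
  have v: "v \<in> Arr C" "Cod C v = Dom C g" and v': "v' \<in> Arr C" "Cod C v' = Dom C g"
    using k by simp_all
  have "AMap (pushforward_func C g) (v, k, v') \<in> hom ?S (gb ?y) (gb ?y')"
    using P.arr_map[OF k] P.dom_map[OF k] P.cod_map[OF k] by (simp add: canonical_pf_sel del: P.arr_map P.dom_map P.cod_map)
  then obtain m where m: "AMap (pushforward_func C g) (v, k, v') = (gb ?y, m, gb ?y')" and mS: "(gb ?y, m, gb ?y') \<in> Arr ?S"
    by (cases "AMap (pushforward_func C g) (v, k, v')") simp
  from counit_natural[OF g k] have e: "ge ?y' \<cdot> pb_pair C g (gb ?y') (pb1 C g (gb ?y)) (m \<cdot> pb2 C g (gb ?y)) = k
    \<cdot> ge ?y"
    by (simp add: m pullback_func_def pushforward_counit_eq(3)[OF g v] pushforward_counit_eq(3)[OF g v'])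
  note ye = canonical_pf_gelem[OF g v] and ye' = canonical_pf_gelem[OF g v']
  have z: "gelem C g (Ident C (Dom C g)) v' (push C k ?y)"
    using ye k by (intro gelem_push) simp_all
  have "\<exists>n. gmor C (push C k ?y) ?y' m n"
    using canonical_gmor[OF ye' canonical_pf_sel(2,3) z] e mS by (simp add: canonical_pf_sel)
  then have "name C ?y' (push C k ?y) = m"
    using name_eq[OF canonical_pf_univ[OF g v'] z] by blast
  then show ?thesis by (simp add: m)
qed

lemma canonical_univ:
  assumes "g \<in> Arr C" "h \<in> Arr C" "Dom C g = Dom C h" "u \<in> Arr C" "Cod C u = Cod C h"
  shows "univ C g h u (canonical C g h u)"
  unfolding canonical_def
proof (rule univ_push_pullback)
  show P: "is_pullback C h u (pb1 C h u) (pb2 C h u)" using assms by (intro pb) simp_all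
  show "univ C g (Ident C (Dom C g)) (pb1 C h u) (canonical_pf C g (pb1 C h u))"
    using pullbackD[OF P] assms by (intro canonical_pf_univ) simp_all
qed

end

locale polynomial = lccc_category +
  fixes f g h
  assumes poly: "f \<in> Arr C" "g \<in> Arr C" "h \<in> Arr C" "Dom C g = Dom C h" "Cod C g = Dom C f" "Cod C f = Cod C h"
begin

lemma canonical_univ': "u \<in> Arr C \<Longrightarrow> Cod C u = Cod C f \<Longrightarrow> univ C g h u (canonical C g h u)"
  using poly by (intro canonical_univ) simp_all

lemma poly_func_obj: "OMap (poly_func C f g h) u = f \<cdot> gb (canonical C g h u)"
  by (simp add: poly_func_def postcomp_func_def pullback_func_def canonical_def canonical_pf_sel)

text \<open>Pushing along \<open>n\<close> and then along \<open>pb2 C h v\<close> is pushing along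
  \<open>pb2 C h u\<close> and then along \<open>k\<close>. Hence the polynomial functor acts on
  elements by mere composition with \<open>k\<close>, which is why \<open>op_hom\<close> expresses
  the condition on algebra morphisms.\<close>

lemma poly_func_arr:
  assumes k: "(u, k, v) \<in> Arr (slice C (Cod C f))"
  shows "AMap (poly_func C f g h) (u, k, v) = (f \<cdot> gb (canonical C g h u),
    name C (canonical C g h v) (push C k (canonical C g h u)), f \<cdot> gb (canonical C g h v))"
proof -
  have k': "(u, k, v) \<in> Arr (slice C (Cod C h))" using k poly by simp
  define n where "n = pb_pair C h v (pb1 C h u) (k \<cdot> pb2 C h u)"
  note n = pullback_func_arr[OF poly(3) k', folded n_def]
  have Pu: "is_pullback C h u (pb1 C h u) (pb2 C h u)" and Pv: "is_pullback C h v (pb1 C h v) (pb2 C h v)"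
    using k' poly by (auto intro!: pb)
  note uD = pullbackD[OF Pu] and vD = pullbackD[OF Pv]
  have nT: "(pb1 C h u, n, pb1 C h v) \<in> Arr (slice C (Dom C g))"
    using n uD vD poly by simp
  let ?y = "canonical_pf C g (pb1 C h u)" and ?z = "canonical_pf C g (pb1 C h v)"
  have y: "univ C g (Ident C (Dom C g)) (pb1 C h u) ?y" and z: "univ C g (Ident C (Dom C g)) (pb1 C h v) ?z"
    using canonical_pf_univ[OF poly(2), of "pb1 C h u"] canonical_pf_univ[OF poly(2), of "pb1 C h v"] uD vD poly
    by simp_all
  note ye = univ_gelem[OF y] and ze = univ_gelem[OF z]
  have nye: "gelem C g (Ident C (Dom C g)) (pb1 C h v) (push C n ?y)"
    using ye n vD by (intro gelem_push) simp_all
  obtain j where "gmor C (push C n ?y) ?z (name C ?z (push C n ?y)) j" using univ_name[OF z nye] .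
  from gmor_push[OF nye ze _ _ this, of "pb2 C h v"]
  have j: "gmor C (push C (pb2 C h v) (push C n ?y)) (canonical C g h v) (name C ?z (push C n ?y)) j"
    using vD by (simp add: canonical_def)
  have "push C (pb2 C h v) (push C n ?y) = push C (pb2 C h v \<cdot> n) ?y"
    using ye n vD by (intro push_push) simp_all
  also have "\<dots> = push C k (canonical C g h u)"
    unfolding canonical_def n(5) using ye uD k by (intro push_push[symmetric]) simp_all
  finally have "gmor C (push C k (canonical C g h u)) (canonical C g h v) (name C ?z (push C n ?y)) j"
    using j by simp
  moreover have "gelem C g h v (push C k (canonical C g h u))"
    using univ_gelem[OF canonical_univ'] k by (intro gelem_push[of _ _ u]) simp_all
  ultimately have "name C (canonical C g h v) (push C k (canonical C g h u)) = name C ?z (push C n ?y)"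
    using canonical_univ'[of v] k by (intro name_eq) simp_all
  then show ?thesis
    using pushforward_func_arr[OF poly(2) nT]
    by (simp add: poly_func_def postcomp_func_def pullback_func_def canonical_def flip: n_def)
qed

abbreviation "algs \<equiv> Alg (slice C (Cod C f)) (poly_func C f g h)"

lemma algs_objE:
  assumes "X \<in> Obj algs"
  obtains u s where "X = (u, (f \<cdot> gb (canonical C g h u), s, u))" "u \<in> Arr C" "Cod C u = Cod C f"
    "s \<in> Arr C" "Dom C s = Dom C (gb (canonical C g h u))" "Cod C s = Dom C u" "u \<cdot> s = f \<cdot> gb (canonical C g h u)"
    "op_alg C f g h u (\<lambda>x. s \<cdot> name C (canonical C g h u) x)"
proof -
  obtain u a s b where X: "X = (u, (a, s, b))" by (metis prod.exhaust)
  have u: "u \<in> Arr C" "Cod C u = Cod C f" using assms X by simp_all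
  note y = canonical_univ'[OF u]
  note yD = gelemD[OF univ_gelem[OF y]]
  have s: "a = f \<cdot> gb (canonical C g h u)" "b = u" "s \<in> Arr C" "Dom C s = Dom C (gb (canonical C g h u))" "Cod C s = Dom
    C u"
     "u \<cdot> s = f \<cdot> gb (canonical C g h u)"
    using assms X yD poly by (auto simp: poly_func_obj)
  show ?thesis
    using that[of u s] X u s op_alg_of[OF y _ _ _ s(3-6)] poly by simp
qed

lemma algs_obj_of:
  assumes \<sigma>: "op_alg C f g h u \<sigma>"
  shows "(u, (f \<cdot> gb (canonical C g h u), \<sigma> (canonical C g h u), u)) \<in> Obj algs"
proof -
  note u = op_algD(1,2)[OF \<sigma>]
  note ye = univ_gelem[OF canonical_univ'[OF u]]
  show ?thesis
    using u op_algD(3-6)[OF \<sigma> ye] gelemD[OF ye] poly by (simp add: poly_func_obj)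
qed

text \<open>At the universal element the operation returns the structure map, so the square in
  \<open>Alg\<close> is the homomorphism condition there; \<open>op_hom_univ\<close> spreads it to
  all elements.\<close>

lemma algs_hom_iff:
  assumes X: "(u, (f \<cdot> gb (canonical C g h u), s, u)) \<in> Obj algs" and Y: "(v, (f \<cdot> gb (canonical C g h v), t, v))
    \<in> Obj algs"
  shows "x \<in> hom algs (u, (f \<cdot> gb (canonical C g h u), s, u)) (v, (f \<cdot> gb (canonical C g h v), t, v))
    \<longleftrightarrow>
    (\<exists>k. x = ((u, (f \<cdot> gb (canonical C g h u), s, u)), (u, k, v), (v, (f \<cdot> gb (canonical C g h v), t, v)))
      \<and>
      op_hom C g h u (\<lambda>x. s \<cdot> name C (canonical C g h u) x) v (\<lambda>x. t \<cdot> name C (canonical C g h v) x) k)"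
    (is "x \<in> hom algs ?X ?Y \<longleftrightarrow> (\<exists>k. x = (?X, (u, k, v), ?Y) \<and> op_hom C g h u ?\<sigma> v
      ?\<tau> k)")
proof -
  let ?y = "canonical C g h u" and ?z = "canonical C g h v"
  obtain "u \<in> Arr C" "Cod C u = Cod C f" and s: "s \<in> Arr C" "Dom C s = Dom C (gb ?y)" and \<sigma>: "op_alg C f g h u
    ?\<sigma>"
    using algs_objE[OF X] by auto
  then have u: "u \<in> Arr C" "Cod C u = Cod C f" by simp_all
  obtain "v \<in> Arr C" "Cod C v = Cod C f" and \<tau>: "op_alg C f g h v ?\<tau>" using algs_objE[OF Y] by auto
  then have v: "v \<in> Arr C" "Cod C v = Cod C f" by simp_all
  note y = canonical_univ'[OF u] and z = canonical_univ'[OF v]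
  have \<sigma>y: "?\<sigma> ?y = s" using s by (simp add: name_self[OF y])
  have P: "(u, k, v) \<cdot>\<^bsub>slice C (Cod C f)\<^esub> (f \<cdot> gb ?y, s, u) = (f \<cdot> gb ?z, t, v)
    \<cdot>\<^bsub>slice C (Cod C f)\<^esub> AMap (poly_func C f g h) (u, k, v)
     \<longleftrightarrow> k \<cdot> ?\<sigma> ?y = ?\<tau> (push C k ?y)" if "(u, k, v) \<in> Arr (slice C (Cod C f))" for k
    unfolding \<sigma>y poly_func_arr[OF that] by simp
  have arr: "(u, k, v) \<in> Arr (slice C (Cod C f)) \<longleftrightarrow> k \<in> hom C (Dom C u) (Dom C v) \<and> v \<cdot> k =
    u" for k
    using u v by auto
  show ?thesis
  proof
    assume x: "x \<in> hom algs ?X ?Y"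
    obtain x1 k0 x3 where x': "x = (x1, k0, x3)" by (cases x)
    with x have x13: "x1 = ?X" "x3 = ?Y" by simp_all
    have k0: "k0 \<in> hom (slice C (Cod C f)) u v" "k0 \<cdot>\<^bsub>slice C (Cod C f)\<^esub> (f \<cdot> gb ?y, s, u) =
        (f \<cdot> gb ?z, t, v) \<cdot>\<^bsub>slice C (Cod C f)\<^esub> AMap (poly_func C f g h) k0"
      using x unfolding x' x13 by (simp_all only: in_hom Alg_simps)
    obtain k where k: "k0 = (u, k, v)" using k0(1) by (cases k0) simp
    have kA: "(u, k, v) \<in> Arr (slice C (Cod C f))" using k0(1) k by simp
    have "op_hom C g h u ?\<sigma> v ?\<tau> k"
      using kA arr P[OF kA] k0(2) k by (intro op_hom_univ[OF \<sigma> \<tau> y]) simp_all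
    then show "\<exists>k. x = (?X, (u, k, v), ?Y) \<and> op_hom C g h u ?\<sigma> v ?\<tau> k" using x' x13 k by blast
  next
    assume "\<exists>k. x = (?X, (u, k, v), ?Y) \<and> op_hom C g h u ?\<sigma> v ?\<tau> k"
    then obtain k where x: "x = (?X, (u, k, v), ?Y)" and k: "op_hom C g h u ?\<sigma> v ?\<tau> k" by blast
    have kA: "(u, k, v) \<in> Arr (slice C (Cod C f))" using u v op_homD(1-4)[OF k] by simp
    note eq = P[OF kA, THEN iffD2, OF op_homD(5)[OF k univ_gelem[OF y]]]
    show "x \<in> hom algs ?X ?Y"
      using X Y kA eq unfolding x in_hom Alg_simps
      by (simp only: in_hom slice_simps(3,4) poly_func_obj simp_thms)
  qed
qed

lemma ex1_hom:
  assumes X: "(u, (f \<cdot> gb (canonical C g h u), s, u)) \<in> Obj algs" and Y: "(v, (f \<cdot> gb (canonical C g h v), t, v))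
    \<in> Obj algs"
  shows "(\<exists>!x. x \<in> hom algs (u, (f \<cdot> gb (canonical C g h u), s, u)) (v, (f \<cdot> gb (canonical C g h v), t,
    v))) \<longleftrightarrow>
    (\<exists>!k. op_hom C g h u (\<lambda>x. s \<cdot> name C (canonical C g h u) x) v (\<lambda>x. t \<cdot> name C (canonical C
      g h v) x) k)"
  unfolding algs_hom_iff[OF X Y] by auto

lemma op_initial_if_initial:
  assumes "initial algs X"
  obtains u s where "X = (u, (f \<cdot> gb (canonical C g h u), s, u))" "X \<in> Obj algs"
    "op_initial C f g h u (\<lambda>x. s \<cdot> name C (canonical C g h u) x)"
proof -
  have XO: "X \<in> Obj algs" using assms by (simp add: initial_def)
  obtain u s where X: "X = (u, (f \<cdot> gb (canonical C g h u), s, u))" and \<sigma>: "op_alg C f g h u (\<lambda>x. s \<cdot>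
    name C (canonical C g h u) x)"
    using algs_objE[OF XO] by blast
  have "\<exists>!k. op_hom C g h u (\<lambda>x. s \<cdot> name C (canonical C g h u) x) v \<tau> k" if \<tau>: "op_alg C f g h v
    \<tau>" for v \<tau>
  proof -
    note v = op_algD(1,2)[OF \<tau>]
    \<comment> \<open>Taken as a structure map, the value at the universal element induces an
      operation that agrees with \<tau> on every element.\<close>
    let ?t = "\<tau> (canonical C g h v)"
    have "\<exists>!x. x \<in> hom algs X (v, (f \<cdot> gb (canonical C g h v), ?t, v))"
      using assms algs_obj_of[OF \<tau>] unfolding initial_def by blast
    then have "\<exists>!k. op_hom C g h u (\<lambda>x. s \<cdot> name C (canonical C g h u) x) v (\<lambda>x. ?t \<cdot> name C
      (canonical C g h v) x) k"
      unfolding X by (rule ex1_hom[OF XO[unfolded X] algs_obj_of[OF \<tau>], THEN iffD1])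
    then show ?thesis
      using op_hom_cong[OF v(1) refl op_alg_univ[OF \<tau> canonical_univ'[OF v]], of g h] by simp
  qed
  then have "op_initial C f g h u (\<lambda>x. s \<cdot> name C (canonical C g h u) x)"
    using \<sigma> by (simp add: op_initial_def)
  then show ?thesis by (rule that[OF X XO])
qed

lemma initial_if_op_initial:
  assumes "op_initial C f g h u \<sigma>"
  shows "initial algs (u, (f \<cdot> gb (canonical C g h u), \<sigma> (canonical C g h u), u))"
  unfolding initial_def
proof (intro conjI ballI)
  have \<sigma>: "op_alg C f g h u \<sigma>" using assms by (simp add: op_initial_def)
  show XO: "(u, (f \<cdot> gb (canonical C g h u), \<sigma> (canonical C g h u), u)) \<in> Obj algs" by (rule algs_obj_of[OF
    \<sigma>])
  fix Y assume Y: "Y \<in> Obj algs"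
  obtain v t where Y': "Y = (v, (f \<cdot> gb (canonical C g h v), t, v))" and v: "v \<in> Arr C"
    and \<tau>: "op_alg C f g h v (\<lambda>x. t \<cdot> name C (canonical C g h v) x)"
    using algs_objE[OF Y] by blast
  have "\<exists>!k. op_hom C g h u \<sigma> v (\<lambda>x. t \<cdot> name C (canonical C g h v) x) k"
    using assms \<tau> by (simp add: op_initial_def)
  then have "\<exists>!k. op_hom C g h u (\<lambda>x. \<sigma> (canonical C g h u) \<cdot> name C (canonical C g h u) x) v
    (\<lambda>x. t \<cdot> name C (canonical C g h v) x) k"
    using op_hom_cong[OF v op_alg_univ[OF \<sigma> canonical_univ'[OF op_algD(1,2)[OF \<sigma>]]] refl, of g h] by simp
  then show "\<exists>!x. x \<in> hom algs (u, (f \<cdot> gb (canonical C g h u), \<sigma> (canonical C g h u), u)) Y"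
    unfolding Y' by (rule ex1_hom[OF XO Y[unfolded Y'], THEN iffD2])
qed

end

section \<open>Functors preserving universal elements\<close>

abbreviation (in cat_functor) map_el where "map_el \<equiv> map_gel (AMap F)"

text \<open>Preservation of this one square is a premise, so that the lemma serves the first
  projection before that is known to be an \<open>lcc_map\<close>.\<close>

lemma (in cat_functor) gelem_map:
  assumes x: "gelem C g h u x"
    and P: "is_pullback D (AMap F g) (AMap F (gb x)) (AMap F (gp x)) (AMap F (gq x))"
  shows "gelem D (AMap F g) (AMap F h) (AMap F u) (map_el x)"
proof (rule D.gelemI)
  note xD = C.gelemD[OF x]
  show "AMap F u \<cdot>\<^bsub>D\<^esub> ge (map_el x) = AMap F h \<cdot>\<^bsub>D\<^esub> gp (map_el x)"
    using map_square[OF xD(18)] xD(3-16) by simp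
qed (use P C.gelemD[OF x] in simp_all)

lemma (in cat_functor) gmor_map:
  assumes x: "gelem C g h u x" and y: "gelem C g h u y" and m: "gmor C x y m n"
  shows "gmor D (map_el x) (map_el y) (AMap F m) (AMap F n)"
proof -
  note xD = C.gelemD(2-16)[OF x] and yD = C.gelemD(2-16)[OF y]
  have mn: "m \<in> Arr C" "Dom C m = Dom C (gb x)" "Cod C m = Dom C (gb y)" "n \<in> Arr C" "Dom C n = Dom C (gp x)"
    "Cod C n = Dom C (gp y)" "gb y \<cdot>\<^bsub>C\<^esub> m = gb x" "gp y \<cdot>\<^bsub>C\<^esub> n = gp x" "gq y
      \<cdot>\<^bsub>C\<^esub> n = m \<cdot>\<^bsub>C\<^esub> gq x" "ge y \<cdot>\<^bsub>C\<^esub> n = ge x"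
    using m by (simp_all add: gmor_def)
  show ?thesis
    using map_triangle[OF mn(7)] map_triangle[OF mn(8)] map_square[OF mn(9)] map_triangle[OF mn(10)] mn(1-6) xD yD
    by (simp add: gmor_def)
qed

text \<open>Local cartesian closure of a functor in a form free of choices: all pullbacks and all
  universal elements are preserved. The invertibility of the comparisons and the formula for
  \<sigma> are derived from this.\<close>

locale lcc_map = C: lccc_category C + D: lccc_category D + cat_functor C D F
  for C :: "('o1, 'a1) cat" and D :: "('o2, 'a2) cat" and F +
  assumes preserves_pb: "is_pullback C f u p q \<Longrightarrow> is_pullback D (AMap F f) (AMap F u) (AMap F p) (AMap F q)"
    and preserves_univ: "univ C g h u y \<Longrightarrow> univ D (AMap F g) (AMap F h) (AMap F u) (map_el y)"
begin

lemma gelem_map': "gelem C g h u x \<Longrightarrow> gelem D (AMap F g) (AMap F h) (AMap F u) (map_el x)"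
  by (intro gelem_map preserves_pb C.gelemD(1))

lemma map_push:
  assumes "gelem C g h u x" "k \<in> Arr C" "Dom C k = Dom C u"
  shows "map_el (push C k x) = push D (AMap F k) (map_el x)"
  using C.gelemD[OF assms(1)] assms(2,3) by (simp add: push_def gel.expand)

lemma pullback_comparison:
  assumes f: "f \<in> Arr C" "u \<in> Arr C" "Cod C f = Cod C u"
  obtains c c' where
    "pullback_comparison C D F f u = (AMap F (pb1 C f u), c, pb1 D (AMap F f) (AMap F u))"
    "(AMap F (pb1 C f u), c, pb1 D (AMap F f) (AMap F u)) \<in> Arr (slice D (OMap F (Dom C f)))"
    "inv_arr (slice D (OMap F (Dom C f))) (pullback_comparison C D F f u) =
      (pb1 D (AMap F f) (AMap F u), c', AMap F (pb1 C f u))"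
    "pb2 D (AMap F f) (AMap F u) \<cdot>\<^bsub>D\<^esub> c = AMap F (pb2 C f u)"
    "inverse_arrows D c c'"
proof -
  let ?p = "pb1 C f u" and ?q = "pb2 C f u" and ?p' = "pb1 D (AMap F f) (AMap F u)" and ?q' = "pb2 D (AMap F f) (AMap F u)"
  have P: "is_pullback C f u ?p ?q" using f by (rule C.pb)
  note PD = C.pullbackD(4-8)[OF P]
  note FP = preserves_pb[OF P]
  have P': "is_pullback D (AMap F f) (AMap F u) ?p' ?q'" using f by (intro D.pb) simp_all
  note PD' = D.pullbackD(4-8)[OF P']
  let ?c = "pair D ?p' ?q' (AMap F ?p) (AMap F ?q)" and ?c' = "pair D (AMap F ?p) (AMap F ?q) ?p' ?q'"
  have c: "?c \<in> Arr D" "Dom D ?c = OMap F (Dom C ?p)" "Cod D ?c = Dom D ?p'" "?p' \<cdot>\<^bsub>D\<^esub> ?c = AMap F ?p" "?q'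
    \<cdot>\<^bsub>D\<^esub> ?c = AMap F ?q"
    using D.pair[OF P' _ _ _ _ _ D.pullbackD(9)[OF FP]] PD PD' f by simp_all
  have c': "?c' \<in> Arr D" "Dom D ?c' = Dom D ?p'" "Cod D ?c' = OMap F (Dom C ?p)" "AMap F ?p \<cdot>\<^bsub>D\<^esub> ?c' = ?p'"
    "AMap F ?q \<cdot>\<^bsub>D\<^esub> ?c' = ?q'"
    using D.pair[OF FP _ _ _ _ _ D.pullbackD(9)[OF P']] PD PD' f by simp_all
  have 1: "?c \<cdot>\<^bsub>D\<^esub> ?c' = Ident D (Dom D ?p')"
    by (rule D.pullback_eqI[OF P']) (use c c' PD' PD D.reassoc1[OF c(4), of ?c'] D.reassoc1[OF c(5), of ?c'] in simp_all)
  have 2: "?c' \<cdot>\<^bsub>D\<^esub> ?c = Ident D (OMap F (Dom C ?p))"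
    by (rule D.pullback_eqI[OF FP]) (use c c' PD' PD D.reassoc1[OF c'(4), of ?c] D.reassoc1[OF c'(5), of ?c] in simp_all)
  have inv: "inverse_arrows D ?c ?c'"
    using c c' 1 2 by (simp add: inverse_arrows_def)
  have A: "(AMap F ?p, ?c, ?p') \<in> Arr (slice D (OMap F (Dom C f)))"
    using c PD PD' f by simp
  have "pullback_comparison C D F f u = (AMap F ?p, ?c, ?p')"
    by (simp add: pullback_comparison_def D.pb_pair_eq)
  then show ?thesis
    using that[of ?c ?c'] A inv c(5)
      category.inv_arr_eq[OF D.category_slice D.slice_inverse[OF A inv]] by simp
qed

text \<open>The arrow being transposed is the image of the counit moved to the chosen pullback in
  \<open>D\<close>. The move \<open>c\<close> covers the identity of the base, so its name is that
  of the image of the canonical element.\<close>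

lemma pushforward_comparison:
  assumes g: "g \<in> Arr C" and v: "v \<in> Arr C" "Cod C v = Dom C g"
  shows "pushforward_comparison C D F g v = (AMap F (gb (canonical_pf C g v)),
    name D (canonical_pf D (AMap F g) (AMap F v)) (map_el (canonical_pf C g v)),
    gb (canonical_pf D (AMap F g) (AMap F v)))"
proof -
  let ?y = "canonical_pf C g v" and ?y' = "canonical_pf D (AMap F g) (AMap F v)" and ?S = "slice D (OMap F (Dom C g))"
  let ?w = "gb ?y"
  note y = C.canonical_pf_univ[OF g v]
  note ye = univ_gelem[OF y]
  note yD = C.gelemD[OF ye]
  have w: "OMap (pushforward_func C g) v = ?w" by (simp add: C.canonical_pf_sel)
  have wc: "Cod C g = Cod C ?w" using yD by simp
  let ?p' = "pb1 D (AMap F g) (AMap F ?w)" and ?q' = "pb2 D (AMap F g) (AMap F ?w)"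
  obtain c c' where c: "pullback_comparison C D F g ?w = (AMap F (pb1 C g ?w), c, ?p')"
    "(AMap F (pb1 C g ?w), c, ?p') \<in> Arr ?S"
    "inv_arr ?S (pullback_comparison C D F g ?w) = (?p', c', AMap F (pb1 C g ?w))"
    "?q' \<cdot>\<^bsub>D\<^esub> c = AMap F (pb2 C g ?w)" "inverse_arrows D c c'"
    using pullback_comparison[OF g yD(2) wc] .
  have P': "is_pullback D (AMap F g) (AMap F ?w) ?p' ?q'" using g yD(2) wc by (intro D.pb) simp_all
  note PD' = D.pullbackD(4-8)[OF P']
  have yp: "gp ?y = pb1 C g ?w" "gq ?y = pb2 C g ?w" by (rule C.canonical_pf_sel)+
  have cD: "c \<in> Arr D" "Dom D c = OMap F (Dom C (gp ?y))" "Cod D c = Dom D ?p'" "?p' \<cdot>\<^bsub>D\<^esub> c = AMap F (gp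
    ?y)"
    "c' \<in> Arr D" "Dom D c' = Dom D ?p'" "Cod D c' = OMap F (Dom C (gp ?y))"
    "c \<cdot>\<^bsub>D\<^esub> c' = Ident D (Dom D ?p')" "c' \<cdot>\<^bsub>D\<^esub> c = Ident D (OMap F (Dom C (gp ?y)))"
    using c(2,5) yD(3) unfolding yp inverse_arrows_def by simp_all
  let ?k = "AMap F (ge ?y) \<cdot>\<^bsub>D\<^esub> c'"
  have comp: "AMap (slice_func F) (pushforward_counit C g v) \<cdot>\<^bsub>?S\<^esub> inv_arr ?S (pullback_comparison C D F g ?w)
    = (?p', ?k, AMap F v)"
    unfolding c(3) C.pushforward_counit_eq(3)[OF g v] by (simp add: slice_func_def)
  have ve: "v \<cdot>\<^bsub>C\<^esub> ge ?y = gp ?y" using yD by simp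
  have "AMap F v \<cdot>\<^bsub>D\<^esub> ?k = AMap F (gp ?y) \<cdot>\<^bsub>D\<^esub> c'"
    by (rule D.reassoc1[OF map_triangle[OF ve]]) (use yD v cD in simp_all)
  also have "\<dots> = ?p'"
    using D.reassoc1[OF cD(4), of c'] cD PD' by simp
  finally have k: "(?p', ?k, AMap F v) \<in> Arr (slice D (Dom D (AMap F g)))"
    using g v yD cD PD' by simp
  have FO: "AMap F g \<in> Arr D" "AMap F v \<in> Arr D" "Cod D (AMap F v) = Dom D (AMap F g)"
    "AMap F ?w \<in> Arr D" "Cod D (AMap F ?w) = Cod D (AMap F g)"
    using g v yD by simp_all
  note t = D.pushforward_transpose_eq[OF FO k]
  let ?z = "Gel (AMap F ?w) ?p' ?q' ?k"
  have Fy: "gelem D (AMap F g) (Ident D (Dom D (AMap F g))) (AMap F v) (map_el ?y)"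
    using gelem_map'[OF ye] g by simp
  have kc: "?k \<cdot>\<^bsub>D\<^esub> c = AMap F (ge ?y)"
    using yD cD by simp
  have zy: "gmor D (map_el ?y) ?z (Ident D (OMap F (Dom C ?w))) c"
    using yD cD PD' c(4) kc by (simp add: gmor_def yp)
  have "name D ?y' (map_el ?y) = name D ?y' ?z \<cdot>\<^bsub>D\<^esub> Ident D (OMap F (Dom C ?w))"
    by (rule D.name_gmor[OF D.canonical_pf_univ[OF FO(1-3)] Fy t(2) zy])
  also have "\<dots> = name D ?y' ?z"
    using D.name_hom[OF D.canonical_pf_univ[OF FO(1-3)] t(2)] yD by simp
  finally show ?thesis
    unfolding pushforward_comparison_def Let_def w comp t(1) by simp
qed

lemma preserves_pushforwards: "preserves_pushforwards C D F"
  unfolding preserves_pushforwards_def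
proof (intro ballI)
  fix g v assume g: "g \<in> Arr C" and "v \<in> Obj (slice C (Dom C g))"
  then have v: "v \<in> Arr C" "Cod C v = Dom C g" by simp_all
  let ?y = "canonical_pf C g v" and ?y' = "canonical_pf D (AMap F g) (AMap F v)"
  note y = C.canonical_pf_univ[OF g v]
  have Fy: "univ D (AMap F g) (Ident D (Dom D (AMap F g))) (AMap F v) (map_el ?y)"
    using preserves_univ[OF y] g by simp
  have y': "univ D (AMap F g) (Ident D (Dom D (AMap F g))) (AMap F v) ?y'"
    using g v by (intro D.canonical_pf_univ) simp_all
  have "pushforward_comparison C D F g v \<in> Arr (slice D (OMap F (Cod C g)))"
    unfolding pushforward_comparison[OF g v]
    using D.name_hom[OF y' univ_gelem[OF Fy]] C.gelemD[OF univ_gelem[OF y]] D.gelemD[OF univ_gelem[OF y']] g by simp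
  then show "is_iso (slice D (OMap F (Cod C g))) (pushforward_comparison C D F g v)"
    unfolding is_iso_def pushforward_comparison[OF g v]
    using D.slice_inverse D.univ_inverse[OF y' Fy] by blast
qed

text \<open>Both comparisons are names, and their composite carries the image of the canonical
  element of \<open>C\<close> to the canonical element of \<open>D\<close>. These elements are
  universal, so taking the inverse merely swaps the arguments of \<open>name\<close>.\<close>

lemma poly_iso:
  assumes poly: "polynomial C f g h" and u: "u \<in> Arr C" "Cod C u = Cod C f"
  shows "poly_iso C D F f g h u =
    (AMap F f \<cdot>\<^bsub>D\<^esub> gb (canonical D (AMap F g) (AMap F h) (AMap F u)),
     name D (map_el (canonical C g h u)) (canonical D (AMap F g) (AMap F h) (AMap F u)),
     AMap F f \<cdot>\<^bsub>D\<^esub> AMap F (gb (canonical C g h u)))"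
proof -
  interpret P: polynomial C f g h by (rule poly)
  note [simp] = P.poly
  let ?y = "canonical C g h u" and ?y' = "canonical D (AMap F g) (AMap F h) (AMap F u)"
  let ?v = "pb1 C h u" and ?v' = "pb1 D (AMap F h) (AMap F u)"
  have P: "is_pullback C h u ?v (pb2 C h u)" using u by (intro C.pb) simp_all
  have P': "is_pullback D (AMap F h) (AMap F u) ?v' (pb2 D (AMap F h) (AMap F u))" using u by (intro D.pb) simp_all
  note vD = C.pullbackD(4-8)[OF P] and vD' = D.pullbackD(4-8)[OF P']
  have hu: "Cod C h = Cod C u" using u by simp
  obtain c c' where c: "pullback_comparison C D F h u = (AMap F ?v, c, ?v')"
    "(AMap F ?v, c, ?v') \<in> Arr (slice D (OMap F (Dom C h)))"
    "pb2 D (AMap F h) (AMap F u) \<cdot>\<^bsub>D\<^esub> c = AMap F (pb2 C h u)"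
    using pullback_comparison[OF P.poly(3) u(1) hu] .
  let ?z = "canonical_pf C g ?v" and ?z1 = "canonical_pf D (AMap F g) (AMap F ?v)" and ?z2 = "canonical_pf D (AMap F g) ?v'"
  have vg: "Cod C ?v = Dom C g" using vD by simp
  have cg: "(AMap F ?v, c, ?v') \<in> Arr (slice D (Dom D (AMap F g)))" using c(2) by simp
  have cD: "c \<in> Arr D" "Dom D c = OMap F (Dom C ?v)" "Cod D c = Dom D ?v'" "?v' \<cdot>\<^bsub>D\<^esub> c = AMap F ?v"
    using cg vD by simp_all
  have z: "univ C g (Ident C (Dom C g)) ?v ?z" using vD by (intro C.canonical_pf_univ) simp_all
  have z1: "univ D (AMap F g) (Ident D (Dom D (AMap F g))) (AMap F ?v) ?z1"
    using vD by (intro D.canonical_pf_univ) simp_all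
  have z2: "univ D (AMap F g) (Ident D (Dom D (AMap F g))) ?v' ?z2"
    using vD' by (intro D.canonical_pf_univ) simp_all
  have Fz: "gelem D (AMap F g) (Ident D (Dom D (AMap F g))) (AMap F ?v) (map_el ?z)"
    using gelem_map'[OF univ_gelem[OF z]] by simp
  have cz1: "gelem D (AMap F g) (Ident D (Dom D (AMap F g))) ?v' (push D c ?z1)"
    using cD vD vD' univ_gelem[OF z1] by (intro D.gelem_push[of _ _ "AMap F ?v"]) simp_all
  have cFz: "gelem D (AMap F g) (Ident D (Dom D (AMap F g))) ?v' (push D c (map_el ?z))"
    using cD vD vD' Fz by (intro D.gelem_push[of _ _ "AMap F ?v"]) simp_all
  obtain n1 where n1: "gmor D (map_el ?z) ?z1 (name D ?z1 (map_el ?z)) n1"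
    using D.univ_name[OF z1 Fz] .
  obtain n2 where n2: "gmor D (push D c ?z1) ?z2 (name D ?z2 (push D c ?z1)) n2"
    using D.univ_name[OF z2 cz1] .
  let ?m = "name D ?z2 (push D c ?z1) \<cdot>\<^bsub>D\<^esub> name D ?z1 (map_el ?z)"
  have "gmor D (push D c (map_el ?z)) (push D c ?z1) (name D ?z1 (map_el ?z)) n1"
    using cD vD by (intro D.gmor_push[OF Fz univ_gelem[OF z1] _ _ n1]) simp_all
  from D.gmor_comp[OF cFz cz1 univ_gelem[OF z2] this n2]
  have "gmor D (push D c (map_el ?z)) ?z2 ?m (n2 \<cdot>\<^bsub>D\<^esub> n1)" .
  from D.gmor_push[OF cFz univ_gelem[OF z2] _ _ this, of "pb2 D (AMap F h) (AMap F u)"]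
  have "gmor D (push D (pb2 D (AMap F h) (AMap F u)) (push D c (map_el ?z))) ?y' ?m (n2 \<cdot>\<^bsub>D\<^esub> n1)"
    using vD' by (simp add: canonical_def)
  moreover have "push D (pb2 D (AMap F h) (AMap F u)) (push D c (map_el ?z)) =
      push D (AMap F (pb2 C h u)) (map_el ?z)"
    using D.push_push[OF Fz cD(1), of "pb2 D (AMap F h) (AMap F u)"] cD vD vD' c(3) by simp
  moreover have "\<dots> = map_el ?y"
    unfolding canonical_def using map_push[OF univ_gelem[OF z]] vD by simp
  ultimately have gm: "gmor D (map_el ?y) ?y' ?m (n2 \<cdot>\<^bsub>D\<^esub> n1)" by simp
  have y: "univ C g h u ?y" using P.canonical_univ'[OF u] .
  have y': "univ D (AMap F g) (AMap F h) (AMap F u) ?y'" using u by (intro D.canonical_univ) simp_all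
  note Fy = preserves_univ[OF y]
  have m: "name D ?y' (map_el ?y) = ?m"
    by (rule D.name_eq[OF y' univ_gelem[OF Fy] gm])
  have comp: "AMap (pushforward_func D (AMap F g)) (pullback_comparison C D F h u) \<cdot>\<^bsub>slice D (OMap F (Cod C g))\<^esub>
      pushforward_comparison C D F g (OMap (pullback_func C h) u) = (AMap F (gb ?z), ?m, gb ?z2)"
    using D.pushforward_func_arr[OF _ cg] pushforward_comparison[OF P.poly(2) vD(1) vg]
    by (simp add: c(1) pullback_func_def)
  have gz: "gb ?z = gb ?y" "gb ?z2 = gb ?y'" by (simp_all add: canonical_def)
  note yD = C.gelemD[OF univ_gelem[OF y]] and yD' = D.gelemD[OF univ_gelem[OF y']]
  have A: "(AMap F f \<cdot>\<^bsub>D\<^esub> AMap F (gb ?y), name D ?y' (map_el ?y), AMap F f \<cdot>\<^bsub>D\<^esub> gb ?y')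
    \<in> Arr (slice D (OMap F (Cod C f)))"
    using D.name_hom[OF y' univ_gelem[OF Fy]] yD(2,11) yD'(2,11) by simp
  have "poly_iso C D F f g h u = inv_arr (slice D (OMap F (Cod C f)))
      (AMap F f \<cdot>\<^bsub>D\<^esub> AMap F (gb ?y), name D ?y' (map_el ?y), AMap F f \<cdot>\<^bsub>D\<^esub> gb ?y')"
    unfolding poly_iso_def comp m gz by (simp add: postcomp_func_def)
  also have "\<dots> = (AMap F f \<cdot>\<^bsub>D\<^esub> gb ?y', name D (map_el ?y) ?y', AMap F f \<cdot>\<^bsub>D\<^esub> AMap F
    (gb ?y))"
    by (rule category.inv_arr_eq[OF D.category_slice D.slice_inverse[OF A D.univ_inverse[OF y' Fy]]])
  finally show ?thesis .
qed

text \<open>Once \<sigma> is a name, the structure map of the image algebra is the value at the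
  canonical element of \<open>D\<close> of the operation in the premise. That operation mentions
  only the image of the canonical element of \<open>C\<close>.\<close>

lemma alg_func_initial:
  assumes poly: "polynomial C f g h" and u: "u \<in> Arr C" "Cod C u = Cod C f"
    and s: "op_initial D (AMap F f) (AMap F g) (AMap F h) (AMap F u)
      (\<lambda>x. AMap F s \<cdot>\<^bsub>D\<^esub> name D (map_el (canonical C g h u)) x)"
  shows "initial (Alg (slice D (OMap F (Cod C f))) (poly_func D (AMap F f) (AMap F g) (AMap F h)))
    (OMap (alg_func C D F f g h) (u, (f \<cdot>\<^bsub>C\<^esub> gb (canonical C g h u), s, u)))"
proof -
  interpret P: polynomial C f g h by (rule poly)
  interpret P': polynomial D "AMap F f" "AMap F g" "AMap F h"
    by standard (simp_all add: P.poly)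
  have "OMap (alg_func C D F f g h) (u, (f \<cdot>\<^bsub>C\<^esub> gb (canonical C g h u), s, u)) =
    (AMap F u, (AMap F f \<cdot>\<^bsub>D\<^esub> gb (canonical D (AMap F g) (AMap F h) (AMap F u)),
      AMap F s \<cdot>\<^bsub>D\<^esub> name D (map_el (canonical C g h u)) (canonical D (AMap F g) (AMap F h) (AMap F u)), AMap F
        u))"
    unfolding alg_func_def Let_def by (simp add: slice_func_def poly_iso[OF poly u])
  then show ?thesis using P'.initial_if_op_initial[OF s] P.poly by simp
qed

end

section \<open>Limits in the comma category\<close>

definition comma_proj2 ::
  "('o1 \<times> 'o2 \<times> 'a2, ('o1 \<times> 'o2 \<times> 'a2) \<times> ('a1 \<times> 'a2) \<times> ('o1 \<times> 'o2 \<times>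
    'a2), 'o2, 'a2) func" where
  "comma_proj2 = \<lparr>OMap = (\<lambda>(X1, X2, x). X2), AMap = (\<lambda>(a, (k1, k2), b). k2)\<rparr>"

definition o1 :: "'o1 \<times> 'o2 \<times> 'a2 \<Rightarrow> 'o1" where
  "o1 X = fst X"

definition o2 :: "'o1 \<times> 'o2 \<times> 'a2 \<Rightarrow> 'o2" where
  "o2 X = fst (snd X)"

definition str :: "'o1 \<times> 'o2 \<times> 'a2 \<Rightarrow> 'a2" where
  "str X = snd (snd X)"

definition mk :: "'o1 \<times> 'o2 \<times> 'a2 \<Rightarrow> 'o1 \<times> 'o2 \<times> 'a2 \<Rightarrow> 'a1 \<Rightarrow> 'a2
  \<Rightarrow>
    ('o1 \<times> 'o2 \<times> 'a2) \<times> ('a1 \<times> 'a2) \<times> ('o1 \<times> 'o2 \<times> 'a2)" where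
  "mk X Y k1 k2 = (X, (k1, k2), Y)"

locale gluing = E1: lccc_category E1 + E2: lccc_category E2 + H: cat_functor E1 E2 H
  for E1 :: "('o1, 'a1) cat" and E2 :: "('o2, 'a2) cat" and H :: "('o1, 'a1, 'o2, 'a2) func" +
  assumes H_limits: "preserves_finite_limits E1 E2 H"
begin

abbreviation K where "K \<equiv> comma E1 E2 H"
abbreviation pr1 :: "('o1 \<times> 'o2 \<times> 'a2, ('o1 \<times> 'o2 \<times> 'a2) \<times> ('a1 \<times> 'a2) \<times> ('o1
  \<times> 'o2 \<times> 'a2), 'o1, 'a1) func" where "pr1 \<equiv> comma_proj1"
abbreviation pr2 :: "('o1 \<times> 'o2 \<times> 'a2, ('o1 \<times> 'o2 \<times> 'a2) \<times> ('a1 \<times> 'a2) \<times> ('o1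
  \<times> 'o2 \<times> 'a2), 'o2, 'a2) func" where "pr2 \<equiv> comma_proj2"
abbreviation a1 where "a1 f \<equiv> AMap pr1 f"
abbreviation a2 where "a2 f \<equiv> AMap pr2 f"
abbreviation Ho where "Ho X \<equiv> OMap H X"
abbreviation Ha where "Ha f \<equiv> AMap H f"
abbreviation el1 where "el1 \<equiv> map_gel (AMap pr1)"
abbreviation cmp1 (infixl "\<cdot>1" 70) where "f \<cdot>1 g \<equiv> f \<cdot>\<^bsub>E1\<^esub> g"
abbreviation cmp2 (infixl "\<cdot>2" 70) where "f \<cdot>2 g \<equiv> f \<cdot>\<^bsub>E2\<^esub> g"
abbreviation cmpK (infixl "\<cdot>K" 70) where "f \<cdot>K g \<equiv> f \<cdot>\<^bsub>K\<^esub> g"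

lemma proj_obj [simp]: "OMap comma_proj1 X = o1 X" "OMap comma_proj2 X = o2 X"
  by (cases X; simp add: comma_proj1_def comma_proj2_def o1_def o2_def)+

lemma triple_sel [simp]: "o1 (X1, X2, x) = X1" "o2 (X1, X2, x) = X2" "str (X1, X2, x) = x"
  by (simp_all add: o1_def o2_def str_def)

lemma triple_eta: "(o1 X, o2 X, str X) = X"
  by (cases X) simp

lemma comma_obj_iff: "X \<in> Obj K \<longleftrightarrow> o1 X \<in> Obj E1 \<and> o2 X \<in> Obj E2 \<and> str X \<in> Arr E2
  \<and> Dom E2 (str X) = o2 X \<and>
    Cod E2 (str X) = Ho (o1 X)"
  by (cases X) (simp add: comma_def comma_obj_def)

lemma comma_objD [simp]:
  assumes "X \<in> Obj K"
  shows "o1 X \<in> Obj E1" "o2 X \<in> Obj E2" "str X \<in> Arr E2" "Dom E2 (str X) = o2 X" "Cod E2 (str X) = Ho (o1 X)"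
  using assms by (simp_all add: comma_obj_iff)

lemma mk_simps [simp]:
  "mk X Y k1 k2 \<in> Arr K \<longleftrightarrow> X \<in> Obj K \<and> Y \<in> Obj K \<and> k1 \<in> Arr E1 \<and> Dom E1 k1 = o1 X
    \<and> Cod E1 k1 = o1 Y \<and>
    k2 \<in> Arr E2 \<and> Dom E2 k2 = o2 X \<and> Cod E2 k2 = o2 Y \<and> str Y \<cdot>2 k2 = Ha k1 \<cdot>2 str X"
  "Dom K (mk X Y k1 k2) = X" "Cod K (mk X Y k1 k2) = Y" "a1 (mk X Y k1 k2) = k1" "a2 (mk X Y k1 k2) = k2"
  "mk Y' Z l1 l2 \<cdot>K mk X Y k1 k2 = mk X Z (l1 \<cdot>1 k1) (l2 \<cdot>2 k2)"
  by (cases X; cases Y; auto simp: mk_def comma_def comma_obj_def comma_proj1_def comma_proj2_def str_def o1_def o2_def)+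

lemma Ident_comma: "Ident K X = mk X X (Ident E1 (o1 X)) (Ident E2 (o2 X))"
  by (cases X) (simp add: mk_def comma_def)

lemma mk_eta: "mk (Dom K f) (Cod K f) (a1 f) (a2 f) = f"
  by (cases f) (simp add: mk_def comma_def comma_proj1_def comma_proj2_def split: prod.split)

lemma comma_arrD:
  assumes "f \<in> Arr K"
  shows "Dom K f \<in> Obj K" "Cod K f \<in> Obj K" "a1 f \<in> Arr E1" "Dom E1 (a1 f) = o1 (Dom K f)" "Cod E1 (a1 f) = o1 (Cod K
    f)"
    "a2 f \<in> Arr E2" "Dom E2 (a2 f) = o2 (Dom K f)" "Cod E2 (a2 f) = o2 (Cod K f)"
    "str (Cod K f) \<cdot>2 a2 f = Ha (a1 f) \<cdot>2 str (Dom K f)"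
proof -
  obtain X Y k1 k2 where f: "f = mk X Y k1 k2" using mk_eta by metis
  show "Dom K f \<in> Obj K" "Cod K f \<in> Obj K" "a1 f \<in> Arr E1" "Dom E1 (a1 f) = o1 (Dom K f)" "Cod E1 (a1 f) = o1 (Cod K f)"
    "a2 f \<in> Arr E2" "Dom E2 (a2 f) = o2 (Dom K f)" "Cod E2 (a2 f) = o2 (Cod K f)"
    "str (Cod K f) \<cdot>2 a2 f = Ha (a1 f) \<cdot>2 str (Dom K f)"
    using assms by (simp_all add: f)
qed

lemma comma_eqI: "\<lbrakk>Dom K f = Dom K g; Cod K f = Cod K g; a1 f = a1 g; a2 f = a2 g\<rbrakk> \<Longrightarrow> f = g"
  by (metis mk_eta)

lemma category_comma: "category K"
proof
  fix X assume "X \<in> Obj K" then show "Ident K X \<in> hom K X X" by (simp add: Ident_comma)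
next
  fix f g X Y Z assume f: "f \<in> hom K X Y" and g: "g \<in> hom K Y Z"
  obtain k1 k2 where k: "f = mk X Y k1 k2" using mk_eta[of f] f by (metis in_hom)
  obtain l1 l2 where l: "g = mk Y Z l1 l2" using mk_eta[of g] g by (metis in_hom)
  have a: "str Y \<cdot>2 k2 = Ha k1 \<cdot>2 str X" and b: "str Z \<cdot>2 l2 = Ha l1 \<cdot>2 str Y" using f g k l by simp_all
  have "str Z \<cdot>2 (l2 \<cdot>2 k2) = Ha l1 \<cdot>2 (str Y \<cdot>2 k2)"
    by (rule E2.reassoc[OF b]) (use f g k l in simp_all)
  then show "g \<cdot>K f \<in> hom K X Z" using f g k l a by simp
next
  fix f X Y assume f: "f \<in> hom K X Y"
  obtain k1 k2 where k: "f = mk X Y k1 k2" using mk_eta[of f] f by (metis in_hom)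
  show "f \<cdot>K Ident K X = f" "Ident K Y \<cdot>K f = f" using f by (simp_all add: k Ident_comma)
next
  fix f g h W X Y Z assume f: "f \<in> hom K W X" and g: "g \<in> hom K X Y" and h: "h \<in> hom K Y Z"
  obtain k1 k2 where k: "f = mk W X k1 k2" using mk_eta[of f] f by (metis in_hom)
  obtain l1 l2 where l: "g = mk X Y l1 l2" using mk_eta[of g] g by (metis in_hom)
  obtain m1 m2 where m: "h = mk Y Z m1 m2" using mk_eta[of h] h by (metis in_hom)
  show "h \<cdot>K (g \<cdot>K f) = h \<cdot>K g \<cdot>K f" using f g h by (simp add: k l m)
qed (simp_all add: comma_arrD)

sublocale K: category K by (rule category_comma)

lemma proj_functors: "is_functor K E1 comma_proj1" "is_functor K E2 comma_proj2"
proof -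
  have c: "a1 (g \<cdot>K f) = a1 g \<cdot>1 a1 f \<and> a2 (g \<cdot>K f) = a2 g \<cdot>2 a2 f" for f g
    by (metis mk_eta mk_simps(4-6))
  show "is_functor K E1 comma_proj1" "is_functor K E2 comma_proj2"
    by (rule is_functorI; simp add: comma_arrD Ident_comma c category_comma E1.category_axioms E2.category_axioms)+
qed

sublocale p1: cat_functor K E1 comma_proj1 by (rule cat_functorI[OF proj_functors(1)])
sublocale p2: cat_functor K E2 comma_proj2 by (rule cat_functorI[OF proj_functors(2)])

lemma H_pullback: "is_pullback E1 f u p q \<Longrightarrow> is_pullback E2 (Ha f) (Ha u) (Ha p) (Ha q)"
  by (rule preserves_pullbacks[OF H.is_functor H_limits])

text \<open>Since \<open>H\<close> preserves the limit \<open>L1\<close>, the structure maps of the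
  diagram induce an arrow \<open>x\<close> from \<open>L2\<close> to \<open>Ho L1\<close>, and the
  triple is the limit. Both component cones are recorded for the preservation statements.\<close>

lemma pointwise_limit:
  assumes J: "finite_shape J" and D: "is_functor J K D"
  shows "\<exists>L \<pi>. limit_cone J K D L \<pi> \<and> limit_cone J E1 (comma_proj1 \<odot> D) (o1 L) (\<lambda>j. a1 (\<pi>
    j)) \<and>
    limit_cone J E2 (comma_proj2 \<odot> D) (o2 L) (\<lambda>j. a2 (\<pi> j))"
proof -
  interpret D: cat_functor J K D using D by (rule cat_functorI)
  have D1: "is_functor J E1 (comma_proj1 \<odot> D)" and D2: "is_functor J E2 (comma_proj2 \<odot> D)"
    using D proj_functors by (auto intro: is_functor_comp)
  have HD1: "is_functor J E2 (H \<odot> (comma_proj1 \<odot> D))" using D1 H.is_functor by (rule is_functor_comp)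
  obtain L1 \<pi>1 where L1: "limit_cone J E1 (comma_proj1 \<odot> D) L1 \<pi>1"
    using E1.finite_limits J D1 unfolding has_finite_limits_def by blast
  obtain L2 \<pi>2 where L2: "limit_cone J E2 (comma_proj2 \<odot> D) L2 \<pi>2"
    using E2.finite_limits J D2 unfolding has_finite_limits_def by blast
  have HL1: "limit_cone J E2 (H \<odot> (comma_proj1 \<odot> D)) (Ho L1) (\<lambda>j. Ha (\<pi>1 j))"
    using H_limits J D1 L1 unfolding preserves_finite_limits_def by blast
  have c1: "cone J E1 (comma_proj1 \<odot> D) L1 \<pi>1" using L1 by (simp add: limit_cone_def)
  have c2: "cone J E2 (comma_proj2 \<odot> D) L2 \<pi>2" using L2 by (simp add: limit_cone_def)
  have LO: "L1 \<in> Obj E1" "L2 \<in> Obj E2" using c1 c2 by (simp_all add: cone_def)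
  have p: "\<pi>1 j \<in> Arr E1" "Dom E1 (\<pi>1 j) = L1" "Cod E1 (\<pi>1 j) = o1 (OMap D j)"
    "\<pi>2 j \<in> Arr E2" "Dom E2 (\<pi>2 j) = L2" "Cod E2 (\<pi>2 j) = o2 (OMap D j)" if "j \<in> Obj J" for j
    using c1 c2 that by (auto simp: cone_def)
  have n: "a1 (AMap D b) \<cdot>1 \<pi>1 (Dom J b) = \<pi>1 (Cod J b)" "a2 (AMap D b) \<cdot>2 \<pi>2 (Dom J b) = \<pi>2 (Cod J b)"
    if "b \<in> Arr J" for b
    using c1 c2 that by (auto simp: cone_def)
  have "cone J E2 (H \<odot> (comma_proj1 \<odot> D)) L2 (\<lambda>j. str (OMap D j) \<cdot>2 \<pi>2 j)"
    unfolding cone_def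
  proof (intro conjI ballI)
    fix b assume b: "b \<in> Arr J"
    have DO: "OMap D (Dom J b) \<in> Obj K" "OMap D (Cod J b) \<in> Obj K" using b by simp_all
    have "str (OMap D (Cod J b)) \<cdot>2 a2 (AMap D b) = Ha (a1 (AMap D b)) \<cdot>2 str (OMap D (Dom J b))"
      using comma_arrD(9)[of "AMap D b"] b by simp
    from E2.reassoc[OF this, of "\<pi>2 (Dom J b)"]
    have "str (OMap D (Cod J b)) \<cdot>2 (a2 (AMap D b) \<cdot>2 \<pi>2 (Dom J b)) = Ha (a1 (AMap D b)) \<cdot>2 (str (OMap D (Dom
      J b)) \<cdot>2 \<pi>2 (Dom J b))"
      using b DO p[of "Dom J b"] by simp
    then show "AMap (H \<odot> (comma_proj1 \<odot> D)) b \<cdot>2 (str (OMap D (Dom J b)) \<cdot>2 \<pi>2 (Dom J b)) = str (OMap D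
      (Cod J b)) \<cdot>2 \<pi>2 (Cod J b)"
      using n(2)[OF b] by simp
  qed (use LO p in simp_all)
  from E2.limit_factor[OF HL1 this] obtain x where x: "x \<in> hom E2 L2 (Ho L1)"
    "\<And>j. j \<in> Obj J \<Longrightarrow> Ha (\<pi>1 j) \<cdot>2 x = str (OMap D j) \<cdot>2 \<pi>2 j" by blast
  let ?L = "(L1, L2, x)" and ?\<pi> = "\<lambda>j. mk (L1, L2, x) (OMap D j) (\<pi>1 j) (\<pi>2 j)"
  have L: "?L \<in> Obj K" using x(1) LO by (simp add: comma_obj_iff)
  have \<pi>K: "?\<pi> j \<in> Arr K" if "j \<in> Obj J" for j using L p[OF that] x(2)[OF that] that by simp
  have "limit_cone J K D ?L ?\<pi>"
  proof (rule K.limit_coneI)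
    show "cone J K D ?L ?\<pi>"
      unfolding cone_def
    proof (intro conjI ballI)
      fix b assume b: "b \<in> Arr J"
      show "AMap D b \<cdot>K ?\<pi> (Dom J b) = ?\<pi> (Cod J b)"
        by (rule comma_eqI) (use b \<pi>K n[OF b] in \<open>simp_all del: mk_simps(1)\<close>)
    qed (use L \<pi>K in \<open>simp_all del: mk_simps(1)\<close>)
  next
    fix X \<rho> assume \<rho>: "cone J K D X \<rho>"
    have \<rho>j: "\<rho> j \<in> Arr K" "Dom K (\<rho> j) = X" "Cod K (\<rho> j) = OMap D j" if "j \<in> Obj J" for j
      using \<rho> that by (auto simp: cone_def)
    have X: "X \<in> Obj K" using \<rho> by (simp add: cone_def)
    have \<rho>n: "AMap D b \<cdot>K \<rho> (Dom J b) = \<rho> (Cod J b)" if "b \<in> Arr J" for b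
      using \<rho> that by (simp add: cone_def)
    have "cone J E1 (comma_proj1 \<odot> D) (o1 X) (\<lambda>j. a1 (\<rho> j))"
      unfolding cone_def
    proof (intro conjI ballI)
      fix b assume b: "b \<in> Arr J"
      show "AMap (comma_proj1 \<odot> D) b \<cdot>1 a1 (\<rho> (Dom J b)) = a1 (\<rho> (Cod J b))"
        using p1.map_triangle[OF \<rho>n[OF b]] b \<rho>j by simp
    qed (use X \<rho>j in simp_all)
    from E1.limit_factor[OF L1 this] obtain m1 where m1: "m1 \<in> hom E1 (o1 X) L1" "\<And>j. j \<in> Obj J \<Longrightarrow>
      \<pi>1 j \<cdot>1 m1 = a1 (\<rho> j)"
      by blast
    have "cone J E2 (comma_proj2 \<odot> D) (o2 X) (\<lambda>j. a2 (\<rho> j))"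
      unfolding cone_def
    proof (intro conjI ballI)
      fix b assume b: "b \<in> Arr J"
      show "AMap (comma_proj2 \<odot> D) b \<cdot>2 a2 (\<rho> (Dom J b)) = a2 (\<rho> (Cod J b))"
        using p2.map_triangle[OF \<rho>n[OF b]] b \<rho>j by simp
    qed (use X \<rho>j in simp_all)
    from E2.limit_factor[OF L2 this] obtain m2 where m2: "m2 \<in> hom E2 (o2 X) L2" "\<And>j. j \<in> Obj J \<Longrightarrow>
      \<pi>2 j \<cdot>2 m2 = a2 (\<rho> j)"
      by blast
    \<comment> \<open>The square that makes \<open>(m1, m2)\<close> an arrow is checked on the
      projections of the limit \<open>Ho L1\<close>.\<close>
    have "x \<cdot>2 m2 = Ha m1 \<cdot>2 str X"
    proof (rule E2.limit_eqI[OF HL1 HD1])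
      show "x \<cdot>2 m2 \<in> hom E2 (o2 X) (Ho L1)" "Ha m1 \<cdot>2 str X \<in> hom E2 (o2 X) (Ho L1)" using x m1 m2 X by
        simp_all
      fix j assume j: "j \<in> Obj J"
      have Dj: "OMap D j \<in> Obj K" using j by simp
      have "Ha (\<pi>1 j) \<cdot>2 (x \<cdot>2 m2) = str (OMap D j) \<cdot>2 (\<pi>2 j \<cdot>2 m2)"
        by (rule E2.reassoc[OF x(2)[OF j]]) (use p[OF j] Dj x(1) m2(1) in simp_all)
      also have "\<dots> = Ha (a1 (\<rho> j)) \<cdot>2 str X"
        using comma_arrD(9)[OF \<rho>j(1)[OF j]] \<rho>j[OF j] m2(2)[OF j] by simp
      also have "\<dots> = Ha (\<pi>1 j) \<cdot>2 (Ha m1 \<cdot>2 str X)"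
        by (rule E2.reassoc1[symmetric, OF H.map_triangle[OF m1(2)[OF j]]]) (use p[OF j] m1(1) X in simp_all)
      finally show "Ha (\<pi>1 j) \<cdot>2 (x \<cdot>2 m2) = Ha (\<pi>1 j) \<cdot>2 (Ha m1 \<cdot>2 str X)" .
    qed
    then have mK: "mk X ?L m1 m2 \<in> hom K X ?L" using X L m1(1) m2(1) by simp
    moreover have "?\<pi> j \<cdot>K mk X ?L m1 m2 = \<rho> j" if "j \<in> Obj J" for j
      by (rule comma_eqI) (use \<rho>j[OF that] m1(2)[OF that] m2(2)[OF that] in simp_all)
    ultimately show "\<exists>m. m \<in> hom K X ?L \<and> (\<forall>j\<in>Obj J. ?\<pi> j \<cdot>K m = \<rho> j)" by blast
  next
    fix X m m' assume m: "m \<in> hom K X ?L" "m' \<in> hom K X ?L"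
      and e: "\<And>j. j \<in> Obj J \<Longrightarrow> ?\<pi> j \<cdot>K m = ?\<pi> j \<cdot>K m'"
    have e1: "\<pi>1 j \<cdot>1 a1 m = \<pi>1 j \<cdot>1 a1 m'" and e2: "\<pi>2 j \<cdot>2 a2 m = \<pi>2 j \<cdot>2 a2 m'" if "j
      \<in> Obj J" for j
      using p1.map_square[OF e[OF that]] p2.map_square[OF e[OF that]] \<pi>K[OF that] m
      by (simp_all del: mk_simps(1))
    have "a1 m = a1 m'"
      by (rule E1.limit_eqI[OF L1 D1, of _ "o1 X"]) (use m e1 in simp_all)
    moreover have "a2 m = a2 m'"
      by (rule E2.limit_eqI[OF L2 D2, of _ "o2 X"]) (use m e2 in simp_all)
    ultimately show "m = m'" using m by (intro comma_eqI) simp_all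
  qed
  then show ?thesis using L1 L2 by (intro exI[of _ ?L] exI[of _ ?\<pi>]) simp
qed

lemma finite_limits_comma: "has_finite_limits K"
  unfolding has_finite_limits_def using pointwise_limit by blast

sublocale K: finite_limit_category K by standard (rule finite_limits_comma)

lemma proj_limits: "preserves_finite_limits K E1 comma_proj1" "preserves_finite_limits K E2 comma_proj2"
  unfolding preserves_finite_limits_def
proof (safe)
  fix J :: "(nat, nat) cat" and D and L :: "'o1 \<times> 'o2 \<times> 'a2" and \<pi> assume J: "finite_shape J" and D: "is_functor
    J K D" and L: "limit_cone J K D L \<pi>"
  obtain L' \<pi>' where L': "limit_cone J K D L' \<pi>'" "limit_cone J E1 (comma_proj1 \<odot> D) (o1 L') (\<lambda>j. a1 (\<pi>'
    j))"
    "limit_cone J E2 (comma_proj2 \<odot> D) (o2 L') (\<lambda>j. a2 (\<pi>' j))"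
    using pointwise_limit[OF J D] by blast
  show "limit_cone J E1 (comma_proj1 \<odot> D) (OMap pr1 L) (\<lambda>j. a1 (\<pi> j))" unfolding proj_obj by (rule
    p1.limit_cone_transfer[unfolded proj_obj, OF D L L'(1,2)])
  show "limit_cone J E2 (comma_proj2 \<odot> D) (OMap pr2 L) (\<lambda>j. a2 (\<pi> j))" unfolding proj_obj by (rule
    p2.limit_cone_transfer[unfolded proj_obj, OF D L L'(1,3)])
qed

lemma p1_pullback: "is_pullback K f u p q \<Longrightarrow> is_pullback E1 (a1 f) (a1 u) (a1 p) (a1 q)"
  and p2_pullback: "is_pullback K f u p q \<Longrightarrow> is_pullback E2 (a2 f) (a2 u) (a2 p) (a2 q)"
  using preserves_pullbacks[OF proj_functors(1) proj_limits(1)] preserves_pullbacks[OF proj_functors(2) proj_limits(2)]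
  by blast+

text \<open>The mediating arrows of the components form an arrow of the comma category because the
  required square ends in the image of the first pullback under \<open>H\<close>, which is again a
  pullback.\<close>

lemma comma_pullbackI:
  assumes fu: "f \<in> Arr K" "u \<in> Arr K" "p \<in> Arr K" "q \<in> Arr K" "Cod K f = Cod K u" "Dom K q = Dom K p"
      "Cod K p = Dom K f" "Cod K q = Dom K u"
    and P1: "is_pullback E1 (a1 f) (a1 u) (a1 p) (a1 q)" and P2: "is_pullback E2 (a2 f) (a2 u) (a2 p) (a2 q)"
  shows "is_pullback K f u p q"
proof (rule K.is_pullbackI)
  show "f \<cdot>K p = u \<cdot>K q"
    by (rule comma_eqI) (use fu E1.pullbackD(9)[OF P1] E2.pullbackD(9)[OF P2] in simp_all)
next
  fix a b assume ab: "a \<in> Arr K" "b \<in> Arr K" "Dom K b = Dom K a" "Cod K a = Dom K f" "Cod K b = Dom K u" "f \<cdot>K a = u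
    \<cdot>K b"
  let ?m1 = "pair E1 (a1 p) (a1 q) (a1 a) (a1 b)" and ?m2 = "pair E2 (a2 p) (a2 q) (a2 a) (a2 b)"
  have ab1: "a1 f \<cdot>1 a1 a = a1 u \<cdot>1 a1 b" and ab2: "a2 f \<cdot>2 a2 a = a2 u \<cdot>2 a2 b"
    using p1.map_square[OF ab(6)] p2.map_square[OF ab(6)] fu ab(1-5) by simp_all
  have m1: "?m1 \<in> Arr E1" "Dom E1 ?m1 = o1 (Dom K a)" "Cod E1 ?m1 = o1 (Dom K p)" "a1 p \<cdot>1 ?m1 = a1 a" "a1 q \<cdot>1 ?m1
    = a1 b"
    using E1.pair[OF P1 _ _ _ _ _ ab1] fu ab(1-5) by simp_all
  have m2: "?m2 \<in> Arr E2" "Dom E2 ?m2 = o2 (Dom K a)" "Cod E2 ?m2 = o2 (Dom K p)" "a2 p \<cdot>2 ?m2 = a2 a" "a2 q \<cdot>2 ?m2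
    = a2 b"
    using E2.pair[OF P2 _ _ _ _ _ ab2] fu ab(1-5) by simp_all
  have O: "Dom K p \<in> Obj K" "Dom K a \<in> Obj K" "Dom K f \<in> Obj K" "Dom K u \<in> Obj K" using fu ab(1,2) by simp_all
  \<comment> \<open>One projection at a time, used with \<open>p\<close>, \<open>a\<close> and with
    \<open>q\<close>, \<open>b\<close> for \<open>c\<close>, \<open>d\<close>.\<close>
  have leg: "Ha (a1 c) \<cdot>2 (str (Dom K p) \<cdot>2 ?m2) = Ha (a1 c) \<cdot>2 (Ha ?m1 \<cdot>2 str (Dom K a))"
    if c: "c \<in> Arr K" "Dom K c = Dom K p" and d: "d \<in> Arr K" "Dom K d = Dom K a" "Cod K d = Cod K c"
      and cd: "a1 c \<cdot>1 ?m1 = a1 d" "a2 c \<cdot>2 ?m2 = a2 d" for c d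
  proof -
    have CO: "Cod K c \<in> Obj K" using c by simp
    have "Ha (a1 c) \<cdot>2 (str (Dom K p) \<cdot>2 ?m2) = str (Cod K c) \<cdot>2 (a2 c \<cdot>2 ?m2)"
      by (rule E2.reassoc[OF comma_arrD(9)[OF c(1), symmetric, unfolded c(2)]]) (use c m2(1-3) O CO in simp_all)
    also have "\<dots> = Ha (a1 d) \<cdot>2 str (Dom K a)"
      using comma_arrD(9)[OF d(1)] d cd(2) by simp
    also have "\<dots> = Ha (a1 c) \<cdot>2 (Ha ?m1 \<cdot>2 str (Dom K a))"
      by (rule E2.reassoc1[symmetric, OF H.map_triangle[OF cd(1)]]) (use c m1(1-3) O in simp_all)
    finally show ?thesis .
  qed
  have "str (Dom K p) \<cdot>2 ?m2 = Ha ?m1 \<cdot>2 str (Dom K a)"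
    by (rule E2.pullback_eqI[OF H_pullback[OF P1]])
      (use leg[of p a] leg[of q b] fu ab(1-5) m1 m2 O in simp_all)
  then have mK: "mk (Dom K a) (Dom K p) ?m1 ?m2 \<in> Arr K" using m1 m2 O by simp
  show "\<exists>m. m \<in> Arr K \<and> Dom K m = Dom K a \<and> Cod K m = Dom K p \<and> p \<cdot>K m = a \<and> q \<cdot>K m = b"
  proof (intro exI conjI)
    show "p \<cdot>K mk (Dom K a) (Dom K p) ?m1 ?m2 = a"
      by (rule comma_eqI) (use mK fu ab(1-5) m1 m2 in \<open>simp_all del: mk_simps(1)\<close>)
    show "q \<cdot>K mk (Dom K a) (Dom K p) ?m1 ?m2 = b"
      by (rule comma_eqI) (use mK fu ab(1-5) m1 m2 in \<open>simp_all del: mk_simps(1)\<close>)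
  qed (use mK in \<open>simp_all del: mk_simps(1)\<close>)
next
  fix m m' assume m: "m \<in> Arr K" "m' \<in> Arr K" "Dom K m' = Dom K m" "Cod K m = Dom K p" "Cod K m' = Dom K p"
    and e: "p \<cdot>K m = p \<cdot>K m'" "q \<cdot>K m = q \<cdot>K m'"
  have "a1 p \<cdot>1 a1 m = a1 p \<cdot>1 a1 m'" "a1 q \<cdot>1 a1 m = a1 q \<cdot>1 a1 m'"
    by (rule p1.map_square[OF e(1)] p1.map_square[OF e(2)]; use m fu in simp)+
  then have "a1 m = a1 m'"
    using m fu E1.pullback_eqI[OF P1, of "a1 m" "a1 m'"] by simp
  moreover have "a2 p \<cdot>2 a2 m = a2 p \<cdot>2 a2 m'" "a2 q \<cdot>2 a2 m = a2 q \<cdot>2 a2 m'"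
    by (rule p2.map_square[OF e(1)] p2.map_square[OF e(2)]; use m fu in simp)+
  then have "a2 m = a2 m'"
    using m fu E2.pullback_eqI[OF P2, of "a2 m" "a2 m'"] by simp
  ultimately show "m = m'" using m by (intro comma_eqI) simp_all
qed (use fu in simp_all)

end

section \<open>Universal elements in the comma category\<close>

text \<open>
  Let \<open>g : A \<rightarrow> B\<close> and \<open>h : A \<rightarrow> I\<close> in the comma category, \<open>u1 : X\<^sub>1 \<rightarrow> I\<^sub>1\<close> in \<open>E1\<close>, and let \<open>y1\<close> represent
  \<open>\<Pi> = (g\<^sub>1)\<^sub>* (h\<^sub>1)\<^sup>* u1\<close>.  Then \<open>(b1, b2)\<close> projects from \<open>B' = H \<Pi> \<times> B\<^sub>2\<close> (over \<open>H B\<^sub>1\<close>), \<open>(pA, g')\<close> from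
  \<open>A' = A\<^sub>2 \<times> B'\<close> (over \<open>B\<^sub>2\<close>), and \<open>(j1, j2)\<close> from \<open>J = H X\<^sub>1 \<times> I\<^sub>2\<close> (over \<open>H I\<^sub>1\<close>).  The arrow \<open>h' : A' \<rightarrow> J\<close>
  evaluates an element of \<open>H \<Pi>\<close> at an element of \<open>A\<^sub>2\<close>.  Objects over \<open>I\<close> with first component \<open>u1\<close> are
  the arrows \<open>w\<close> into \<open>J\<close>, via \<open>tot\<close>, and \<open>up\<close> and \<open>down\<close> compare the generalized elements for
  \<open>(g', h', w)\<close> in \<open>E2\<close> with those for \<open>(g, h, tot w)\<close> in the comma category.
\<close>

locale comma_step = gluing E1 E2 H
  for E1 :: "('o1, 'a1) cat" and E2 :: "('o2, 'a2) cat" and H :: "('o1, 'a1, 'o2, 'a2) func" +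
  fixes g h :: "('o1 \<times> 'o2 \<times> 'a2) \<times> ('a1 \<times> 'a2) \<times> ('o1 \<times> 'o2 \<times> 'a2)" and u1 :: 'a1
    and y1 :: "'a1 gel"
    and b1 b2 pA g' r j1 j2 h' :: 'a2
  assumes gh: "g \<in> Arr K" "h \<in> Arr K" "Dom K h = Dom K g"
    and y1: "univ E1 (a1 g) (a1 h) u1 y1"
    and PB: "is_pullback E2 (Ha (gb y1)) (str (Cod K g)) b1 b2"
    and PA: "is_pullback E2 (a2 g) b2 pA g'"
    and r: "r \<in> Arr E2" "Dom E2 r = Dom E2 pA" "Cod E2 r = Ho (Dom E1 (gp y1))"
      "Ha (gp y1) \<cdot>2 r = str (Dom K g) \<cdot>2 pA" "Ha (gq y1) \<cdot>2 r = b1 \<cdot>2 g'"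
    and PJ: "is_pullback E2 (Ha u1) (str (Cod K h)) j1 j2"
    and h': "h' \<in> Arr E2" "Dom E2 h' = Dom E2 pA" "Cod E2 h' = Dom E2 j1"
      "j1 \<cdot>2 h' = Ha (ge y1) \<cdot>2 r" "j2 \<cdot>2 h' = a2 h \<cdot>2 pA"
begin

lemmas y1e = univ_gelem[OF y1]
lemmas y1D = E1.gelemD[OF y1e]

lemma u1_props [simp]: "u1 \<in> Arr E1" "Cod E1 u1 = o1 (Cod K h)"
  using y1D gh by simp_all

lemma y1_props [simp]:
  "gb y1 \<in> Arr E1" "gp y1 \<in> Arr E1" "gq y1 \<in> Arr E1" "ge y1 \<in> Arr E1"
  "Cod E1 (gb y1) = o1 (Cod K g)" "Dom E1 (gq y1) = Dom E1 (gp y1)" "Dom E1 (ge y1) = Dom E1 (gp y1)"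
  "Cod E1 (gp y1) = o1 (Dom K g)" "Cod E1 (gq y1) = Dom E1 (gb y1)" "Cod E1 (ge y1) = Dom E1 u1"
  using y1D gh by simp_all

lemma gh_obj [simp]: "Dom K g \<in> Obj K" "Cod K g \<in> Obj K" "Cod K h \<in> Obj K"
  using gh by simp_all

lemma arrows [simp]:
  "b1 \<in> Arr E2" "b2 \<in> Arr E2" "Dom E2 b2 = Dom E2 b1" "Cod E2 b1 = Ho (Dom E1 (gb y1))" "Cod E2 b2 = o2 (Cod K g)"
  "pA \<in> Arr E2" "g' \<in> Arr E2" "Dom E2 g' = Dom E2 pA" "Cod E2 g' = Dom E2 b1" "Cod E2 pA = o2 (Dom K g)"
  "j1 \<in> Arr E2" "j2 \<in> Arr E2" "Dom E2 j2 = Dom E2 j1" "Cod E2 j1 = Ho (Dom E1 u1)" "Cod E2 j2 = o2 (Cod K h)"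
  using E2.pullbackD[OF PB] E2.pullbackD[OF PA] E2.pullbackD[OF PJ] gh by simp_all

declare r(1-3) [simp] h'(1-3) [simp] gh [simp]

definition tot_obj where "tot_obj w = (Dom E1 u1, Dom E2 w, j1 \<cdot>2 w)"

definition tot where "tot w = mk (tot_obj w) (Cod K h) u1 (j2 \<cdot>2 w)"

definition gob where "gob z = (Dom E1 (gb y1), Dom E2 (gb z), b1 \<cdot>2 gb z)"

text \<open>\<open>r\<close> maps \<open>A'\<close> to the image under \<open>H\<close> of the
  domain of \<open>gp y1\<close>, which is the pullback of \<open>a1 g\<close> along
  \<open>gb y1\<close>. It supplies the structure map over the carrier of a generalized
  element.\<close>

definition qob where "qob z = (Dom E1 (gp y1), Dom E2 (gp z), r \<cdot>2 gp z)"

definition up where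
  "up w z = Gel (mk (gob z) (Cod K g) (gb y1) (b2 \<cdot>2 gb z)) (mk (qob z) (Dom K g) (gp y1) (pA \<cdot>2 gp z))
     (mk (qob z) (gob z) (gq y1) (gq z)) (mk (qob z) (tot_obj w) (ge y1) (ge z))"

definition base_map where "base_map x = name E1 y1 (el1 x)"

text \<open>The base goes to \<open>B'\<close> with coordinates in \<open>H \<Pi>\<close> and
  \<open>B\<^sub>2\<close>; the former is the structure map followed by \<open>H\<close> of
  \<open>base_map x\<close>, the arrow classifying the first component of \<open>x\<close>.\<close>

definition down where
  "down x = (let b = pair E2 b1 b2 (Ha (base_map x) \<cdot>2 str (Dom K (gb x))) (a2 (gb x)) in
     Gel b (pair E2 pA g' (a2 (gp x)) (b \<cdot>2 a2 (gq x))) (a2 (gq x)) (a2 (ge x)))"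

lemma tot_obj_sel [simp]: "o1 (tot_obj w) = Dom E1 u1" "o2 (tot_obj w) = Dom E2 w" "str (tot_obj w) = j1 \<cdot>2 w"
  by (simp_all add: tot_obj_def)

lemma gob_sel [simp]: "o1 (gob z) = Dom E1 (gb y1)" "o2 (gob z) = Dom E2 (gb z)" "str (gob z) = b1 \<cdot>2 gb z"
  by (simp_all add: gob_def)

lemma qob_sel [simp]: "o1 (qob z) = Dom E1 (gp y1)" "o2 (qob z) = Dom E2 (gp z)" "str (qob z) = r \<cdot>2 gp z"
  by (simp_all add: qob_def)

lemma tot_sel [simp]: "Dom K (tot w) = tot_obj w" "Cod K (tot w) = Cod K h" "a1 (tot w) = u1" "a2 (tot w) = j2 \<cdot>2 w"
  by (simp_all add: tot_def)

lemma tot_obj [simp]: "w \<in> Arr E2 \<Longrightarrow> Cod E2 w = Dom E2 j1 \<Longrightarrow> tot_obj w \<in> Obj K"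
  by (simp add: comma_obj_iff)

lemma tot_arr [simp]:
  assumes w: "w \<in> Arr E2" "Cod E2 w = Dom E2 j1" shows "tot w \<in> Arr K"
proof -
  have "str (Cod K h) \<cdot>2 (j2 \<cdot>2 w) = Ha u1 \<cdot>2 (j1 \<cdot>2 w)"
    by (rule E2.reassoc[OF E2.pullbackD(9)[OF PJ, symmetric]]) (use w in simp_all)
  then show ?thesis using w by (simp add: tot_def)
qed

lemma up_sel [simp]:
  "gb (up w z) = mk (gob z) (Cod K g) (gb y1) (b2 \<cdot>2 gb z)"
  "gp (up w z) = mk (qob z) (Dom K g) (gp y1) (pA \<cdot>2 gp z)"
  "gq (up w z) = mk (qob z) (gob z) (gq y1) (gq z)"
  "ge (up w z) = mk (qob z) (tot_obj w) (ge y1) (ge z)"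
  by (simp_all add: up_def)

lemma map_gel_up: "el1 (up w z) = y1"
  by (rule gel.expand) simp

section \<open>From generalized elements in \<open>E2\<close> to the comma category\<close>

context
  fixes w z
  assumes z: "gelem E2 g' h' w z"
begin

lemma fibre_props [simp]:
  "w \<in> Arr E2" "Cod E2 w = Dom E2 j1"
  "gb z \<in> Arr E2" "gp z \<in> Arr E2" "gq z \<in> Arr E2" "ge z \<in> Arr E2"
  "Cod E2 (gb z) = Dom E2 b1" "Dom E2 (gq z) = Dom E2 (gp z)" "Dom E2 (ge z) = Dom E2 (gp z)"
  "Cod E2 (gp z) = Dom E2 pA" "Cod E2 (gq z) = Dom E2 (gb z)" "Cod E2 (ge z) = Dom E2 w"
  using E2.gelemD[OF z] by simp_all

lemma up_obj [simp]: "gob z \<in> Obj K" "qob z \<in> Obj K"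
  by (simp_all add: comma_obj_iff)

lemma up_arr [simp]: "gb (up w z) \<in> Arr K" "gp (up w z) \<in> Arr K" "gq (up w z) \<in> Arr K" "ge (up w z) \<in> Arr K"
proof -
  note zD = E2.gelemD(17,18)[OF z]
  have "str (Cod K g) \<cdot>2 (b2 \<cdot>2 gb z) = Ha (gb y1) \<cdot>2 (b1 \<cdot>2 gb z)"
    by (rule E2.reassoc[OF E2.pullbackD(9)[OF PB, symmetric]]) simp_all
  then show "gb (up w z) \<in> Arr K" by simp
  have "str (Dom K g) \<cdot>2 (pA \<cdot>2 gp z) = Ha (gp y1) \<cdot>2 (r \<cdot>2 gp z)"
    by (rule E2.reassoc[OF r(4)[symmetric]]) simp_all
  then show "gp (up w z) \<in> Arr K" by simp
  have "Ha (gq y1) \<cdot>2 (r \<cdot>2 gp z) = b1 \<cdot>2 (g' \<cdot>2 gp z)"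
    by (rule E2.reassoc[OF r(5)]) simp_all
  then show "gq (up w z) \<in> Arr K" by (simp add: zD(1))
  have "Ha (ge y1) \<cdot>2 (r \<cdot>2 gp z) = j1 \<cdot>2 (h' \<cdot>2 gp z)"
    by (rule E2.reassoc[OF h'(4)[symmetric]]) simp_all
  then show "ge (up w z) \<in> Arr K" by (simp add: zD(2))
qed

lemma gelem_up: "gelem K g h (tot w) (up w z)"
proof (rule K.gelemI)
  note zD = E2.gelemD(17,18)[OF z]
  show "is_pullback K g (gb (up w z)) (gp (up w z)) (gq (up w z))"
  proof (rule comma_pullbackI)
    show "is_pullback E1 (a1 g) (a1 (gb (up w z))) (a1 (gp (up w z))) (a1 (gq (up w z)))"
      using y1D(1) by simp
    show "is_pullback E2 (a2 g) (a2 (gb (up w z))) (a2 (gp (up w z))) (a2 (gq (up w z)))"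
      \<comment> \<open>The square of \<open>z\<close> over \<open>g'\<close> is pasted onto the
        square \<open>PA\<close> of \<open>g'\<close> over \<open>a2 g\<close>.\<close>
      using E2.pullback_paste[OF PA E2.gelemD(1)[OF z]] by simp
  qed (use up_arr in \<open>simp_all del: up_arr mk_simps(1)\<close>)
  have e2: "j2 \<cdot>2 (h' \<cdot>2 gp z) = a2 h \<cdot>2 (pA \<cdot>2 gp z)"
    by (rule E2.reassoc[OF h'(5)]) simp_all
  show "tot w \<cdot>K ge (up w z) = h \<cdot>K gp (up w z)"
    by (rule comma_eqI) (use up_arr y1D(18) zD(2) e2 in \<open>simp_all del: up_arr mk_simps(1)\<close>)
qed (use up_arr in \<open>simp_all del: up_arr mk_simps(1)\<close>)

end

lemma up_push:
  assumes z: "gelem E2 g' h' w z"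
  shows "up w' (push E2 d z) = push K (mk (tot_obj w) (tot_obj w') (Ident E1 (Dom E1 u1)) d) (up w z)"
  by (simp add: up_def push_def qob_def gob_def)

lemma gmor_up:
  assumes z: "gelem E2 g' h' w z" and z': "gelem E2 g' h' w z'" and m: "gmor E2 z z' m n"
  shows "gmor K (up w z) (up w z') (mk (gob z) (gob z') (Ident E1 (Dom E1 (gb y1))) m)
    (mk (qob z) (qob z') (Ident E1 (Dom E1 (gp y1))) n)"
proof -
  note [simp] = fibre_props[OF z] fibre_props[OF z'] up_obj[OF z] up_obj[OF z']
  have mn: "m \<in> Arr E2" "Dom E2 m = Dom E2 (gb z)" "Cod E2 m = Dom E2 (gb z')"
    "n \<in> Arr E2" "Dom E2 n = Dom E2 (gp z)" "Cod E2 n = Dom E2 (gp z')"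
    "gb z' \<cdot>2 m = gb z" "gp z' \<cdot>2 n = gp z" "gq z' \<cdot>2 n = m \<cdot>2 gq z" "ge z' \<cdot>2 n = ge z"
    using m by (simp_all add: gmor_def)
  show ?thesis unfolding gmor_def
    using mn up_arr[OF z] up_arr[OF z'] by simp
qed

section \<open>From generalized elements of the comma category to \<open>E2\<close>\<close>

context
  fixes w x
  assumes w: "w \<in> Arr E2" "Cod E2 w = Dom E2 j1" and x: "gelem K g h (tot w) x"
begin

lemma base_gelem: "gelem E1 (a1 g) (a1 h) u1 (el1 x)"
  using p1.gelem_map[OF x p1_pullback[OF K.gelemD(1)[OF x]]] by simp

lemma x_props [simp]:
  "gb x \<in> Arr K" "gp x \<in> Arr K" "gq x \<in> Arr K" "ge x \<in> Arr K"
  "Cod K (gb x) = Cod K g" "Dom K (gq x) = Dom K (gp x)" "Dom K (ge x) = Dom K (gp x)"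
  "Cod K (gp x) = Dom K g" "Cod K (gq x) = Dom K (gb x)" "Cod K (ge x) = tot_obj w"
  using K.gelemD[OF x] by simp_all

lemma base_map [simp]:
  "base_map x \<in> Arr E1" "Dom E1 (base_map x) = o1 (Dom K (gb x))" "Cod E1 (base_map x) = Dom E1 (gb y1)"
  and base_map_gb: "gb y1 \<cdot>1 base_map x = a1 (gb x)"
  using E1.name_hom[OF y1 base_gelem] by (simp_all add: base_map_def)

lemma down_sel:
  "gb (down x) \<in> Arr E2" "Dom E2 (gb (down x)) = o2 (Dom K (gb x))" "Cod E2 (gb (down x)) = Dom E2 b1"
  "b1 \<cdot>2 gb (down x) = Ha (base_map x) \<cdot>2 str (Dom K (gb x))" "b2 \<cdot>2 gb (down x) = a2 (gb x)"
  "gp (down x) \<in> Arr E2" "Dom E2 (gp (down x)) = o2 (Dom K (gp x))" "Cod E2 (gp (down x)) = Dom E2 pA"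
  "pA \<cdot>2 gp (down x) = a2 (gp x)" "g' \<cdot>2 gp (down x) = gb (down x) \<cdot>2 a2 (gq x)"
  "gq (down x) = a2 (gq x)" "ge (down x) = a2 (ge x)"
proof -
  have O: "Dom K (gb x) \<in> Obj K" by simp
  have "Ha (gb y1) \<cdot>2 (Ha (base_map x) \<cdot>2 str (Dom K (gb x))) = str (Cod K g) \<cdot>2 a2 (gb x)"
    using comma_arrD(9)[of "gb x"] E2.reassoc1[OF H.map_triangle[OF base_map_gb], of "str (Dom K (gb x))"] O by simp
  note b = E2.pair[OF PB _ _ _ _ _ this]
  show 1: "gb (down x) \<in> Arr E2" "Dom E2 (gb (down x)) = o2 (Dom K (gb x))" "Cod E2 (gb (down x)) = Dom E2 b1"
    "b1 \<cdot>2 gb (down x) = Ha (base_map x) \<cdot>2 str (Dom K (gb x))" "b2 \<cdot>2 gb (down x) = a2 (gb x)"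
    using b O by (simp_all add: down_def Let_def)
  show sel: "gq (down x) = a2 (gq x)" "ge (down x) = a2 (ge x)" by (simp_all add: down_def Let_def)
  have "a2 g \<cdot>2 a2 (gp x) = a2 (gb x) \<cdot>2 a2 (gq x)"
    by (rule p2.map_square[OF K.gelemD(17)[OF x]]) simp_all
  also have "\<dots> = b2 \<cdot>2 (gb (down x) \<cdot>2 a2 (gq x))"
    by (rule E2.reassoc1[OF 1(5), symmetric]) (use 1(1-3) in simp_all)
  finally have "a2 g \<cdot>2 a2 (gp x) = b2 \<cdot>2 (gb (down x) \<cdot>2 a2 (gq x))" .
  note p = E2.pair[OF PA _ _ _ _ _ this]
  have gp: "gp (down x) = pair E2 pA g' (a2 (gp x)) (gb (down x) \<cdot>2 a2 (gq x))" by (simp add: down_def Let_def)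
  show "gp (down x) \<in> Arr E2" "Dom E2 (gp (down x)) = o2 (Dom K (gp x))" "Cod E2 (gp (down x)) = Dom E2 pA"
    "pA \<cdot>2 gp (down x) = a2 (gp x)" "g' \<cdot>2 gp (down x) = gb (down x) \<cdot>2 a2 (gq x)"
    unfolding gp using p 1(1-3) by simp_all
qed

text \<open>\<open>n1\<close> accompanies \<open>base_map x\<close> on the pullbacks. The last
  equation holds because \<open>H\<close> keeps the square of \<open>y1\<close> a pullback, so it
  may be checked on both legs; it is the square needed to pair \<open>n1\<close> with an identity of
  \<open>E2\<close>.\<close>

lemma base_gmor:
  obtains n1 where "n1 \<in> Arr E1" "Dom E1 n1 = o1 (Dom K (gp x))" "Cod E1 n1 = Dom E1 (gp y1)" "gp y1 \<cdot>1 n1 = a1 (gp x)"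
    "gq y1 \<cdot>1 n1 = base_map x \<cdot>1 a1 (gq x)" "ge y1 \<cdot>1 n1 = a1 (ge x)"
    "r \<cdot>2 gp (down x) = Ha n1 \<cdot>2 str (Dom K (gp x))"
proof -
  obtain n1 where n1: "gmor E1 (el1 x) y1 (base_map x) n1"
    using E1.univ_name[OF y1 base_gelem] unfolding base_map_def .
  then have n: "n1 \<in> Arr E1" "Dom E1 n1 = o1 (Dom K (gp x))" "Cod E1 n1 = Dom E1 (gp y1)" "gp y1 \<cdot>1 n1 = a1 (gp x)"
    "gq y1 \<cdot>1 n1 = base_map x \<cdot>1 a1 (gq x)" "ge y1 \<cdot>1 n1 = a1 (ge x)" by (simp_all add: gmor_def)
  note d = down_sel
  have O: "Dom K (gb x) \<in> Obj K" "Dom K (gp x) \<in> Obj K" by simp_all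
  have "Ha (gp y1) \<cdot>2 (r \<cdot>2 gp (down x)) = str (Dom K g) \<cdot>2 (pA \<cdot>2 gp (down x))"
    by (rule E2.reassoc[OF r(4)]) (use d(6-8) in simp_all)
  also have "\<dots> = Ha (a1 (gp x)) \<cdot>2 str (Dom K (gp x))" using comma_arrD(9)[of "gp x"] d(9) by simp
  also have "\<dots> = Ha (gp y1) \<cdot>2 (Ha n1 \<cdot>2 str (Dom K (gp x)))"
    by (rule E2.reassoc1[OF H.map_triangle[OF n(4)], symmetric]) (use n O in simp_all)
  finally have 1: "Ha (gp y1) \<cdot>2 (r \<cdot>2 gp (down x)) = Ha (gp y1) \<cdot>2 (Ha n1 \<cdot>2 str (Dom K (gp x)))" .
  have "Ha (gq y1) \<cdot>2 (r \<cdot>2 gp (down x)) = b1 \<cdot>2 (g' \<cdot>2 gp (down x))"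
    by (rule E2.reassoc[OF r(5)]) (use d(6-8) in simp_all)
  also have "\<dots> = Ha (base_map x) \<cdot>2 (str (Dom K (gb x)) \<cdot>2 a2 (gq x))"
    unfolding d(10) by (rule E2.reassoc[OF d(4)]) (use d(1-3) O in simp_all)
  also have "\<dots> = (Ha (base_map x) \<cdot>2 Ha (a1 (gq x))) \<cdot>2 str (Dom K (gp x))"
    using comma_arrD(9)[of "gq x"] O by simp
  also have "\<dots> = Ha (gq y1) \<cdot>2 (Ha n1 \<cdot>2 str (Dom K (gp x)))"
    using H.map_square[OF n(5)] n O by (simp flip: E2.assoc)
  finally have 2: "Ha (gq y1) \<cdot>2 (r \<cdot>2 gp (down x)) = Ha (gq y1) \<cdot>2 (Ha n1 \<cdot>2 str (Dom K (gp x)))" .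
  have "r \<cdot>2 gp (down x) = Ha n1 \<cdot>2 str (Dom K (gp x))"
    by (rule E2.pullback_eqI[OF H_pullback[OF y1D(1)]]) (use 1 2 d(6-8) n O in simp_all)
  then show ?thesis using that n by blast
qed

lemma gelem_down: "gelem E2 g' h' w (down x)"
proof (rule E2.gelemI)
  note d = down_sel
  have O: "Dom K (gp x) \<in> Obj K" by simp
  show "is_pullback E2 g' (gb (down x)) (gp (down x)) (gq (down x))"
    \<comment> \<open>The second components of \<open>x\<close> form a pullback of
      \<open>a2 g\<close> along \<open>b2 \<cdot>2 gb (down x)\<close>; cancelling \<open>PA\<close>
      leaves one of \<open>g'\<close>.\<close>
    using p2_pullback[OF K.gelemD(1)[OF x]] d by (intro E2.pullback_cancel[OF PA, of _ "a2 (gp x)"]) simp_all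
  obtain n1 where n1: "n1 \<in> Arr E1" "Dom E1 n1 = o1 (Dom K (gp x))" "Cod E1 n1 = Dom E1 (gp y1)" "ge y1 \<cdot>1 n1 = a1 (ge x)"
    "r \<cdot>2 gp (down x) = Ha n1 \<cdot>2 str (Dom K (gp x))" using base_gmor by metis
  have "j1 \<cdot>2 (h' \<cdot>2 gp (down x)) = Ha (ge y1) \<cdot>2 (r \<cdot>2 gp (down x))"
    by (rule E2.reassoc[OF h'(4)]) (use d(6-8) in simp_all)
  also have "\<dots> = Ha (a1 (ge x)) \<cdot>2 str (Dom K (gp x))"
    unfolding n1(5) by (rule E2.reassoc1[OF H.map_triangle[OF n1(4)]]) (use n1(1-3) O in simp_all)
  finally have 1: "j1 \<cdot>2 (w \<cdot>2 a2 (ge x)) = j1 \<cdot>2 (h' \<cdot>2 gp (down x))"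
    using comma_arrD(9)[of "ge x"] w by simp
  have "j2 \<cdot>2 (h' \<cdot>2 gp (down x)) = a2 h \<cdot>2 (pA \<cdot>2 gp (down x))"
    by (rule E2.reassoc[OF h'(5)]) (use d(6-8) in simp_all)
  then have 2: "j2 \<cdot>2 (w \<cdot>2 a2 (ge x)) = j2 \<cdot>2 (h' \<cdot>2 gp (down x))"
    using p2.map_square[OF K.gelemD(18)[OF x]] d(9) w by simp
  show "w \<cdot>2 ge (down x) = h' \<cdot>2 gp (down x)"
    by (rule E2.pullback_eqI[OF PJ]) (use 1 2 d w in simp_all)
qed (use down_sel w in simp_all)

text \<open>The unit of an adjunction between \<open>down\<close> and \<open>up\<close>: each
  element maps to one whose first component is \<open>y1\<close> itself, by a base arrow that is an
  identity in \<open>E2\<close>.\<close>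

lemma gmor_up_down:
  obtains n where "gmor K x (up w (down x)) (mk (Dom K (gb x)) (gob (down x)) (base_map x) (Ident E2 (o2 (Dom K (gb x))))) n"
proof -
  obtain n1 where n1: "n1 \<in> Arr E1" "Dom E1 n1 = o1 (Dom K (gp x))" "Cod E1 n1 = Dom E1 (gp y1)" "gp y1 \<cdot>1 n1 = a1 (gp x)"
    "gq y1 \<cdot>1 n1 = base_map x \<cdot>1 a1 (gq x)" "ge y1 \<cdot>1 n1 = a1 (ge x)"
    "r \<cdot>2 gp (down x) = Ha n1 \<cdot>2 str (Dom K (gp x))" using base_gmor by metis
  note d = down_sel
  note ua = up_arr[OF gelem_down]
  have O: "Dom K (gb x) \<in> Obj K" "Dom K (gp x) \<in> Obj K" by simp_all
  let ?m = "mk (Dom K (gb x)) (gob (down x)) (base_map x) (Ident E2 (o2 (Dom K (gb x))))"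
  let ?n = "mk (Dom K (gp x)) (qob (down x)) n1 (Ident E2 (o2 (Dom K (gp x))))"
  have m: "?m \<in> Arr K" using O up_obj[OF gelem_down] d(1-4) by simp
  have n: "?n \<in> Arr K" using O up_obj[OF gelem_down] d(6-8) n1 by simp
  have "gmor K x (up w (down x)) ?m ?n"
    unfolding gmor_def
  proof (intro conjI)
    show "gb (up w (down x)) \<cdot>K ?m = gb x"
      by (rule comma_eqI) (use m ua(1) base_map_gb d in \<open>simp_all del: mk_simps(1)\<close>)
    show "gp (up w (down x)) \<cdot>K ?n = gp x"
      by (rule comma_eqI) (use n ua(2) n1 d in \<open>simp_all del: mk_simps(1)\<close>)
    show "gq (up w (down x)) \<cdot>K ?n = ?m \<cdot>K gq x"
      by (rule comma_eqI) (use m n ua(3) n1 d in \<open>simp_all del: mk_simps(1)\<close>)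
    show "ge (up w (down x)) \<cdot>K ?n = ge x"
      by (rule comma_eqI) (use n ua(4) n1 d in \<open>simp_all del: mk_simps(1)\<close>)
  qed (use m n in \<open>simp_all del: mk_simps(1)\<close>)
  then show ?thesis by (rule that)
qed

end

lemma gmor_down:
  assumes w: "w \<in> Arr E2" "Cod E2 w = Dom E2 j1" and x: "gelem K g h (tot w) x" and y: "gelem K g h (tot w) y"
    and m: "gmor K x y m n"
  shows "gmor E2 (down x) (down y) (a2 m) (a2 n)" and "base_map x = base_map y \<cdot>1 a1 m"
proof -
  note [simp] = x_props[OF w x] x_props[OF w y] base_map[OF w x] base_map[OF w y]
  note dx = down_sel[OF w x] and dy = down_sel[OF w y]
  have mn: "m \<in> Arr K" "Dom K m = Dom K (gb x)" "Cod K m = Dom K (gb y)"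
    "n \<in> Arr K" "Dom K n = Dom K (gp x)" "Cod K n = Dom K (gp y)"
    "gb y \<cdot>K m = gb x" "gp y \<cdot>K n = gp x" "gq y \<cdot>K n = m \<cdot>K gq x" "ge y \<cdot>K n = ge x"
    using m by (simp_all add: gmor_def)
  have O: "Dom K (gb x) \<in> Obj K" "Dom K (gb y) \<in> Obj K" by simp_all
  show bm: "base_map x = base_map y \<cdot>1 a1 m"
    unfolding base_map_def by (rule E1.name_gmor[OF y1 base_gelem[OF w x] base_gelem[OF w y] p1.gmor_map[OF x y m]])
  have "b1 \<cdot>2 (gb (down y) \<cdot>2 a2 m) = Ha (base_map y) \<cdot>2 (str (Dom K (gb y)) \<cdot>2 a2 m)"
    by (rule E2.reassoc[OF dy(4)]) (use dy(1-3) mn O in simp_all)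
  also have "\<dots> = b1 \<cdot>2 gb (down x)"
    using comma_arrD(9)[of m] mn O by (simp add: dx(4) bm)
  finally have 1: "b1 \<cdot>2 (gb (down y) \<cdot>2 a2 m) = b1 \<cdot>2 gb (down x)" .
  have 2: "b2 \<cdot>2 (gb (down y) \<cdot>2 a2 m) = b2 \<cdot>2 gb (down x)"
    using E2.reassoc1[OF dy(5), of "a2 m"] p2.map_triangle[OF mn(7)] dy(1-3) dx(5) mn by simp
  have b: "gb (down y) \<cdot>2 a2 m = gb (down x)"
    by (rule E2.pullback_eqI[OF PB]) (use 1 2 dx(1-3) dy(1-3) mn in simp_all)
  have q: "a2 (gq y) \<cdot>2 a2 n = a2 m \<cdot>2 a2 (gq x)"
    using p2.map_square[OF mn(9)] mn by simp
  have "g' \<cdot>2 (gp (down y) \<cdot>2 a2 n) = gb (down y) \<cdot>2 (a2 (gq y) \<cdot>2 a2 n)"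
    by (rule E2.reassoc[OF dy(10)]) (use dy(1-3,6-8) mn in simp_all)
  also have "\<dots> = gb (down x) \<cdot>2 a2 (gq x)"
    unfolding q by (rule E2.reassoc1[OF b]) (use dy(1-3) mn in simp_all)
  finally have 3: "g' \<cdot>2 (gp (down y) \<cdot>2 a2 n) = g' \<cdot>2 gp (down x)" by (simp add: dx(10))
  have 4: "pA \<cdot>2 (gp (down y) \<cdot>2 a2 n) = pA \<cdot>2 gp (down x)"
    using E2.reassoc1[OF dy(9), of "a2 n"] p2.map_triangle[OF mn(8)] dy(6-8) dx(9) mn by simp
  have p: "gp (down y) \<cdot>2 a2 n = gp (down x)"
    by (rule E2.pullback_eqI[OF PA]) (use 3 4 dx(6-8) dy(6-8) mn in simp_all)
  show "gmor E2 (down x) (down y) (a2 m) (a2 n)"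
    unfolding gmor_def using b p q p2.map_triangle[OF mn(10)] mn dx dy by simp
qed

lemma down_up:
  assumes z: "gelem E2 g' h' w z"
  shows "down (up w z) = z" and "base_map (up w z) = Ident E1 (Dom E1 (gb y1))"
proof -
  note [simp] = fibre_props[OF z]
  show bm: "base_map (up w z) = Ident E1 (Dom E1 (gb y1))"
    by (simp add: base_map_def map_gel_up E1.name_self[OF y1])
  have "pair E2 b1 b2 (Ha (base_map (up w z)) \<cdot>2 str (Dom K (gb (up w z)))) (a2 (gb (up w z))) = gb z"
    using E2.pair_eq[OF PB, of "gb z"] by (simp add: bm)
  moreover have "pair E2 pA g' (pA \<cdot>2 gp z) (gb z \<cdot>2 gq z) = gp z"
    using E2.pair_eq[OF PA, of "gp z"] E2.gelemD(17)[OF z] by simp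
  ultimately show "down (up w z) = z"
    by (simp add: down_def Let_def)
qed

text \<open>\<open>down\<close> is left adjoint to \<open>up\<close>, with unit from
  \<open>gmor_up_down\<close> and identity counit from \<open>down_up\<close>, and right adjoints
  preserve terminal objects. In the uniqueness part, the component in \<open>E1\<close> is forced to
  be \<open>base_map x\<close> and the one in \<open>E2\<close> to be the name of
  \<open>down x\<close>.\<close>

lemma univ_up:
  assumes z: "univ E2 g' h' w z"
  shows "univ K g h (tot w) (up w z)"
  unfolding univ_def
proof (intro conjI allI impI)
  note ze = univ_gelem[OF z]
  note w = fibre_props(1,2)[OF ze]
  show ue: "gelem K g h (tot w) (up w z)" by (rule gelem_up[OF ze])
  fix x assume x: "gelem K g h (tot w) x"
  note dx = gelem_down[OF w x]
  note ux = gelem_up[OF dx]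
  obtain n where n: "gmor K x (up w (down x)) (mk (Dom K (gb x)) (gob (down x)) (base_map x) (Ident E2 (o2 (Dom K (gb x))))) n"
    using gmor_up_down[OF w x] by blast
  obtain k where "gmor E2 (down x) z (name E2 z (down x)) k" using E2.univ_name[OF z dx] .
  from K.gmor_comp[OF x ux ue n gmor_up[OF dx ze this]]
  obtain m l where m: "gmor K x (up w z) m l" by blast
  show "\<exists>!m. \<exists>n. gmor K x (up w z) m n"
  proof (rule ex1I)
    show "\<exists>n. gmor K x (up w z) m n" using m by blast
    fix m' assume "\<exists>n. gmor K x (up w z) m' n"
    then obtain l' where m': "gmor K x (up w z) m' l'" by blast
    have "name E2 z (down x) = a2 m" "name E2 z (down x) = a2 m'"
      by (rule E2.name_eq[OF z dx gmor_down(1)[OF w x ue m, unfolded down_up(1)[OF ze]]],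
          rule E2.name_eq[OF z dx gmor_down(1)[OF w x ue m', unfolded down_up(1)[OF ze]]])
    moreover have "base_map x = a1 m" "base_map x = a1 m'"
      using gmor_down(2)[OF w x ue m] gmor_down(2)[OF w x ue m'] m m' by (simp_all add: down_up(2)[OF ze] gmor_def)
    ultimately show "m' = m" using m m' by (intro comma_eqI) (simp_all add: gmor_def)
  qed
qed

text \<open>\<open>w\<close> pairs the structure map of the source of \<open>u\<close> with
  \<open>a2 u\<close>; the square that makes \<open>u\<close> an arrow is the compatibility needed
  for an arrow into \<open>J\<close>.\<close>

lemma tot_eq:
  assumes u: "u \<in> Arr K" "Cod K u = Cod K h" "a1 u = u1"
  obtains w where "w \<in> Arr E2" "Cod E2 w = Dom E2 j1" "tot w = u"
proof -
  have O: "Dom K u \<in> Obj K" using u by simp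
  have D: "Dom E1 u1 = o1 (Dom K u)" using u p1.dom_map[of u] by simp
  have "Ha u1 \<cdot>2 str (Dom K u) = str (Cod K h) \<cdot>2 a2 u" using comma_arrD(9)[of u] u by simp
  note w = E2.pair[OF PJ _ _ _ _ _ this]
  let ?w = "pair E2 j1 j2 (str (Dom K u)) (a2 u)"
  have w: "?w \<in> Arr E2" "Dom E2 ?w = o2 (Dom K u)" "Cod E2 ?w = Dom E2 j1" "j1 \<cdot>2 ?w = str (Dom K u)" "j2 \<cdot>2 ?w =
    a2 u"
    using w u O D by simp_all
  have "tot_obj ?w = Dom K u" unfolding tot_obj_def w D by (rule triple_eta)
  then have "tot ?w = u" using u w by (intro comma_eqI) simp_all
  then show ?thesis using that w by blast
qed

end

text \<open>\<open>r\<close> is induced by the pullback that \<open>H\<close> makes of the square of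
  \<open>y1\<close>. Then \<open>h'\<close> is induced by \<open>J\<close>, with coordinates
  \<open>ge y1\<close> evaluated at \<open>r\<close> and \<open>a2 h\<close>.\<close>

lemma (in gluing) comma_step_exists:
  assumes gh: "g \<in> Arr K" "h \<in> Arr K" "Dom K h = Dom K g" and y1: "univ E1 (a1 g) (a1 h) u1 y1"
  obtains b1 b2 pA g' r j1 j2 h' where "comma_step E1 E2 H g h u1 y1 b1 b2 pA g' r j1 j2 h'"
proof -
  note yD = E1.gelemD[OF univ_gelem[OF y1]]
  have O: "Dom K g \<in> Obj K" "Cod K g \<in> Obj K" "Cod K h \<in> Obj K" using gh by simp_all
  let ?b1 = "pb1 E2 (Ha (gb y1)) (str (Cod K g))" and ?b2 = "pb2 E2 (Ha (gb y1)) (str (Cod K g))"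
  have PB: "is_pullback E2 (Ha (gb y1)) (str (Cod K g)) ?b1 ?b2"
    using yD O gh by (intro E2.pb) simp_all
  note B = E2.pullbackD[OF PB]
  let ?pA = "pb1 E2 (a2 g) ?b2" and ?g' = "pb2 E2 (a2 g) ?b2"
  have PA: "is_pullback E2 (a2 g) ?b2 ?pA ?g'"
    using B O gh by (intro E2.pb) simp_all
  note A = E2.pullbackD[OF PA]
  let ?j1 = "pb1 E2 (Ha u1) (str (Cod K h))" and ?j2 = "pb2 E2 (Ha u1) (str (Cod K h))"
  have PJ: "is_pullback E2 (Ha u1) (str (Cod K h)) ?j1 ?j2"
    using yD O gh by (intro E2.pb) simp_all
  note J = E2.pullbackD[OF PJ]
  have g9: "str (Cod K g) \<cdot>2 a2 g = Ha (a1 g) \<cdot>2 str (Dom K g)" by (rule comma_arrD(9)[OF gh(1)])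
  have h9: "str (Cod K h) \<cdot>2 a2 h = Ha (a1 h) \<cdot>2 str (Dom K g)" using comma_arrD(9)[OF gh(2)] gh by simp
  have "Ha (a1 g) \<cdot>2 (str (Dom K g) \<cdot>2 ?pA) = str (Cod K g) \<cdot>2 (a2 g \<cdot>2 ?pA)"
    by (rule E2.reassoc[OF g9[symmetric]]) (use A O gh in simp_all)
  also have "\<dots> = Ha (gb y1) \<cdot>2 (?b1 \<cdot>2 ?g')"
    unfolding A(9) by (rule E2.reassoc[OF B(9)[symmetric]]) (use A B O yD gh in simp_all)
  finally have e: "Ha (a1 g) \<cdot>2 (str (Dom K g) \<cdot>2 ?pA) = Ha (gb y1) \<cdot>2 (?b1 \<cdot>2 ?g')" .
  let ?r = "pair E2 (Ha (gp y1)) (Ha (gq y1)) (str (Dom K g) \<cdot>2 ?pA) (?b1 \<cdot>2 ?g')"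
  have r: "?r \<in> Arr E2" "Dom E2 ?r = Dom E2 ?pA" "Cod E2 ?r = Ho (Dom E1 (gp y1))"
      "Ha (gp y1) \<cdot>2 ?r = str (Dom K g) \<cdot>2 ?pA" "Ha (gq y1) \<cdot>2 ?r = ?b1 \<cdot>2 ?g'"
    using E2.pair[OF H_pullback[OF yD(1)] _ _ _ _ _ e] A B O yD gh by simp_all
  have "Ha u1 \<cdot>2 (Ha (ge y1) \<cdot>2 ?r) = Ha (a1 h) \<cdot>2 (Ha (gp y1) \<cdot>2 ?r)"
    by (rule E2.reassoc[OF H.map_square[OF yD(18)]]) (use r yD gh in simp_all)
  also have "\<dots> = str (Cod K h) \<cdot>2 (a2 h \<cdot>2 ?pA)"
    unfolding r(4) by (rule E2.reassoc[OF h9[symmetric]]) (use A O gh in simp_all)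
  finally have e': "Ha u1 \<cdot>2 (Ha (ge y1) \<cdot>2 ?r) = str (Cod K h) \<cdot>2 (a2 h \<cdot>2 ?pA)" .
  let ?h' = "pair E2 ?j1 ?j2 (Ha (ge y1) \<cdot>2 ?r) (a2 h \<cdot>2 ?pA)"
  have h': "?h' \<in> Arr E2" "Dom E2 ?h' = Dom E2 ?pA" "Cod E2 ?h' = Dom E2 ?j1"
      "?j1 \<cdot>2 ?h' = Ha (ge y1) \<cdot>2 ?r" "?j2 \<cdot>2 ?h' = a2 h \<cdot>2 ?pA"
    using E2.pair[OF PJ _ _ _ _ _ e'] r(1-3) A O yD gh by simp_all
  show ?thesis
    by (rule that[of ?b1 ?b2 ?pA ?g' ?r ?j1 ?j2 ?h'], unfold_locales) (fact gh y1 PB PA r PJ h')+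
qed

text \<open>With \<open>u\<close> written as \<open>tot w\<close>, a universal element for
  \<open>w\<close> in \<open>E2\<close> is lifted by \<open>up\<close>. Its first component is on
  the nose the universal element of \<open>E1\<close> from which the construction started.\<close>

lemma (in gluing) comma_univ:
  assumes "g \<in> Arr K" "h \<in> Arr K" "Dom K h = Dom K g" "u \<in> Arr K" "Cod K u = Cod K h"
  obtains y where "univ K g h u y" "univ E1 (a1 g) (a1 h) (a1 u) (el1 y)"
proof -
  have y1: "univ E1 (a1 g) (a1 h) (a1 u) (canonical E1 (a1 g) (a1 h) (a1 u))" (is "univ _ _ _ _ ?y1")
    using assms by (intro E1.canonical_univ) simp_all
  obtain b1 b2 pA g' r j1 j2 h' where "comma_step E1 E2 H g h (a1 u) ?y1 b1 b2 pA g' r j1 j2 h'"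
    using comma_step_exists[OF assms(1-3) y1] .
  then interpret S: comma_step E1 E2 H g h "a1 u" ?y1 b1 b2 pA g' r j1 j2 h' .
  obtain w where w: "w \<in> Arr E2" "Cod E2 w = Dom E2 j1" "S.tot w = u"
    using S.tot_eq[OF assms(4,5) refl] .
  have z: "univ E2 g' h' w (canonical E2 g' h' w)" using w by (intro E2.canonical_univ) simp_all
  show ?thesis
    using that[of "S.up w (canonical E2 g' h' w)"] S.univ_up[OF z] y1 w(3) by (simp add: S.map_gel_up)
qed

text \<open>The universal element from \<open>comma_univ\<close> projects to a universal one by
  construction. Any other is isomorphic to it, and the projection carries the isomorphism to
  \<open>E1\<close>.\<close>

lemma (in gluing) preserves_univ1:
  assumes y: "univ K g h u y"
  shows "univ E1 (a1 g) (a1 h) (a1 u) (el1 y)"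
proof -
  note yD = K.gelemD[OF univ_gelem[OF y]]
  obtain z where z: "univ K g h u z" and z1: "univ E1 (a1 g) (a1 h) (a1 u) (el1 z)"
    using comma_univ[OF yD(8,7,9,6,10)] .
  note e = univ_gelem[OF y] univ_gelem[OF z]
  obtain m n where m: "gmor K z y (name K y z) n" and n: "gmor K y z (name K z y) m"
    using K.univ_name[OF y e(2)] K.univ_name[OF z e(1)] by metis
  note i = p1.map_inverse_arrows[OF K.univ_inverse[OF y z]]
  show ?thesis
  proof (rule E1.univ_transport[OF z1])
    show "gelem E1 (a1 g) (a1 h) (a1 u) (el1 y)"
      by (rule p1.gelem_map[OF e(1) p1_pullback[OF yD(1)]])
    show "gmor E1 (el1 z) (el1 y) (a1 (name K y z)) (a1 n)"
      by (rule p1.gmor_map[OF e(2,1) m])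
    show "gmor E1 (el1 y) (el1 z) (a1 (name K z y)) (a1 m)"
      by (rule p1.gmor_map[OF e n])
    show "a1 (name K y z) \<cdot>1 a1 (name K z y) = Ident E1 (Dom E1 (gb (el1 y)))"
      using i K.name_hom[OF y e(2)] yD by (simp add: inverse_arrows_def)
  qed
qed

section \<open>Local cartesian closure of the comma category and of its first projection\<close>

lemma (in gluing) lccc_comma: "lccc K"
proof (rule K.lcccI)
  fix g v assume "g \<in> Arr K" "v \<in> Arr K" "Cod K v = Dom K g"
  then show "\<exists>y. univ K g (Ident K (Dom K g)) v y"
    using comma_univ[of g "Ident K (Dom K g)" v] by (metis K.arr_ident K.cod_ident K.dom_ident K.dom_obj)
qed

sublocale gluing \<subseteq> K: lccc_category K
  by standard (rule lccc_comma)

sublocale gluing \<subseteq> p1: lcc_map K E1 pr1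
  by standard (rule p1_pullback, assumption, rule preserves_univ1, assumption)

lemma (in gluing) lcc_functor_proj1: "lcc_functor K E1 pr1"
  unfolding lcc_functor_def
  using lccc_comma E1.lccc proj_functors(1) proj_limits(1) p1.preserves_pushforwards by blast

section \<open>W-types in the comma category\<close>

lemma (in category) op_initial_cong:
  assumes u: "op_initial C f g h u \<sigma>" and e: "\<And>x. gelem C g h u x \<Longrightarrow> \<sigma> x = \<sigma>' x"
  shows "op_initial C f g h u \<sigma>'"
proof -
  have \<sigma>: "op_alg C f g h u \<sigma>" using u by (simp add: op_initial_def)
  have "op_alg C f g h u \<sigma>'"
  proof (rule op_algI)
    show "\<sigma>' x = \<sigma>' y \<cdot> m" if "gelem C g h u x" "gelem C g h u y" "gmor C x y m n" for x y m n
      using op_algD(7)[OF \<sigma> that] e[OF that(1)] e[OF that(2)] by simp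
  qed (use op_algD(1-6)[OF \<sigma>] e in simp_all)
  moreover have "\<exists>!k. op_hom C g h u \<sigma>' v \<tau> k" if \<tau>: "op_alg C f g h v \<tau>" for v \<tau>
  proof -
    have "op_hom C g h u \<sigma> v \<tau> k \<longleftrightarrow> op_hom C g h u \<sigma>' v \<tau> k" for k
      by (rule op_hom_cong[OF op_algD(1)[OF \<tau>] e refl])
    moreover have "\<exists>!k. op_hom C g h u \<sigma> v \<tau> k" using u \<tau> by (simp add: op_initial_def)
    ultimately show ?thesis by simp
  qed
  ultimately show ?thesis by (simp add: op_initial_def)
qed

locale gluing_polynomial = gluing E1 E2 H + P: polynomial "comma E1 E2 H" f g h
  for E1 :: "('o1, 'a1) cat" and E2 :: "('o2, 'a2) cat" and H :: "('o1, 'a1, 'o2, 'a2) func" and f g h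
begin

text \<open>
  An operation is projected to \<open>E1\<close> through its value at the universal element; this avoids lifting
  arbitrary generalized elements from \<open>E1\<close> to the comma category.
\<close>

definition proj_op where
  "proj_op v \<tau> x = a1 (\<tau> (canonical K g h v)) \<cdot>1 name E1 (el1 (canonical K g h v)) x"

lemma proj_op_alg:
  assumes \<tau>: "op_alg K f g h v \<tau>"
  shows "op_alg E1 (a1 f) (a1 g) (a1 h) (a1 v) (proj_op v \<tau>)"
proof -
  note v = K.op_algD(1,2)[OF \<tau>]
  note y = P.canonical_univ'[OF v]
  note ye = univ_gelem[OF y]
  note t = K.op_algD(3-6)[OF \<tau> ye]
  have fb: "Dom K f = Cod K (gb (canonical K g h v))" using K.gelemD(11)[OF ye] P.poly by simp
  have "a1 v \<cdot>1 a1 (\<tau> (canonical K g h v)) = a1 f \<cdot>1 a1 (gb (canonical K g h v))"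
    by (rule p1.map_square[OF t(4)]) (use t v P.poly fb K.gelemD(2)[OF ye] in simp_all)
  then show ?thesis
    unfolding proj_op_def
    by (intro E1.op_alg_of[OF preserves_univ1[OF y]]) (use P.poly t v K.gelemD(2)[OF ye] in simp_all)
qed

text \<open>On elements that come from the comma category, naturality of \<tau> undoes the detour
  through the universal element.\<close>

lemma proj_op_eq:
  assumes \<tau>: "op_alg K f g h v \<tau>" and x: "gelem K g h v x"
  shows "proj_op v \<tau> (el1 x) = a1 (\<tau> x)"
proof -
  let ?y = "canonical K g h v"
  note v = K.op_algD(1,2)[OF \<tau>]
  note y = P.canonical_univ'[OF v]
  note ye = univ_gelem[OF y]
  obtain n where n: "gmor K x ?y (name K ?y x) n" using K.univ_name[OF y x] .
  have "name E1 (el1 ?y) (el1 x) = a1 (name K ?y x)"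
    by (rule E1.name_eq[OF preserves_univ1[OF y] p1.gelem_map' p1.gmor_map[OF x ye n]]) (rule x)
  moreover have "a1 (\<tau> x) = a1 (\<tau> ?y) \<cdot>1 a1 (name K ?y x)"
    using p1.map_triangle[OF K.op_alg_univ[OF \<tau> y x, symmetric]] K.op_algD(3,4)[OF \<tau> ye] K.name_hom[OF y x] by simp
  ultimately show ?thesis by (simp add: proj_op_def)
qed

text \<open>The condition is tested at the image of the canonical element, which is universal in
  \<open>E1\<close> and has a lift, so that \<open>proj_op_eq\<close> applies.\<close>

lemma proj_op_hom:
  assumes \<sigma>: "op_alg K f g h u \<sigma>" and \<tau>: "op_alg K f g h v \<tau>" and k: "op_hom K g h u \<sigma> v \<tau> k"
  shows "op_hom E1 (a1 g) (a1 h) (a1 u) (proj_op u \<sigma>) (a1 v) (proj_op v \<tau>) (a1 k)"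
proof -
  let ?y = "canonical K g h u"
  note u = K.op_algD(1,2)[OF \<sigma>]
  note v = K.op_algD(1,2)[OF \<tau>]
  note kD = K.op_homD(1-4)[OF k]
  note y = P.canonical_univ'[OF u]
  note ye = univ_gelem[OF y]
  have kye: "gelem K g h v (push K k ?y)"
    using kD v by (intro K.gelem_push[OF ye]) simp_all
  have "a1 k \<cdot>1 a1 (\<sigma> ?y) = a1 (\<tau> (push K k ?y))"
    by (rule p1.map_triangle[OF K.op_homD(5)[OF k ye]]) (use kD K.op_algD(3-5)[OF \<sigma> ye] in simp_all)
  then have e: "a1 k \<cdot>1 proj_op u \<sigma> (el1 ?y) = proj_op v \<tau> (push E1 (a1 k) (el1 ?y))"
    using proj_op_eq[OF \<sigma> ye] proj_op_eq[OF \<tau> kye] p1.map_push[OF ye kD(1,2)] by simp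
  have vk: "a1 v \<cdot>1 a1 k = a1 u" by (rule p1.map_triangle[OF kD(4)]) (use kD v in simp_all)
  show ?thesis
    by (rule E1.op_hom_univ[OF proj_op_alg[OF \<sigma>] proj_op_alg[OF \<tau>] preserves_univ1[OF y] _ _ _ vk e])
      (use kD u v in simp_all)
qed

end

text \<open>
  With \<open>f' : B' \<rightarrow> J\<close> given by \<open>(t, b) \<mapsto> (sup t, f\<^sub>2 b)\<close>, the algebras over \<open>\<sigma>1\<close> are those of the endopolynomial
  \<open>(f', g', h')\<close> on \<open>J\<close>.
\<close>

locale W_step = comma_step E1 E2 H g h u1 y1 b1 b2 pA g' r j1 j2 h' + gluing_polynomial E1 E2 H f g h
  for E1 :: "('o1, 'a1) cat" and E2 :: "('o2, 'a2) cat" and H :: "('o1, 'a1, 'o2, 'a2) func"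
    and f g h u1 y1 b1 b2 pA g' r j1 j2 h' +
  fixes \<sigma>1 f' w \<sigma>2
  assumes \<sigma>1: "op_initial E1 (a1 f) (a1 g) (a1 h) u1 \<sigma>1"
    and f': "f' \<in> Arr E2" "Dom E2 f' = Dom E2 b1" "Cod E2 f' = Dom E2 j1"
      "j1 \<cdot>2 f' = Ha (\<sigma>1 y1) \<cdot>2 b1" "j2 \<cdot>2 f' = a2 f \<cdot>2 b2"
    and \<sigma>2: "op_initial E2 f' g' h' w \<sigma>2"
begin

declare f'(1-3) [simp]

lemma f_props [simp]: "f \<in> Arr K" "Dom K f = Cod K g" "Cod K f = Cod K h"
  using P.poly by simp_all

lemma \<sigma>1_alg: "op_alg E1 (a1 f) (a1 g) (a1 h) u1 \<sigma>1" using \<sigma>1 by (simp add: op_initial_def)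

lemma \<sigma>2_alg: "op_alg E2 f' g' h' w \<sigma>2" using \<sigma>2 by (simp add: op_initial_def)

lemma w [simp]: "w \<in> Arr E2" "Cod E2 w = Dom E2 j1"
  using E2.op_algD(1,2)[OF \<sigma>2_alg] by simp_all

lemmas s1 = E1.op_algD(3-6)[OF \<sigma>1_alg y1e]

declare s1(1-3) [simp]

text \<open>The first component makes the projection to \<open>E1\<close> recover \<sigma>1; the
  second applies the fibre operation to the \<open>E2\<close> part of the element. The two fit
  together because of the equation for \<open>j1 \<cdot>2 f'\<close>.\<close>

definition op where
  "op x = mk (Dom K (gb x)) (tot_obj w) (\<sigma>1 (el1 x)) (\<sigma>2 (down x))"

lemma \<sigma>1_base:
  assumes x: "gelem K g h (tot w) x"
  shows "\<sigma>1 (el1 x) = \<sigma>1 y1 \<cdot>1 base_map x"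
  unfolding base_map_def using E1.op_alg_univ[OF \<sigma>1_alg y1 base_gelem[OF w x]] .

lemma op_arr:
  assumes x: "gelem K g h (tot w) x"
  shows "op x \<in> Arr K" and "tot w \<cdot>K op x = f \<cdot>K gb x"
proof -
  note [simp] = x_props[OF w x] base_map[OF w x]
  note d = down_sel[OF w x]
  have O: "Dom K (gb x) \<in> Obj K" by simp
  note s = E1.op_algD(3-6)[OF \<sigma>1_alg base_gelem[OF w x]]
  note t = E2.op_algD(3-6)[OF \<sigma>2_alg gelem_down[OF w x]]
  have "j1 \<cdot>2 (w \<cdot>2 \<sigma>2 (down x)) = Ha (\<sigma>1 y1) \<cdot>2 (b1 \<cdot>2 gb (down x))"
    unfolding t(4) by (rule E2.reassoc[OF f'(4)]) (use d(1-3) in simp_all)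
  also have "\<dots> = Ha (\<sigma>1 (el1 x)) \<cdot>2 str (Dom K (gb x))"
    unfolding d(4) \<sigma>1_base[OF x] using O by simp
  finally show A: "op x \<in> Arr K"
    using O s t d(1-3) by (simp add: op_def)
  have "j2 \<cdot>2 (w \<cdot>2 \<sigma>2 (down x)) = a2 f \<cdot>2 (b2 \<cdot>2 gb (down x))"
    unfolding t(4) by (rule E2.reassoc[OF f'(5)]) (use d(1-3) in simp_all)
  then have e2: "j2 \<cdot>2 (w \<cdot>2 \<sigma>2 (down x)) = a2 f \<cdot>2 a2 (gb x)" by (simp add: d(5))
  show "tot w \<cdot>K op x = f \<cdot>K gb x"
  proof (rule comma_eqI)
    show "a1 (tot w \<cdot>K op x) = a1 (f \<cdot>K gb x)"
      using A s(4) by (simp add: op_def del: mk_simps(1))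
    show "a2 (tot w \<cdot>K op x) = a2 (f \<cdot>K gb x)"
      using A e2 t(1-3) by (simp add: op_def del: mk_simps(1))
  qed (use A in \<open>simp_all add: op_def del: mk_simps(1)\<close>)
qed

lemma op_sel [simp]: "Dom K (op x) = Dom K (gb x)" "Cod K (op x) = tot_obj w"
  "a1 (op x) = \<sigma>1 (el1 x)" "a2 (op x) = \<sigma>2 (down x)"
  by (simp_all add: op_def)

lemma op_alg_op: "op_alg K f g h (tot w) op"
proof (rule K.op_algI)
  show "op x = op y \<cdot>K m" if x: "gelem K g h (tot w) x" and y: "gelem K g h (tot w) y" and m: "gmor K x y m n" for x y m n
  proof (rule comma_eqI)
    have mm: "m \<in> Arr K" "Dom K m = Dom K (gb x)" "Cod K m = Dom K (gb y)" using m by (simp_all add: gmor_def)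
    note A = op_arr(1)[OF x] op_arr(1)[OF y]
    have bx: "gelem E1 (a1 g) (a1 h) u1 (el1 x)" and by': "gelem E1 (a1 g) (a1 h) u1 (el1 y)"
      using base_gelem[OF w x] base_gelem[OF w y] .
    show "a1 (op x) = a1 (op y \<cdot>K m)"
      using E1.op_algD(7)[OF \<sigma>1_alg bx by' p1.gmor_map[OF x y m]] A mm by simp
    show "a2 (op x) = a2 (op y \<cdot>K m)"
      using E2.op_algD(7)[OF \<sigma>2_alg gelem_down[OF w x] gelem_down[OF w y] gmor_down(1)[OF w x y m]] A mm by simp
    show "Dom K (op x) = Dom K (op y \<cdot>K m)" "Cod K (op x) = Cod K (op y \<cdot>K m)" using A mm by simp_all
  qed
qed (use op_arr in simp_all)

text \<open>The canonical element of the comma category projects to a universal element, at which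
  \<sigma>1 is determined by a single value.\<close>

lemma \<sigma>1_eq_proj_op:
  assumes x: "gelem E1 (a1 g) (a1 h) u1 x"
  shows "\<sigma>1 x = proj_op (tot w) op x"
proof -
  have u: "tot w \<in> Arr K" "Cod K (tot w) = Cod K f" by simp_all
  note y = preserves_univ1[OF P.canonical_univ'[OF u], unfolded tot_sel]
  show ?thesis using E1.op_alg_univ[OF \<sigma>1_alg y x] by (simp add: proj_op_def)
qed

lemma proj_op_initial: "op_initial E1 (a1 f) (a1 g) (a1 h) u1 (proj_op (tot w) op)"
  by (rule E1.op_initial_cong[OF \<sigma>1 \<sigma>1_eq_proj_op])

section \<open>Initiality of the glued algebra\<close>

context
  fixes v \<tau>
  assumes \<tau>: "op_alg K f g h v \<tau>"
begin

lemma v [simp]: "v \<in> Arr K" "Cod K v = Cod K h"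
  using K.op_algD(1,2)[OF \<tau>] by simp_all

text \<open>
  The algebra \<open>v : Y \<rightarrow> I\<close> is pulled back along \<open>k1 : W\<^sub>1 \<rightarrow> Y\<^sub>1\<close>: the object \<open>c : H W\<^sub>1 \<times> Y\<^sub>2 \<rightarrow> J\<close> (product over \<open>H Y\<^sub>1\<close>)
  inherits an operation \<open>\<rho>\<close>, and morphisms to \<open>Y\<close> lying over \<open>k1\<close> are the morphisms to \<open>c\<close> in \<open>E2\<close>.
\<close>

lemma hom_op: "\<exists>!k. op_hom K g h (tot w) op v \<tau> k"
proof -
  note \<tau>1 = proj_op_alg[OF \<tau>]
  have O: "Dom K v \<in> Obj K" by simp
  \<comment> \<open>The first component of the homomorphism, dictated by initiality in
    \<open>E1\<close>.\<close>
  obtain k1 where k1: "op_hom E1 (a1 g) (a1 h) u1 \<sigma>1 (a1 v) (proj_op v \<tau>) k1"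
    and k1_unique: "\<And>l. op_hom E1 (a1 g) (a1 h) u1 \<sigma>1 (a1 v) (proj_op v \<tau>) l \<Longrightarrow> l = k1"
    using op_initialE[OF \<sigma>1 \<tau>1] by blast
  have k1D [simp]: "k1 \<in> Arr E1" "Dom E1 k1 = Dom E1 u1" "Cod E1 k1 = o1 (Dom K v)" and vk1: "a1 v \<cdot>1 k1 = u1"
    using E1.op_homD(1-4)[OF k1] by simp_all
  define c1 d where "c1 = pb1 E2 (Ha k1) (str (Dom K v))" and "d = pb2 E2 (Ha k1) (str (Dom K v))"
  have PC: "is_pullback E2 (Ha k1) (str (Dom K v)) c1 d"
    unfolding c1_def d_def using O by (intro E2.pb) simp_all
  have cd [simp]: "c1 \<in> Arr E2" "d \<in> Arr E2" "Dom E2 d = Dom E2 c1" "Cod E2 c1 = Ho (Dom E1 u1)" "Cod E2 d = o2 (Dom K v)"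
    using E2.pullbackD[OF PC] O by simp_all
  have v9: "str (Cod K h) \<cdot>2 a2 v = Ha (a1 v) \<cdot>2 str (Dom K v)" using comma_arrD(9)[of v] by simp
  have "Ha u1 \<cdot>2 c1 = Ha (a1 v) \<cdot>2 (Ha k1 \<cdot>2 c1)"
    by (rule E2.reassoc1[OF H.map_triangle[OF vk1], symmetric]) simp_all
  also have "\<dots> = str (Cod K h) \<cdot>2 (a2 v \<cdot>2 d)"
    unfolding E2.pullbackD(9)[OF PC] by (rule E2.reassoc[OF v9[symmetric]]) (use O in simp_all)
  finally have "Ha u1 \<cdot>2 c1 = str (Cod K h) \<cdot>2 (a2 v \<cdot>2 d)" .
  note cc = E2.pair[OF PJ _ _ _ _ _ this]
  define c where "c = pair E2 j1 j2 c1 (a2 v \<cdot>2 d)"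
  have c [simp]: "c \<in> Arr E2" "Dom E2 c = Dom E2 c1" "Cod E2 c = Dom E2 j1" and j1c: "j1 \<cdot>2 c = c1" and j2c: "j2 \<cdot>2
    c = a2 v \<cdot>2 d"
    unfolding c_def using cc by simp_all
  \<comment> \<open>The cartesian lift of \<open>k1\<close>: an arrow over \<open>I\<close> from
    \<open>tot c\<close> to \<open>v\<close>.\<close>
  define \<kappa> where "\<kappa> = mk (tot_obj c) (Dom K v) k1 d"
  have \<kappa>: "\<kappa> \<in> Arr K" unfolding \<kappa>_def using O E2.pullbackD(9)[OF PC] j1c by simp
  have \<kappa>_sel [simp]: "Dom K \<kappa> = tot_obj c" "Cod K \<kappa> = Dom K v" "a1 \<kappa> = k1" "a2 \<kappa> = d" by
    (simp_all add: \<kappa>_def)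
  have v\<kappa>: "v \<cdot>K \<kappa> = tot c"
    by (rule comma_eqI) (use \<kappa> vk1 j2c in simp_all)
  let ?t = "\<lambda>z. \<tau> (push K \<kappa> (up c z))"
  \<comment> \<open>The first coordinate is forced, because the value must lie over
    \<open>f'\<close> in \<open>J\<close>; the second is \<tau> after transport along \<kappa>. They
    agree over \<open>H Y\<^sub>1\<close> because \<open>k1\<close> is a homomorphism.\<close>
  define \<rho> where "\<rho> z = pair E2 c1 d (j1 \<cdot>2 (f' \<cdot>2 gb z)) (a2 (?t z))" for z
  have \<kappa>up: "gelem K g h v (push K \<kappa> (up c z))" if z: "gelem E2 g' h' c z" for z
    using \<kappa> v\<kappa> by (intro K.gelem_push[OF gelem_up[OF z]]) simp_all
  have t: "?t z \<in> Arr K" "Dom K (?t z) = gob z" "Cod K (?t z) = Dom K v" "v \<cdot>K ?t z = f \<cdot>K gb (up c z)"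
    "a1 (?t z) = k1 \<cdot>1 \<sigma>1 y1" if z: "gelem E2 g' h' c z" for z
  proof -
    show "?t z \<in> Arr K" "Dom K (?t z) = gob z" "Cod K (?t z) = Dom K v" "v \<cdot>K ?t z = f \<cdot>K gb (up c z)"
      using K.op_algD(3-6)[OF \<tau> \<kappa>up[OF z]] by simp_all
    have "a1 (?t z) = proj_op v \<tau> (push E1 k1 y1)"
      using proj_op_eq[OF \<tau> \<kappa>up[OF z]] p1.map_push[OF gelem_up[OF z] \<kappa>] by (simp add: map_gel_up)
    then show "a1 (?t z) = k1 \<cdot>1 \<sigma>1 y1" using E1.op_homD(5)[OF k1 y1e] by simp
  qed
  have \<rho>: "\<rho> z \<in> Arr E2" "Dom E2 (\<rho> z) = Dom E2 (gb z)" "Cod E2 (\<rho> z) = Dom E2 c1"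
    "c1 \<cdot>2 \<rho> z = j1 \<cdot>2 (f' \<cdot>2 gb z)" "d \<cdot>2 \<rho> z = a2 (?t z)" "c \<cdot>2 \<rho> z = f' \<cdot>2 gb
      z" if z: "gelem E2 g' h' c z" for z
  proof -
    note [simp] = fibre_props[OF z] up_obj[OF z] and tz = t[OF z]
    have "j1 \<cdot>2 (f' \<cdot>2 gb z) = Ha (\<sigma>1 y1) \<cdot>2 (b1 \<cdot>2 gb z)"
      by (rule E2.reassoc[OF f'(4)]) simp_all
    then have "Ha k1 \<cdot>2 (j1 \<cdot>2 (f' \<cdot>2 gb z)) = str (Dom K v) \<cdot>2 a2 (?t z)"
      using comma_arrD(9)[OF tz(1)] tz by simp
    note p = E2.pair[OF PC _ _ _ _ _ this]
    show r: "\<rho> z \<in> Arr E2" "Dom E2 (\<rho> z) = Dom E2 (gb z)" "Cod E2 (\<rho> z) = Dom E2 c1"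
      "c1 \<cdot>2 \<rho> z = j1 \<cdot>2 (f' \<cdot>2 gb z)" "d \<cdot>2 \<rho> z = a2 (?t z)"
      unfolding \<rho>_def using p tz O by simp_all
    have 1: "j1 \<cdot>2 (c \<cdot>2 \<rho> z) = j1 \<cdot>2 (f' \<cdot>2 gb z)"
      using E2.reassoc1[OF j1c, of "\<rho> z"] r by simp
    have "j2 \<cdot>2 (c \<cdot>2 \<rho> z) = a2 v \<cdot>2 (d \<cdot>2 \<rho> z)"
      by (rule E2.reassoc[OF j2c]) (use r(1-3) in simp_all)
    also have "\<dots> = a2 f \<cdot>2 (b2 \<cdot>2 gb z)"
      using p2.map_square[OF tz(4)] tz(1-3) up_arr(1)[OF z] by (simp add: r(5) del: mk_simps(1))
    also have "\<dots> = j2 \<cdot>2 (f' \<cdot>2 gb z)"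
      by (rule E2.reassoc[OF f'(5), symmetric]) simp_all
    finally have 2: "j2 \<cdot>2 (c \<cdot>2 \<rho> z) = j2 \<cdot>2 (f' \<cdot>2 gb z)" .
    show "c \<cdot>2 \<rho> z = f' \<cdot>2 gb z"
      by (rule E2.pullback_eqI[OF PJ]) (use 1 2 r(1-3) in simp_all)
  qed
  have \<rho>_alg: "op_alg E2 f' g' h' c \<rho>"
  proof (rule E2.op_algI)
    fix z z' m n assume z: "gelem E2 g' h' c z" and z': "gelem E2 g' h' c z'" and m: "gmor E2 z z' m n"
    note [simp] = fibre_props[OF z] fibre_props[OF z'] up_obj[OF z] up_obj[OF z']
    have mm: "m \<in> Arr E2" "Dom E2 m = Dom E2 (gb z)" "Cod E2 m = Dom E2 (gb z')" "gb z' \<cdot>2 m = gb z"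
      using m by (simp_all add: gmor_def)
    let ?M = "mk (gob z) (gob z') (Ident E1 (Dom E1 (gb y1))) m"
    note M = gmor_up[OF z z' m]
    have MA: "?M \<in> Arr K" using M unfolding gmor_def in_hom by blast
    have "gmor K (push K \<kappa> (up c z)) (push K \<kappa> (up c z')) ?M (mk (qob z) (qob z') (Ident E1 (Dom E1 (gp y1))) n)"
      by (rule K.gmor_push[OF gelem_up[OF z] gelem_up[OF z'] \<kappa> _ M]) simp
    from K.op_algD(7)[OF \<tau> \<kappa>up[OF z] \<kappa>up[OF z'] this]
    have "a2 (?t z) = a2 (?t z') \<cdot>2 m"
      using MA t(1-3)[OF z'] by (simp del: mk_simps(1))
    then have 1: "d \<cdot>2 \<rho> z = d \<cdot>2 (\<rho> z' \<cdot>2 m)"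
      using E2.reassoc1[OF \<rho>(5)[OF z'], of m] \<rho>(1-3)[OF z'] \<rho>(5)[OF z] mm by simp
    have 2: "c1 \<cdot>2 \<rho> z = c1 \<cdot>2 (\<rho> z' \<cdot>2 m)"
      using E2.reassoc1[OF \<rho>(4)[OF z'], of m] \<rho>(1-3)[OF z'] \<rho>(4)[OF z] mm by simp
    show "\<rho> z = \<rho> z' \<cdot>2 m"
      by (rule E2.pullback_eqI[OF PC]) (use 1 2 \<rho>(1-3)[OF z] \<rho>(1-3)[OF z'] mm in simp_all)
  qed (use \<rho> in simp_all)
  obtain k2 where k2: "op_hom E2 g' h' w \<sigma>2 c \<rho> k2"
    and k2_unique: "\<And>l. op_hom E2 g' h' w \<sigma>2 c \<rho> l \<Longrightarrow> l = k2"
    using op_initialE[OF \<sigma>2 \<rho>_alg] by blast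
  \<comment> \<open>An arrow \<open>l\<close> over \<open>J\<close> into \<open>c\<close> is
    regarded as an arrow with identity first component; following it by \<kappa> gives the arrow
    with components \<open>k1\<close> and \<open>d \<cdot>2 l\<close>.\<close>
  have emb: "mk (tot_obj w) (tot_obj c) (Ident E1 (Dom E1 u1)) l \<in> Arr K"
      "\<kappa> \<cdot>K mk (tot_obj w) (tot_obj c) (Ident E1 (Dom E1 u1)) l = mk (tot_obj w) (Dom K v) k1 (d \<cdot>2 l)"
    if l: "l \<in> Arr E2" "Dom E2 l = Dom E2 w" "Cod E2 l = Dom E2 c1" "c \<cdot>2 l = w" for l
    using l by (simp_all add: \<kappa>_def)
  have push_up: "?t (push E2 l z) = \<tau> (push K (mk (tot_obj w) (Dom K v) k1 (d \<cdot>2 l)) (up w z))"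
    if l: "l \<in> Arr E2" "Dom E2 l = Dom E2 w" "Cod E2 l = Dom E2 c1" "c \<cdot>2 l = w" and z: "gelem E2 g' h' w z" for l z
    using K.push_push[OF gelem_up[OF z] emb(1)[OF l] _ \<kappa>] emb(2)[OF l] up_push[OF z, of c l] by simp
  show ?thesis
  proof (rule ex1I)
    note k2D = E2.op_homD(1-4)[OF k2]
    have k2D: "k2 \<in> Arr E2" "Dom E2 k2 = Dom E2 w" "Cod E2 k2 = Dom E2 c1" "c \<cdot>2 k2 = w" using k2D by simp_all
    \<comment> \<open>The fibre homomorphism \<open>k2\<close> followed by \<kappa>.\<close>
    let ?k = "mk (tot_obj w) (Dom K v) k1 (d \<cdot>2 k2)"
    have k: "?k \<in> Arr K" using emb[OF k2D] \<kappa> K.arr_cmp[OF emb(1)[OF k2D] \<kappa>] by (simp del: mk_simps(1))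
    have vk: "v \<cdot>K ?k = tot w"
    proof (rule comma_eqI)
      show "a2 (v \<cdot>K ?k) = a2 (tot w)"
        using E2.reassoc[OF j2c, of k2] k2D k by (simp del: mk_simps(1))
    qed (use k vk1 in \<open>simp_all del: mk_simps(1)\<close>)
    show "op_hom K g h (tot w) op v \<tau> ?k"
      unfolding op_hom_def
    proof (intro conjI allI impI)
      fix x assume x: "gelem K g h (tot w) x"
      note [simp] = x_props[OF w x]
      note dx = gelem_down[OF w x]
      note ux = gelem_up[OF dx]
      have kx: "gelem K g h v (push K ?k x)" and kux: "gelem K g h v (push K ?k (up w (down x)))"
        using k vk by (auto intro!: K.gelem_push[OF x] K.gelem_push[OF ux] simp del: mk_simps(1))
      \<comment> \<open>\<open>push_up\<close> evaluates \<tau> only at elements pushed from the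
        form \<open>up w z\<close>, so \<open>x\<close> is replaced by \<open>up w (down x)\<close>.
        The base arrow \<open>?M\<close> is an identity in \<open>E2\<close> and leaves second
        components of values unchanged.\<close>
      let ?M = "mk (Dom K (gb x)) (gob (down x)) (base_map x) (Ident E2 (o2 (Dom K (gb x))))"
      obtain n where n: "gmor K x (up w (down x)) ?M n" using gmor_up_down[OF w x] by blast
      have MA: "?M \<in> Arr K" using n unfolding gmor_def in_hom by blast
      have "gmor K (push K ?k x) (push K ?k (up w (down x))) ?M n"
        by (rule K.gmor_push[OF x ux k _ n]) simp
      note tn = K.op_algD(7)[OF \<tau> kx kux this]
      note tk = K.op_algD(3-5)[OF \<tau> kux]
      have tk2: "a2 (\<tau> (push K ?k x)) = a2 (\<tau> (push K ?k (up w (down x))))"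
        using tn tk MA down_sel(2)[OF w x] by (simp del: mk_simps(1))
      have sx: "\<sigma>2 (down x) \<in> Arr E2" "Cod E2 (\<sigma>2 (down x)) = Dom E2 w"
        using E2.op_algD(3,5)[OF \<sigma>2_alg dx] .
      have k2x: "gelem E2 g' h' c (push E2 k2 (down x))"
        using k2D by (intro E2.gelem_push[OF dx]) simp_all
      have "d \<cdot>2 (k2 \<cdot>2 \<sigma>2 (down x)) = a2 (?t (push E2 k2 (down x)))"
        using E2.op_homD(5)[OF k2 dx] \<rho>(5)[OF k2x] by simp
      also have "\<dots> = a2 (\<tau> (push K ?k x))" using push_up[OF k2D dx] tk2 by simp
      finally have e2: "d \<cdot>2 (k2 \<cdot>2 \<sigma>2 (down x)) = a2 (\<tau> (push K ?k x))" .
      have e1: "k1 \<cdot>1 \<sigma>1 (el1 x) = a1 (\<tau> (push K ?k x))"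
        using E1.op_homD(5)[OF k1 base_gelem[OF w x]] proj_op_eq[OF \<tau> kx] p1.map_push[OF x k] by (simp del: mk_simps(1))
      show "?k \<cdot>K op x = \<tau> (push K ?k x)"
      proof (rule comma_eqI)
        show "a2 (?k \<cdot>K op x) = a2 (\<tau> (push K ?k x))"
          using k op_arr(1)[OF x] e2 sx k2D by (simp del: mk_simps(1))
        show "a1 (?k \<cdot>K op x) = a1 (\<tau> (push K ?k x))"
          using k op_arr(1)[OF x] e1 by (simp del: mk_simps(1))
      qed (use k op_arr(1)[OF x] K.op_algD(3-5)[OF \<tau> kx] in \<open>simp_all del: mk_simps(1)\<close>)
    qed (use k vk in \<open>simp_all del: mk_simps(1)\<close>)
    fix l assume l: "op_hom K g h (tot w) op v \<tau> l"
    note lD = K.op_homD(1-4)[OF l]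
    \<comment> \<open>A homomorphism projects to one out of \<sigma>1, so its first component can
      only be \<open>k1\<close>.\<close>
    have "op_hom E1 (a1 g) (a1 h) u1 (proj_op (tot w) op) (a1 v) (proj_op v \<tau>) (a1 l)"
      using proj_op_hom[OF op_alg_op \<tau> l] by simp
    then have "op_hom E1 (a1 g) (a1 h) u1 \<sigma>1 (a1 v) (proj_op v \<tau>) (a1 l)"
      by (simp add: op_hom_def \<sigma>1_eq_proj_op)
    then have l1: "a1 l = k1" by (rule k1_unique)
    have "Ha k1 \<cdot>2 (j1 \<cdot>2 w) = str (Dom K v) \<cdot>2 a2 l"
      using comma_arrD(9)[OF lD(1)] lD l1 by simp
    note p = E2.pair[OF PC _ _ _ _ _ this]
    \<comment> \<open>The factorization of \<open>l\<close> through \<kappa>, obtained from the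
      pullback \<open>PC\<close>; it will be identified with \<open>k2\<close>.\<close>
    let ?l = "pair E2 c1 d (j1 \<cdot>2 w) (a2 l)"
    have p: "?l \<in> Arr E2" "Dom E2 ?l = Dom E2 w" "Cod E2 ?l = Dom E2 c1" "c1 \<cdot>2 ?l = j1 \<cdot>2 w" "d \<cdot>2 ?l = a2 l"
      using p lD O by simp_all
    have vl: "a2 v \<cdot>2 a2 l = j2 \<cdot>2 w"
      using p2.map_triangle[OF lD(4)] lD by simp
    have cl: "c \<cdot>2 ?l = w"
      by (rule E2.pullback_eqI[OF PJ])
        (use p lD vl E2.reassoc1[OF j1c, of ?l] E2.reassoc[OF j2c, of ?l] in simp_all)
    note pl = p(1-3) cl
    have lk: "mk (tot_obj w) (Dom K v) k1 (d \<cdot>2 ?l) = l"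
      by (rule comma_eqI) (use lD l1 p in simp_all)
    have "op_hom E2 g' h' w \<sigma>2 c \<rho> ?l"
      unfolding op_hom_def
    proof (intro conjI allI impI)
      fix z assume z: "gelem E2 g' h' w z"
      note [simp] = fibre_props[OF z]
      note s = E2.op_algD(3-6)[OF \<sigma>2_alg z]
      have lz: "gelem E2 g' h' c (push E2 ?l z)" using p cl by (intro E2.gelem_push[OF z]) simp_all
      note uz = gelem_up[OF z]
      have "c1 \<cdot>2 (?l \<cdot>2 \<sigma>2 z) = j1 \<cdot>2 (w \<cdot>2 \<sigma>2 z)"
        by (rule E2.reassoc[OF p(4)]) (use p(1-3) s(1-3) in simp_all)
      then have 1: "c1 \<cdot>2 (?l \<cdot>2 \<sigma>2 z) = c1 \<cdot>2 \<rho> (push E2 ?l z)"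
        using \<rho>(4)[OF lz] by (simp only: s(4) push_simps)
      have "d \<cdot>2 (?l \<cdot>2 \<sigma>2 z) = a2 l \<cdot>2 \<sigma>2 z"
        by (rule E2.reassoc1[OF p(5)]) (use p(1-3) s(1-3) in simp_all)
      also have "\<dots> = a2 (\<tau> (push K l (up w z)))"
        using p2.map_triangle[OF K.op_homD(5)[OF l uz]] op_arr(1)[OF uz] lD(1-3) down_up(1)[OF z] by simp
      also have "\<dots> = d \<cdot>2 \<rho> (push E2 ?l z)"
        unfolding \<rho>(5)[OF lz] push_up[OF pl z] lk ..
      finally have 2: "d \<cdot>2 (?l \<cdot>2 \<sigma>2 z) = d \<cdot>2 \<rho> (push E2 ?l z)" .
      show "?l \<cdot>2 \<sigma>2 z = \<rho> (push E2 ?l z)"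
        by (rule E2.pullback_eqI[OF PC]) (use 1 2 p(1-3) s(1-3) \<rho>(1-3)[OF lz] in simp_all)
    qed (use p cl in simp_all)
    then have "?l = k2" by (rule k2_unique)
    then show "l = ?k" using lk by simp
  qed
qed

end

lemma op_initial_op: "op_initial K f g h (tot w) op"
  unfolding op_initial_def using op_alg_op hom_op by blast

end

text \<open>The second conclusion keeps the fact that this particular initial operation projects to
  an initial one; preservation for arbitrary initial algebras is transported from it.\<close>

lemma (in gluing_polynomial) op_initial_exists:
  assumes "has_W_types E1" "has_W_types E2"
  obtains u \<sigma> where "op_initial K f g h u \<sigma>" "op_initial E1 (a1 f) (a1 g) (a1 h) (a1 u) (proj_op u \<sigma>)"
proof -
  interpret P1: polynomial E1 "a1 f" "a1 g" "a1 h" by standard (simp_all add: P.poly)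
  have "endopolynomial E1 (Cod E1 (a1 f)) (a1 f) (a1 g) (a1 h)"
    unfolding endopolynomial_def using P.poly by auto
  then obtain X where "initial P1.algs X" using assms(1) P.poly unfolding has_W_types_def
    by (metis E1.cod_obj P1.poly(1))
  then obtain u1 s1 where \<sigma>1: "op_initial E1 (a1 f) (a1 g) (a1 h) u1 (\<lambda>x. s1 \<cdot>1 name E1 (canonical E1 (a1 g)
    (a1 h) u1) x)"
    (is "op_initial _ _ _ _ _ ?\<sigma>1") by (rule P1.op_initial_if_initial)
  have \<sigma>1a: "op_alg E1 (a1 f) (a1 g) (a1 h) u1 ?\<sigma>1" using \<sigma>1 by (simp add: op_initial_def)
  let ?y1 = "canonical E1 (a1 g) (a1 h) u1"
  have y1: "univ E1 (a1 g) (a1 h) u1 ?y1" using E1.op_algD(1,2)[OF \<sigma>1a] by (rule P1.canonical_univ')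
  note s = E1.op_algD(3-6)[OF \<sigma>1a univ_gelem[OF y1]]
  have gh: "g \<in> Arr K" "h \<in> Arr K" "Dom K h = Dom K g" using P.poly by simp_all
  obtain b1 b2 pA g' r j1 j2 h' where "comma_step E1 E2 H g h u1 ?y1 b1 b2 pA g' r j1 j2 h'"
    using comma_step_exists[OF gh y1] .
  then interpret S: comma_step E1 E2 H g h u1 ?y1 b1 b2 pA g' r j1 j2 h' .
  have f9: "str (Cod K h) \<cdot>2 a2 f = Ha (a1 f) \<cdot>2 str (Cod K g)"
    using comma_arrD(9)[OF P.poly(1)] P.poly by simp
  \<comment> \<open>The coordinates of \<open>f'\<close> agree over \<open>H I\<^sub>1\<close> by
    the image of the algebra law of \<open>u1\<close>, the square \<open>PB\<close> and the square
    that makes \<open>f\<close> an arrow.\<close>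
  have "Ha u1 \<cdot>2 (Ha (?\<sigma>1 ?y1) \<cdot>2 b1) = Ha (a1 f) \<cdot>2 (Ha (gb ?y1) \<cdot>2 b1)"
    by (rule E2.reassoc[OF H.map_square[OF s(4)]]) (use s(1-3) P.poly in simp_all)
  also have "\<dots> = str (Cod K h) \<cdot>2 (a2 f \<cdot>2 b2)"
    unfolding E2.pullbackD(9)[OF S.PB] by (rule E2.reassoc[OF f9[symmetric]]) (use P.poly in simp_all)
  finally have e: "Ha u1 \<cdot>2 (Ha (?\<sigma>1 ?y1) \<cdot>2 b1) = str (Cod K h) \<cdot>2 (a2 f \<cdot>2 b2)" .
  let ?f' = "pair E2 j1 j2 (Ha (?\<sigma>1 ?y1) \<cdot>2 b1) (a2 f \<cdot>2 b2)"
  have f': "?f' \<in> Arr E2" "Dom E2 ?f' = Dom E2 b1" "Cod E2 ?f' = Dom E2 j1"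
      "j1 \<cdot>2 ?f' = Ha (?\<sigma>1 ?y1) \<cdot>2 b1" "j2 \<cdot>2 ?f' = a2 f \<cdot>2 b2"
    using E2.pair[OF S.PJ _ _ _ _ _ e] s(1-3) P.poly by simp_all
  interpret P2: polynomial E2 ?f' g' h' by standard (use f'(1-3) in simp_all)
  have "endopolynomial E2 (Cod E2 ?f') ?f' g' h'"
    unfolding endopolynomial_def using P2.poly by auto
  then obtain X' where "initial P2.algs X'" using assms(2) unfolding has_W_types_def
    by (metis E2.cod_obj P2.poly(1))
  then obtain w s2 where \<sigma>2: "op_initial E2 ?f' g' h' w (\<lambda>x. s2 \<cdot>2 name E2 (canonical E2 g' h' w) x)"
    by (rule P2.op_initial_if_initial)
  interpret W: W_step E1 E2 H f g h u1 ?y1 b1 b2 pA g' r j1 j2 h' ?\<sigma>1 ?f' w "\<lambda>x. s2 \<cdot>2 name E2 (canonical E2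
    g' h' w) x"
    by standard (fact \<sigma>1 f' \<sigma>2)+
  show ?thesis
    using that[OF W.op_initial_op] W.proj_op_initial by simp
qed

section \<open>Translation back to initial algebras\<close>

context gluing
begin

lemma endopolynomial_comma:
  assumes "I \<in> Obj K" "endopolynomial K I f g h"
  shows "gluing_polynomial E1 E2 H f g h" "Cod K f = I"
proof -
  show "Cod K f = I" using assms by (auto simp: endopolynomial_def)
  show "gluing_polynomial E1 E2 H f g h"
    by unfold_locales (use assms in \<open>auto simp: endopolynomial_def\<close>)
qed

lemma has_W_types_comma:
  assumes "has_W_types E1" "has_W_types E2"
  shows "has_W_types K"
  unfolding has_W_types_def
proof (intro conjI lccc_comma ballI allI impI)
  fix I f g h assume I: "I \<in> Obj K" "endopolynomial K I f g h"
  interpret gluing_polynomial E1 E2 H f g h by (rule endopolynomial_comma(1)[OF I])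
  obtain u \<sigma> where "op_initial K f g h u \<sigma>" using op_initial_exists[OF assms] .
  from P.initial_if_op_initial[OF this]
  show "\<exists>W. initial (Alg (slice K I) (poly_func K f g h)) W"
    unfolding endopolynomial_comma(2)[OF I] by blast
qed

lemma preserves_W_types_comma:
  assumes "has_W_types E1" "has_W_types E2"
  shows "preserves_W_types K E1 pr1"
  unfolding preserves_W_types_def preserves_initial_def
proof (intro conjI lcc_functor_proj1 ballI allI impI)
  fix I f g h X assume I: "I \<in> Obj K" "endopolynomial K I f g h"
    and X: "initial (Alg (slice K I) (poly_func K f g h)) X"
  interpret gluing_polynomial E1 E2 H f g h by (rule endopolynomial_comma(1)[OF I])
  note Cf = endopolynomial_comma(2)[OF I]
  obtain u s where Xu: "X = (u, (f \<cdot>K gb (canonical K g h u), s, u))" and XA: "X \<in> Obj P.algs"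
    and u: "op_initial K f g h u (\<lambda>x. s \<cdot>K name K (canonical K g h u) x)" (is "op_initial _ _ _ _ _ ?\<sigma>")
    using P.op_initial_if_initial X unfolding Cf by metis
  have ua: "op_alg K f g h u ?\<sigma>" using u by (simp add: op_initial_def)
  note uD = K.op_algD(1,2)[OF ua]
  obtain v \<tau> where v: "op_initial K f g h v \<tau>" and v1: "op_initial E1 (a1 f) (a1 g) (a1 h) (a1 v) (proj_op v \<tau>)"
    using op_initial_exists[OF assms] .
  have va: "op_alg K f g h v \<tau>" using v by (simp add: op_initial_def)
  obtain i where i: "op_hom K g h v \<tau> u ?\<sigma> i" using op_initialE[OF v ua] by blast
  obtain j where j: "op_hom K g h u ?\<sigma> v \<tau> j" using op_initialE[OF u va] by blast
  \<comment> \<open>The initial \<open>u\<close> has no endomorphism besides the identity.\<close>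
  have ij: "i \<cdot>K j = Ident K (Dom K u)"
    using op_initialE[OF u ua] K.op_hom_comp[OF ua va ua j i] K.op_hom_ident[OF ua] by metis
  have "op_initial E1 (a1 f) (a1 g) (a1 h) (a1 u) (proj_op u ?\<sigma>)"
  proof (rule E1.op_initial_transport[OF v1 proj_op_alg[OF ua] proj_op_hom[OF va ua i] proj_op_hom[OF ua va j]])
    show "a1 i \<cdot>1 a1 j = Ident E1 (Dom E1 (a1 u))"
      using p1.map_triangle[OF ij] K.op_homD(1-3)[OF i] K.op_homD(1-3)[OF j] uD by simp
  qed
  \<comment> \<open>Evaluating at the canonical element gives back the structure map, which turns
    \<open>proj_op u ?\<sigma>\<close> into the operation expected by
    \<open>alg_func_initial\<close>.\<close>
  moreover have "?\<sigma> (canonical K g h u) = s"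
  proof -
    have "s \<in> Arr K" "Dom K s = Dom K (gb (canonical K g h u))"
      using P.algs_objE[OF XA] Xu by auto
    then show ?thesis by (simp add: K.name_self[OF P.canonical_univ'[OF uD]])
  qed
  ultimately have "op_initial E1 (a1 f) (a1 g) (a1 h) (a1 u)
      (\<lambda>x. a1 s \<cdot>1 name E1 (el1 (canonical K g h u)) x)"
    unfolding proj_op_def by simp
  from p1.alg_func_initial[OF P.polynomial_axioms uD this]
  show "initial (Alg (slice E1 (OMap pr1 I)) (poly_func E1 (a1 f) (a1 g) (a1 h))) (OMap (alg_func K E1 pr1 f g h) X)"
    unfolding Xu Cf .
qed

end

theorem corollary37:
  fixes E1 :: "('o1, 'a1) cat"
    and E2 :: "('o2, 'a2) cat"
    and H :: "('o1, 'a1, 'o2, 'a2) func"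
  assumes "extensive E1" and "lccc E1"
    and "extensive E2" and "lccc E2"
    and "cartesian_functor E1 E2 H"
    and "has_W_types E1" and "has_W_types E2"
  shows "has_W_types (comma E1 E2 H) \<and> preserves_W_types (comma E1 E2 H) E1 comma_proj1"
proof -
  interpret gluing E1 E2 H
    using assms(2,4,5)
    by unfold_locales (auto simp: lccc_def cartesian_functor_def category_def is_functor_def)
  show ?thesis using has_W_types_comma preserves_W_types_comma assms(6,7) by blast
qed

end
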